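(* Let $\mathcal I=(-1,1)$ and let $\mathcal B\subset L^2(\mathcal I,\mathbb R^{q})$, $q=m+p$, be a controllable linear differential behavior with McMillan degree $\mathfrak n(\mathcal B)$ and lag $\mathfrak l(\mathcal B)$. Let $L\ge\mathfrak l(\mathcal B)+1$ and let $\operatorname{col}(\overline u,\overline y)\in\mathcal B$ be such that $\overline u$ is persistently exciting of order $L+\mathfrak n(\mathcal B)$. Let $K\in\mathbb N$ with $\mathfrak l(\mathcal B)+1\le K\le L$. Then for $\operatorname{col}(u,y)\in H^{L-1}(\mathcal I,\mathbb R^q)$ the following are equivalent: (1) $\operatorname{col}(u,y)\in\mathcal B$; (2) there exists $g\in L^2(\mathcal I,\mathbb R^{Lm+Kp})$ such that $\Lambda_{L,K}(u,y)=\Gamma_{L,K}(\overline u,\overline y)\,g$. Moreover, $\operatorname{rank}\Gamma_{L,K}(\overline u,\overline y)=Lm+\mathfrak n(\mathcal B)$.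
   Context: $\mathbb N$ includes $0$; $\mathcal I=(-1,1)$. For $f\in H^{k-1}(\mathcal I,\mathbb R^d)$, $k\ge1$, $\Lambda_k(f)=\operatorname{col}(f,f^{(1)},\dots,f^{(k-1)})\in L^2(\mathcal I,\mathbb R^{kd})$ (vertical stacking). For $u\in H^{L-1}(\mathcal I,\mathbb R^m)$ and $y\in H^{K-1}(\mathcal I,\mathbb R^p)$, $\Lambda_{L,K}(u,y)=\operatorname{col}(\Lambda_L(u),\Lambda_K(y))$ and $\Gamma_{L,K}(u,y)=\int_{\mathcal I}\Lambda_{L,K}(u,y)\Lambda_{L,K}(u,y)^\top dt$. A function $f:\mathcal I\to\mathbb R^d$ is persistently exciting of order $L\ge1$ if $f\in H^{L-1}(\mathcal I,\mathbb R^d)$ and the Gramian $\Gamma_L(f)=\int_{\mathcal I}\Lambda_L(f)\Lambda_L(f)^\top dt$ is positive definite. A linear differential behavior is a set $\mathcal B=\{w\in L^2(\mathcal I,\mathbb R^q)\mid R(\frac{d}{dt})w=0\}$ with $R(s)=R_0+\dots+R_rs^r\in\mathbb R^{g\times q}[s]$, where $R(\frac{d}{dt})w=0$ is meant weakly: $\sum_{i=0}^r(-1)^i\int_{\mathcal I}w^\top R_i^\top\phi^{(i)}\,dt=0$ for all $\phi\in C_c^\infty(\mathcal I,\mathbb R^g)$. Trajectories are partitioned as $w=\operatorname{col}(u,y)$ with input $u$ ($m$ components) and output $y$ ($p$ components) such that $\mathcal B$ admits an input-state-output representation: matrices $A\in\mathbb R^{n\times n}$, $B\in\mathbb R^{n\times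 m}$, $C\in\mathbb R^{p\times n}$, $D\in\mathbb R^{p\times m}$ such that $w=\operatorname{col}(u,y)\in C^\infty(\overline{\mathcal I},\mathbb R^q)$ belongs to $\mathcal B$ if and only if there is $x\in C^\infty(\overline{\mathcal I},\mathbb R^n)$ with $\frac{d}{dt}x=Ax+Bu$, $y=Cx+Du$. The McMillan degree $\mathfrak n(\mathcal B)$ is the minimal state dimension $n$ among all such representations. With $\mathcal O_k=\operatorname{col}(C,CA,\dots,CA^k)$ (and $\mathcal O_{-1}$ the empty matrix, of rank $0$), the lag is $\mathfrak l(\mathcal B)=\min\{k\in\mathbb N\mid \operatorname{rank}\mathcal O_k=\operatorname{rank}\mathcal O_{k-1}\}$; it does not depend on the chosen representation. $\mathcal B$ is controllable if for all $w_0,w_1\in\mathcal B$ there are $t_1\in(0,1)$ and $w\in\mathcal B$ with $w(t)=w_0(t)$ for (a.e.) $t\in(-1,0]$ and $w(t)=w_1(t-t_1)$ for (a.e.) $t\in[t_1,1)$. *)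

theory Defs
  imports "HOL-Analysis.Analysis" "Jordan_Normal_Form.DL_Rank"
begin

unbundle no vec_syntax
no_notation inner (infix "\<bullet>" 70)

text \<open>
  Vectors and matrices are those of Jordan_Normal_Form, so that all sizes are natural numbers
  (possibly 0). A function on the open interval is represented by a total function on the reals,
  whose values outside of the interval are irrelevant. Elements of \<open>L\<^sup>2\<close> are represented by
  functions, and equality in \<open>L\<^sup>2\<close> is stated as equality almost everywhere.
\<close>

abbreviation time_interval :: "real set" (\<open>\<I>\<close>) where
  "\<I> \<equiv> {-1<..<1}"

definition L2_scalar :: "(real \<Rightarrow> real) set" where
  "L2_scalar = {f. set_borel_measurable lebesgue \<I> f \<and> set_integrable lebesgue \<I> (\<lambda>t. (f t)\<^sup>2)}"

definition L2_vec :: "nat \<Rightarrow> (real \<Rightarrow> real vec) set" where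
  "L2_vec d = {f. (\<forall>t\<in>\<I>. f t \<in> carrier_vec d) \<and> (\<forall>j<d. (\<lambda>t. f t $ j) \<in> L2_scalar)}"

definition test_function :: "(real \<Rightarrow> real) \<Rightarrow> bool" where
  "test_function \<phi> \<longleftrightarrow>
     (\<forall>k t. (deriv ^^ k) \<phi> field_differentiable at t) \<and>
     compact (closure {t. \<phi> t \<noteq> 0}) \<and> closure {t. \<phi> t \<noteq> 0} \<subseteq> \<I>"

definition is_weak_deriv :: "nat \<Rightarrow> (real \<Rightarrow> real) \<Rightarrow> (real \<Rightarrow> real) \<Rightarrow> bool" where
  "is_weak_deriv i f g \<longleftrightarrow>
     (\<forall>\<phi>. test_function \<phi> \<longrightarrow>
        (LINT t:\<I>|lebesgue. f t * (deriv ^^ i) \<phi> t)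
          = (-1) ^ i * (LINT t:\<I>|lebesgue. g t * \<phi> t))"

definition sobolev :: "nat \<Rightarrow> nat \<Rightarrow> (real \<Rightarrow> real vec) set" where
  "sobolev k d = {f \<in> L2_vec d. \<forall>i\<le>k. \<forall>j<d. \<exists>g\<in>L2_scalar. is_weak_deriv i (\<lambda>t. f t $ j) g}"

text \<open>
  The \<open>i\<close>-th weak derivative is unique up to equality almost everywhere; an arbitrary
  representative is chosen (for \<open>i = 0\<close> it agrees with the function almost everywhere).
\<close>

definition weak_deriv :: "nat \<Rightarrow> (real \<Rightarrow> real) \<Rightarrow> real \<Rightarrow> real" where
  "weak_deriv i f = (SOME g. g \<in> L2_scalar \<and> is_weak_deriv i f g)"

text \<open>
  \<open>Lam d k f = col(f, f\<^sup>(\<^sup>1\<^sup>), \<dots>, f\<^sup>(\<^sup>k\<^sup>-\<^sup>1\<^sup>))\<close> for \<open>f\<close> with values in \<open>\<real>\<^sup>d\<close>: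
  entry \<open>a\<close> of the stacked vector is component \<open>a mod d\<close> of block \<open>a div d\<close>.
\<close>

definition Lam :: "nat \<Rightarrow> nat \<Rightarrow> (real \<Rightarrow> real vec) \<Rightarrow> real \<Rightarrow> real vec" where
  "Lam d k f t = vec (k * d) (\<lambda>a. weak_deriv (a div d) (\<lambda>s. f s $ (a mod d)) t)"

definition col_fun :: "(real \<Rightarrow> real vec) \<Rightarrow> (real \<Rightarrow> real vec) \<Rightarrow> real \<Rightarrow> real vec" where
  "col_fun u y t = u t @\<^sub>v y t"

definition Lam2 :: "nat \<Rightarrow> nat \<Rightarrow> nat \<Rightarrow> nat \<Rightarrow> (real \<Rightarrow> real vec) \<Rightarrow> (real \<Rightarrow> real vec) \<Rightarrow> real \<Rightarrow> real vec"
  where "Lam2 m p L K u y = col_fun (Lam m L u) (Lam p K y)"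

definition gramian :: "nat \<Rightarrow> (real \<Rightarrow> real vec) \<Rightarrow> real mat" where
  "gramian N F = mat N N (\<lambda>(i, j). LINT t:\<I>|lebesgue. F t $ i * F t $ j)"

definition Gam :: "nat \<Rightarrow> nat \<Rightarrow> (real \<Rightarrow> real vec) \<Rightarrow> real mat" where
  "Gam d L f = gramian (L * d) (Lam d L f)"

definition Gam2 :: "nat \<Rightarrow> nat \<Rightarrow> nat \<Rightarrow> nat \<Rightarrow> (real \<Rightarrow> real vec) \<Rightarrow> (real \<Rightarrow> real vec) \<Rightarrow> real mat" where
  "Gam2 m p L K u y = gramian (L * m + K * p) (Lam2 m p L K u y)"

definition positive_definite :: "nat \<Rightarrow> real mat \<Rightarrow> bool" where
  "positive_definite N M \<longleftrightarrow>
     M \<in> carrier_mat N N \<and> transpose_mat M = M \<and>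
     (\<forall>v \<in> carrier_vec N. v \<noteq> 0\<^sub>v N \<longrightarrow> 0 < v \<bullet> (M *\<^sub>v v))"

definition persistently_exciting :: "nat \<Rightarrow> nat \<Rightarrow> (real \<Rightarrow> real vec) \<Rightarrow> bool" where
  "persistently_exciting d L f \<longleftrightarrow>
     1 \<le> L \<and> f \<in> sobolev (L - 1) d \<and> positive_definite (L * d) (Gam d L f)"

text \<open>
  Weak solutions of \<open>R(d/dt) w = 0\<close>, where \<open>R(s) = R 0 + \<dots> + R r s\<^sup>r\<close> has \<open>g\<close> rows;
  \<open>w\<^sup>T R\<^sub>i\<^sup>T \<phi>\<^sup>(\<^sup>i\<^sup>)\<close> is written as the scalar product of \<open>R\<^sub>i w\<close> and \<open>\<phi>\<^sup>(\<^sup>i\<^sup>)\<close>.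
\<close>

definition weak_kernel :: "nat \<Rightarrow> nat \<Rightarrow> nat \<Rightarrow> (nat \<Rightarrow> real mat) \<Rightarrow> (real \<Rightarrow> real vec) set" where
  "weak_kernel q g r R = {w \<in> L2_vec q.
     \<forall>\<phi>. (\<forall>j<g. test_function (\<phi> j)) \<longrightarrow>
       (\<Sum>i\<le>r. (-1) ^ i *
          (LINT t:\<I>|lebesgue. (R i *\<^sub>v w t) \<bullet> vec g (\<lambda>j. (deriv ^^ i) (\<phi> j) t))) = 0}"

definition linear_differential_behavior :: "nat \<Rightarrow> (real \<Rightarrow> real vec) set \<Rightarrow> bool" where
  "linear_differential_behavior q \<B> \<longleftrightarrow>
     (\<exists>g r R. (\<forall>i\<le>r. R i \<in> carrier_mat g q) \<and> \<B> = weak_kernel q g r R)"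

text \<open>
  Smoothness on the closed interval \<open>[-1,1]\<close>, with one-sided derivatives at the endpoints:
  \<open>D k\<close> is the \<open>k\<close>-th derivative.
\<close>

definition smooth_closed_scalar :: "(real \<Rightarrow> real) \<Rightarrow> bool" where
  "smooth_closed_scalar f \<longleftrightarrow>
     (\<exists>D :: nat \<Rightarrow> real \<Rightarrow> real. (\<forall>t\<in>{-1..1}. D 0 t = f t) \<and>
        (\<forall>k. \<forall>t\<in>{-1..1}. (D k has_real_derivative D (Suc k) t) (at t within {-1..1})))"

definition smooth_closed :: "nat \<Rightarrow> (real \<Rightarrow> real vec) set" where
  "smooth_closed d = {f. (\<forall>t\<in>{-1..1}. f t \<in> carrier_vec d) \<and>
     (\<forall>j<d. smooth_closed_scalar (\<lambda>t. f t $ j))}"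

definition iso_representation ::
  "nat \<Rightarrow> nat \<Rightarrow> (real \<Rightarrow> real vec) set \<Rightarrow> nat \<Rightarrow> real mat \<Rightarrow> real mat \<Rightarrow> real mat \<Rightarrow> real mat \<Rightarrow> bool" where
  "iso_representation m p \<B> n A B C D \<longleftrightarrow>
     A \<in> carrier_mat n n \<and> B \<in> carrier_mat n m \<and> C \<in> carrier_mat p n \<and> D \<in> carrier_mat p m \<and>
     (\<forall>u \<in> smooth_closed m. \<forall>y \<in> smooth_closed p.
        col_fun u y \<in> \<B> \<longleftrightarrow>
        (\<exists>x \<in> smooth_closed n. \<forall>t\<in>{-1..1}.
           (\<forall>j<n. ((\<lambda>s. x s $ j) has_real_derivative (A *\<^sub>v x t + B *\<^sub>v u t) $ j)
                    (at t within {-1..1})) \<and>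
           y t = C *\<^sub>v x t + D *\<^sub>v u t))"

definition mcmillan_degree :: "nat \<Rightarrow> nat \<Rightarrow> (real \<Rightarrow> real vec) set \<Rightarrow> nat" where
  "mcmillan_degree m p \<B> = (LEAST n. \<exists>A B C D. iso_representation m p \<B> n A B C D)"

text \<open>
  \<open>obs_mat n p A C k\<close> has the \<open>k\<close> blocks \<open>C, C A, \<dots>, C A\<^sup>k\<^sup>-\<^sup>1\<close>, that is, it is the matrix
  usually called \<open>\<O>\<^sub>k\<^sub>-\<^sub>1\<close>; the shift makes the empty matrix \<open>\<O>\<^sub>-\<^sub>1\<close> the case \<open>k = 0\<close>.
\<close>

definition obs_mat :: "nat \<Rightarrow> nat \<Rightarrow> real mat \<Rightarrow> real mat \<Rightarrow> nat \<Rightarrow> real mat" where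
  "obs_mat n p A C k = mat (k * p) n (\<lambda>(i, j). (C * A ^\<^sub>m (i div p)) $$ (i mod p, j))"

definition rep_lag :: "nat \<Rightarrow> nat \<Rightarrow> real mat \<Rightarrow> real mat \<Rightarrow> nat" where
  "rep_lag n p A C =
     (LEAST k. vec_space.rank (Suc k * p) (obs_mat n p A C (Suc k))
             = vec_space.rank (k * p) (obs_mat n p A C k))"

text \<open>All representations of a behavior have the same lag, so any of them may be chosen.\<close>

definition lag :: "nat \<Rightarrow> nat \<Rightarrow> (real \<Rightarrow> real vec) set \<Rightarrow> nat" where
  "lag m p \<B> = (SOME l. \<exists>n A B C D. iso_representation m p \<B> n A B C D \<and> l = rep_lag n p A C)"

definition controllable :: "(real \<Rightarrow> real vec) set \<Rightarrow> bool" where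
  "controllable \<B> \<longleftrightarrow>
     (\<forall>w0 \<in> \<B>. \<forall>w1 \<in> \<B>. \<exists>t1 \<in> {0<..<1}. \<exists>w \<in> \<B>.
        (AE t\<in>{-1<..0} in lebesgue. w t = w0 t) \<and>
        (AE t\<in>{t1..<1} in lebesgue. w t = w1 (t - t1)))"

end

theory Submission
  imports Defs "HOL-Computational_Algebra.Fundamental_Theorem_Algebra"
begin

text \<open>
  Differential equations satisfied by trajectories are encoded as polynomial rows \<open>r\<close>, acting weakly by
  \<open>r(d/dt) w = 0\<close>. Modulo the equations of a state representation every row acts as a polynomial operator on
  the input plus a constant functional of the state, and the rows for which both parts vanish (null rows) are
  exactly the annihilators of the behavior. Indeed a null row annihilates the smooth trajectories, hence all
  exponential ones, so some nonzero polynomial multiple of it lies in the module of annihilators of the behavior;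
  controllability removes the factor, because a trajectory can be continued by zero near the right end, and a
  distribution killed by a nonzero polynomial in \<open>d/dt\<close> which vanishes on an interval vanishes everywhere.

  With a minimal, hence observable, representation the null rows are generated by those of degree below \<open>L\<close> in
  the input and below \<open>K\<close> in the output, and such rows are the coefficient vectors \<open>v\<close> with
  \<open>v \<bullet> \<Lambda>(u, y) = 0\<close> for all trajectories. If a row of these degrees annihilates the excited trajectory, then
  multiplying it by a monic polynomial that annihilates its state functional leaves an operator of order below
  \<open>L + n\<close> on the input alone, which is zero by excitation; by torsion-freeness the row is a null row. So
  the kernel of the Gramian is the space of bounded null rows, its image is the orthogonal complement, and the
  rank is the dimension of the image \<open>\<real>\<^sup>L\<^sup>m \<times> \<real>\<^sup>n\<close> of the reduction map.
\<close>

section \<open>Smooth functions and bumps\<close>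

text \<open>A state representation is promised only for trajectories that are smooth up to the
  boundary, while the excited trajectory and the candidates are merely weak solutions; no state is
  ever constructed for them. This is why everything runs through annihilating rows: smooth
  trajectories identify the null rows, and the equations found in this way are then tested on
  nonsmooth trajectories. Real exponentials suffice to detect a nonzero polynomial; complex values
  come in because differential operators are inverted one linear factor at a time. The order L + n
  of excitation consists of L for the degree of a bounded row and n for a monic polynomial in A^T
  that kills a given vector of R^n. The condition K > lag leaves room for the relations that express
  C A^lag through the earlier blocks, by which high output derivatives are eliminated. A further
  difficulty is that the output is only known to be square integrable, so the Gramian is meaningful
  only after a regularity argument that obtains the derivatives of the output from those of the
  input.\<close>

definition vd :: "(real \<Rightarrow> 'a::real_normed_vector) \<Rightarrow> real \<Rightarrow> 'a" where
  "vd f = (\<lambda>t. vector_derivative f (at t))"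

definition smooth :: "(real \<Rightarrow> 'a::real_normed_vector) \<Rightarrow> bool" where
  "smooth f \<longleftrightarrow> (\<forall>k t. (vd ^^ k) f differentiable (at t))"

text \<open>Smoothness behaves like a greatest fixed point: most closure properties below follow by
  exhibiting a set of functions that contains the given one and is stable under \<open>vd\<close>,
  without a formula for higher derivatives.\<close>

lemma smooth_coinduct:
  assumes "f \<in> S" and step: "\<And>g. g \<in> S \<Longrightarrow> (\<forall>t. g differentiable (at t)) \<and> vd g \<in> S"
  shows "smooth f"
proof -
  have "(vd ^^ k) f \<in> S" for k
    using assms by (induction k) auto
  then show ?thesis using step by (auto simp: smooth_def)
qed

lemma smooth_vd: "smooth f \<Longrightarrow> smooth (vd f)"
  unfolding smooth_def by (metis funpow_Suc_right o_apply)

lemma smooth_differentiable: "smooth f \<Longrightarrow> f differentiable (at t)"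
  unfolding smooth_def by (metis funpow_0)

lemma smooth_has_vd: "smooth f \<Longrightarrow> (f has_vector_derivative vd f t) (at t)"
  using smooth_differentiable vector_derivative_works by (auto simp: vd_def)

lemma vd_eqI: "(\<And>t. (f has_vector_derivative g t) (at t)) \<Longrightarrow> vd f = g"
  by (auto simp: vd_def vector_derivative_at)

lemma smooth_continuous: "smooth f \<Longrightarrow> continuous_on S f"
  by (meson continuous_at_imp_continuous_on differentiable_imp_continuous_within smooth_differentiable)

lemma smoothI_derivs:
  assumes "\<And>k t. (D k has_vector_derivative D (Suc k) t) (at t)" and "f = D 0"
  shows "smooth f"
proof (rule smooth_coinduct[of _ "range D"])
  fix g assume "g \<in> range D"
  then obtain k where g: "g = D k" by auto
  have "vd g = D (Suc k)" unfolding g by (rule vd_eqI) (rule assms)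
  then show "(\<forall>t. g differentiable at t) \<and> vd g \<in> range D"
    using assms(1)[of k] g differentiableI_vector by blast
qed (use assms in auto)

lemma smooth_linear:
  assumes h: "bounded_linear h" and f: "smooth f"
  shows "smooth (\<lambda>t. h (f t))" and "vd (\<lambda>t. h (f t)) = (\<lambda>t. h (vd f t))"
proof -
  have d: "((\<lambda>t. h (g t)) has_vector_derivative h (vd g t)) (at t)" if "smooth g" for g t
    by (rule bounded_linear.has_vector_derivative[OF h smooth_has_vd[OF that]])
  show "vd (\<lambda>t. h (f t)) = (\<lambda>t. h (vd f t))" by (rule vd_eqI) (rule d[OF f])
  show "smooth (\<lambda>t. h (f t))"
  proof (rule smooth_coinduct[of _ "{\<lambda>t. h (g t) |g. smooth g}"])
    fix k assume "k \<in> {\<lambda>t. h (g t) |g. smooth g}"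
    then obtain g where k: "k = (\<lambda>t. h (g t))" and g: "smooth g" by auto
    have "vd k = (\<lambda>t. h (vd g t))" unfolding k by (rule vd_eqI) (rule d[OF g])
    then show "(\<forall>t. k differentiable at t) \<and> vd k \<in> {\<lambda>t. h (g t) |g. smooth g}"
      using d[OF g] k g smooth_vd differentiableI_vector by blast
  qed (use f in auto)
qed

lemma smooth_const [simp, intro]: "smooth (\<lambda>t. c)"
  by (rule smoothI_derivs[of "\<lambda>k t. if k = 0 then c else 0"]) auto

lemma vd_const [simp]: "vd (\<lambda>t. c) = (\<lambda>t. 0)"
  by (rule vd_eqI) auto

lemma smooth_add:
  assumes f: "smooth f" and g: "smooth g"
  shows "smooth (\<lambda>t. f t + g t)" and "vd (\<lambda>t. f t + g t) = (\<lambda>t. vd f t + vd g t)"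
proof -
  have d: "((\<lambda>t. f t + g t) has_vector_derivative vd f t + vd g t) (at t)"
    if "smooth f" "smooth g" for f g :: "real \<Rightarrow> 'a" and t
    by (intro has_vector_derivative_add smooth_has_vd that)
  show "vd (\<lambda>t. f t + g t) = (\<lambda>t. vd f t + vd g t)" by (rule vd_eqI) (rule d[OF f g])
  show "smooth (\<lambda>t. f t + g t)"
  proof (rule smooth_coinduct[of _ "{\<lambda>t. f t + g t |f g. smooth f \<and> smooth g}"])
    fix k :: "real \<Rightarrow> 'a" assume "k \<in> {\<lambda>t. f t + g t |f g. smooth f \<and> smooth g}"
    then obtain f g where k: "k = (\<lambda>t. f t + g t)" and g: "smooth f" "smooth g" by auto
    have "vd k = (\<lambda>t. vd f t + vd g t)" unfolding k by (rule vd_eqI) (rule d[OF g])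
    then show "(\<forall>t. k differentiable at t) \<and> vd k \<in> {\<lambda>t. f t + g t |f g. smooth f \<and> smooth g}"
      using d[OF g] k g smooth_vd differentiableI_vector by blast
  qed (use f g in auto)
qed

lemma smooth_minus:
  assumes "smooth f"
  shows "smooth (\<lambda>t. - f t)" and "vd (\<lambda>t. - f t) = (\<lambda>t. - vd f t)"
  using smooth_linear[OF bounded_linear_minus[OF bounded_linear_ident] assms] by auto

lemma smooth_cmult:
  fixes f :: "real \<Rightarrow> 'a::real_normed_algebra"
  assumes "smooth f"
  shows "smooth (\<lambda>t. c * f t)" and "vd (\<lambda>t. c * f t) = (\<lambda>t. c * vd f t)"
  using smooth_linear[OF bounded_linear_mult_right assms] by auto

text \<open>The Leibniz rule turns one product into a sum of two, so a set stable under
  differentiation has to contain finite sums of products.\<close>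

inductive_set smooth_products :: "(real \<Rightarrow> 'a::real_normed_algebra) set" where
  prod: "smooth f \<Longrightarrow> smooth g \<Longrightarrow> (\<lambda>t. f t * g t) \<in> smooth_products"
| add: "h \<in> smooth_products \<Longrightarrow> k \<in> smooth_products \<Longrightarrow> (\<lambda>t. h t + k t) \<in> smooth_products"

lemma smooth_mult:
  fixes f g :: "real \<Rightarrow> 'a::real_normed_algebra"
  assumes f: "smooth f" and g: "smooth g"
  shows "smooth (\<lambda>t. f t * g t)" and "vd (\<lambda>t. f t * g t) = (\<lambda>t. f t * vd g t + vd f t * g t)"
proof -
  have d: "((\<lambda>t. f t * g t) has_vector_derivative (f t * vd g t + vd f t * g t)) (at t)"
    if "smooth f" "smooth g" for f g :: "real \<Rightarrow> 'a" and t
    by (intro has_vector_derivative_mult smooth_has_vd that)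
  show "vd (\<lambda>t. f t * g t) = (\<lambda>t. f t * vd g t + vd f t * g t)"
    by (rule vd_eqI) (rule d[OF f g])
  have main: "(\<forall>t. (h has_vector_derivative vd h t) (at t)) \<and> vd h \<in> smooth_products" 
    if "h \<in> smooth_products" for h :: "real \<Rightarrow> 'a"
    using that
  proof induction
    case (prod f g)
    have "vd (\<lambda>t. f t * g t) = (\<lambda>t. f t * vd g t + vd f t * g t)"
      by (rule vd_eqI) (rule d[OF prod])
    then show ?case using d[OF prod] prod by (auto intro!: smooth_products.intros smooth_vd)
  next
    case (add h k)
    have *: "((\<lambda>t. h t + k t) has_vector_derivative (vd h t + vd k t)) (at t)" for t
      using add by (intro has_vector_derivative_add) auto
    then have "vd (\<lambda>t. h t + k t) = (\<lambda>t. vd h t + vd k t)" by (rule vd_eqI)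
    then show ?case using * add by (auto intro!: smooth_products.add)
  qed
  show "smooth (\<lambda>t. f t * g t)"
    by (rule smooth_coinduct[of _ smooth_products])
      (use main f g differentiableI_vector in \<open>blast intro: smooth_products.prod\<close>)+
qed

lemma smooth_affine:
  assumes f: "smooth f" shows "smooth (\<lambda>t. f (a * t + b))"
proof (rule smoothI_derivs[of "\<lambda>k t. a ^ k *\<^sub>R (vd ^^ k) f (a * t + b)"])
  fix k t
  have "((vd ^^ k) f has_vector_derivative (vd ^^ Suc k) f (a * t + b)) (at (a * t + b))"
    using f by (auto simp: smooth_def vd_def vector_derivative_works[symmetric])
  moreover have "((\<lambda>t. a * t + b) has_vector_derivative a) (at t)"
    by (auto intro!: derivative_eq_intros)
  ultimately have "((\<lambda>t. (vd ^^ k) f (a * t + b)) has_vector_derivative a *\<^sub>R (vd ^^ Suc k) f (a * t + b)) (at t)"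
    using vector_diff_chain_at[of "\<lambda>t. a * t + b" a t "(vd ^^ k) f"] by (auto simp: o_def)
  then have "((\<lambda>t. a ^ k *\<^sub>R (vd ^^ k) f (a * t + b)) has_vector_derivative a ^ k *\<^sub>R a *\<^sub>R (vd ^^ Suc k) f (a * t + b)) (at t)"
    by (rule bounded_linear.has_vector_derivative[OF bounded_linear_scaleR_right])
  then show "((\<lambda>t. a ^ k *\<^sub>R (vd ^^ k) f (a * t + b)) has_vector_derivative a ^ Suc k *\<^sub>R (vd ^^ Suc k) f (a * t + b)) (at t)"
    by (simp add: mult.commute)
qed auto

lemma smooth_exp:
  fixes c :: "'a::{real_normed_field,banach}"
  shows "smooth (\<lambda>t. exp (c * of_real t))" and "vd (\<lambda>t. exp (c * of_real t)) = (\<lambda>t. c * exp (c * of_real t))"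
proof -
  have "((\<lambda>t. exp (c * of_real t)) has_vector_derivative c * exp (c * of_real t)) (at t)" for t
  proof -
    have "((\<lambda>z. exp (c * z)) has_field_derivative exp (c * of_real t) * c) (at (of_real t))"
      by (auto intro!: derivative_eq_intros)
    from has_vector_derivative_real_field[OF this] show ?thesis by (simp add: mult.commute)
  qed
  note d = this
  show "vd (\<lambda>t. exp (c * of_real t)) = (\<lambda>t. c * exp (c * of_real t))" by (rule vd_eqI) (rule d)
  show "smooth (\<lambda>t. exp (c * of_real t))"
  proof (rule smoothI_derivs[of "\<lambda>k t. c ^ k * exp (c * of_real t)"])
    fix k t
    show "((\<lambda>t. c ^ k * exp (c * of_real t)) has_vector_derivative c ^ Suc k * exp (c * of_real t)) (at t)"
      using bounded_linear.has_vector_derivative[OF bounded_linear_mult_right d, of "c^k" t]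
      by (simp add: mult_ac)
  qed auto
qed

lemma deriv_eq_vd: "deriv = (vd :: (real \<Rightarrow> real) \<Rightarrow> _)"
  by (auto simp: fun_eq_iff deriv_def vd_def vector_derivative_def has_real_derivative_iff_has_vector_derivative)

section \<open>Flat functions and compactly supported bumps\<close>

definition flat :: "real poly \<Rightarrow> real \<Rightarrow> real" where
  "flat P t = (if t > 0 then poly P (1 / t) * exp (- (1 / t)) else 0)"

lemma poly_div_exp_tendsto_0: "((\<lambda>x. poly P x * exp (- x)) \<longlongrightarrow> 0) at_top" for P :: "real poly"
proof -
  have "((\<lambda>x. \<Sum>i\<le>degree P. coeff P i * (x ^ i / exp x)) \<longlongrightarrow> (\<Sum>i\<le>degree P. coeff P i * 0)) at_top"
    by (intro tendsto_sum tendsto_mult tendsto_const tendsto_power_div_exp_0)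
  moreover have "(\<lambda>x. \<Sum>i\<le>degree P. coeff P i * (x ^ i / exp x)) = (\<lambda>x. poly P x * exp (- x))"
    by (auto simp: poly_altdef sum_distrib_right exp_minus divide_inverse mult.assoc)
  ultimately show ?thesis by simp
qed

text \<open>With s = 1/t the derivative of P(s) exp(-s) is s^2 (P - P')(s) exp(-s). The polynomial
  is kept as a parameter so that the family \<open>flat\<close> is stable under differentiation; at
  0 both one-sided difference quotients tend to 0.\<close>

lemma flat_has_derivative:
  "(flat P has_real_derivative flat (monom 1 2 * (P - pderiv P)) t) (at t)"
proof (cases t "0::real" rule: linorder_cases)
  case less
  have "((\<lambda>_. 0) has_real_derivative 0) (at t)" by simp
  then have "(flat P has_real_derivative 0) (at t)"
    by (rule has_field_derivative_transform_within_open[of _ _ _ "{..<0}"]) (use less in \<open>auto simp: flat_def\<close>)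
  then show ?thesis using less by (simp add: flat_def)
next
  case greater
  have "((\<lambda>s. poly P (1 / s) * exp (- (1 / s))) has_real_derivative
      poly P (1 / t) * (exp (- (1 / t)) * (1 / t\<^sup>2)) + poly (pderiv P) (1 / t) * (- 1 / t\<^sup>2) * exp (- (1 / t))) (at t)"
    using greater by (auto intro!: derivative_eq_intros simp: power2_eq_square)
  then have "(flat P has_real_derivative 
     poly P (1 / t) * (exp (- (1 / t)) * (1 / t\<^sup>2)) + poly (pderiv P) (1 / t) * (- 1 / t\<^sup>2) * exp (- (1 / t))) (at t)"
    by (rule has_field_derivative_transform_within_open[of _ _ _ "{0<..}"]) (use greater in \<open>auto simp: flat_def\<close>)
  moreover have "poly P (1 / t) * (exp (- (1 / t)) * (1 / t\<^sup>2)) + poly (pderiv P) (1 / t) * (- 1 / t\<^sup>2) * exp (- (1 / t))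
    = flat (monom 1 2 * (P - pderiv P)) t"
    using greater by (simp add: flat_def poly_monom field_simps power2_eq_square)
  ultimately show ?thesis by simp
next
  case equal
  have l: "((\<lambda>h. (flat P (0 + h) - flat P 0) / h) \<longlongrightarrow> 0) (at_left 0)"
    by (rule Lim_transform_eventually[of "\<lambda>_. 0"])
      (auto simp: flat_def eventually_at_left_field intro!: exI[of _ "-1"])
  \<comment> \<open>The right difference quotient at 0 is P(1/h) exp(-1/h) / h, and
    \<open>pCons 0 P\<close> is the polynomial that absorbs the factor 1/h.\<close>
  have "((\<lambda>h. poly (pCons 0 P) (1 / h) * exp (- (1 / h))) \<longlongrightarrow> 0) (at_right 0)"
  proof -
    have "filterlim (\<lambda>h::real. 1 / h) at_top (at_right 0)"
      using filterlim_inverse_at_top_right by (simp add: inverse_eq_divide)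
    from filterlim_compose[OF poly_div_exp_tendsto_0[of "pCons 0 P"] this] show ?thesis .
  qed
  then have r: "((\<lambda>h. (flat P (0 + h) - flat P 0) / h) \<longlongrightarrow> 0) (at_right 0)"
    by (rule Lim_transform_eventually)
      (auto simp: flat_def eventually_at_right_field intro!: exI[of _ "1"])
  have "((\<lambda>h. (flat P (0 + h) - flat P 0) / h) \<longlongrightarrow> 0) (at 0)"
    using l r by (simp add: filterlim_split_at)
  then show ?thesis using equal by (simp add: DERIV_def flat_def)
qed

lemma smooth_flat: "smooth (flat P)"
proof (rule smooth_coinduct[of _ "range flat"])
  fix g assume "g \<in> range flat"
  then obtain P where g: "g = flat P" by auto
  have d: "(g has_vector_derivative flat (monom 1 2 * (P - pderiv P)) t) (at t)" for t
    unfolding g using flat_has_derivative has_real_derivative_iff_has_vector_derivative by blast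
  then have "vd g = flat (monom 1 2 * (P - pderiv P))" by (rule vd_eqI)
  then show "(\<forall>t. g differentiable at t) \<and> vd g \<in> range flat"
    using d differentiableI_vector by blast
qed auto

text \<open>The arguments are c (t - a) and c (b - t), spelled out in affine form. For c > 0 the
  support does not depend on c, while growing c pushes the values on (a, b) towards 1, since
  exp(-1/(c s)) tends to 1 for s > 0. So bumps also approximate indicators.\<close>

definition bump :: "real \<Rightarrow> real \<Rightarrow> real \<Rightarrow> real \<Rightarrow> real" where
  "bump c a b t = flat 1 (c * t + (- c * a)) * flat 1 ((- c) * t + c * b)"

lemma smooth_bump: "smooth (bump c a b)"
  unfolding bump_def by (intro smooth_mult smooth_affine smooth_flat)

lemma flat_1: "flat 1 t = (if t > 0 then exp (- (1 / t)) else 0)"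
  by (simp add: flat_def)

lemma bump_outside: "c > 0 \<Longrightarrow> t \<notin> {a<..<b} \<Longrightarrow> bump c a b t = 0"
  by (auto simp: bump_def flat_1 mult_less_cancel_left_pos algebra_simps)
  
lemma bump_bounds: "0 \<le> bump c a b t" "bump c a b t \<le> 1"
  unfolding bump_def flat_1 by (auto intro!: mult_le_one)

lemma bump_pos: "c > 0 \<Longrightarrow> a < t \<Longrightarrow> t < b \<Longrightarrow> 0 < bump c a b t"
  by (auto simp: bump_def flat_1 mult_less_cancel_left_pos algebra_simps)

lemma bump_tendsto:
  "(\<lambda>n. bump (real (Suc n)) a b t) \<longlonglongrightarrow> indicator {a<..<b} t"
proof (cases "t \<in> {a<..<b}")
  case True
  have e: "(\<lambda>n. exp (- (1 / (real (Suc n) * s)))) \<longlonglongrightarrow> exp (- 0)" for s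
  proof -
    have "(\<lambda>n. 1 / (real (Suc n) * s)) \<longlonglongrightarrow> 0"
    proof -
      have "(\<lambda>n. inverse (real (Suc n)) * (1 / s)) \<longlonglongrightarrow> 0 * (1 / s)"
        by (intro tendsto_mult LIMSEQ_inverse_real_of_nat tendsto_const)
      then show ?thesis by (simp add: field_simps)
    qed
    then show ?thesis by (intro tendsto_intros)
  qed
  have "bump (real (Suc n)) a b t = exp (- (1 / (real (Suc n) * (t - a)))) * exp (- (1 / (real (Suc n) * (b - t))))" for n
  proof -
    have "real (Suc n) * t + - real (Suc n) * a = real (Suc n) * (t - a)" 
      "- real (Suc n) * t + real (Suc n) * b = real (Suc n) * (b - t)" by (simp_all add: algebra_simps)
    moreover have "real (Suc n) * (t - a) > 0" "real (Suc n) * (b - t) > 0" using True by auto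
    ultimately show ?thesis by (simp only: bump_def flat_1 if_True)
  qed
  then show ?thesis using tendsto_mult[OF e[of "t - a"] e[of "b - t"]] True by simp
next
  case False
  then show ?thesis by (simp add: bump_outside)
qed

section \<open>Test functions and differential operators\<close>

definition vanishes_outside :: "real \<Rightarrow> real \<Rightarrow> (real \<Rightarrow> 'a::zero) \<Rightarrow> bool" where
  "vanishes_outside a b f \<longleftrightarrow> (\<forall>t. t \<notin> {a..b} \<longrightarrow> f t = 0)"

text \<open>The support is recorded by explicit bounds, which are easy to enlarge and compare. The
  value type is general because complex test functions are needed to factor operators.\<close>

definition test :: "(real \<Rightarrow> 'a::real_normed_vector) \<Rightarrow> bool" where
  "test f \<longleftrightarrow> smooth f \<and> (\<exists>a b. -1 < a \<and> b < 1 \<and> vanishes_outside a b f)"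

lemma vanishes_outside_mono:
  "vanishes_outside a b f \<Longrightarrow> a' \<le> a \<Longrightarrow> b \<le> b' \<Longrightarrow> vanishes_outside a' b' f"
  by (auto simp: vanishes_outside_def)

lemma vanishes_outside_vd:
  assumes "vanishes_outside a b f" shows "vanishes_outside a b (vd f)"
proof -
  have "vd f t = 0" if "t \<notin> {a..b}" for t
  proof -
    have "((\<lambda>_. 0) has_vector_derivative 0) (at t)" by simp
    then have "(f has_vector_derivative 0) (at t)"
      by (rule has_vector_derivative_transform_within_open[of _ _ _ "- {a..b}"])
        (use assms that in \<open>auto simp: vanishes_outside_def\<close>)
    then show ?thesis by (simp add: vd_def vector_derivative_at)
  qed
  then show ?thesis by (simp add: vanishes_outside_def)
qed

lemma test_smooth: "test f \<Longrightarrow> smooth f"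
  by (simp add: test_def)

lemma testI: "smooth f \<Longrightarrow> vanishes_outside a b f \<Longrightarrow> -1 < a \<Longrightarrow> b < 1 \<Longrightarrow> test f"
  unfolding test_def by blast

lemma test_bounds:
  assumes "test f" "-1 < c" "d < 1"
  obtains a b where "-1 < a" "b < 1" "a \<le> c" "d \<le> b" "vanishes_outside a b f"
proof -
  obtain a b where "-1 < a" "b < 1" "vanishes_outside a b f"
    using assms by (auto simp: test_def)
  then show thesis
    using assms by (intro that[of "min a c" "max b d"]) (auto elim: vanishes_outside_mono)
qed

text \<open>A nonempty compact support has a least and a greatest element, and these serve as the
  bounds a and b.\<close>

lemma test_function_iff: "test_function \<phi> \<longleftrightarrow> test \<phi>"
proof -
  have sm: "(\<forall>k t. (deriv ^^ k) \<phi> field_differentiable at t) \<longleftrightarrow> smooth \<phi>"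
    unfolding smooth_def deriv_eq_vd field_differentiable_def has_real_derivative_iff_has_vector_derivative
    by (meson differentiableI_vector vector_derivative_works)
  let ?S = "closure {t. \<phi> t \<noteq> 0}"
  have "(\<exists>a b. -1 < a \<and> b < 1 \<and> vanishes_outside a b \<phi>)" if "compact ?S" "?S \<subseteq> \<I>"
  proof (cases "?S = {}")
    case True
    then have "vanishes_outside 0 0 \<phi>" by (auto simp: vanishes_outside_def)
    then show ?thesis by (intro exI[of _ 0]) auto
  next
    case False
    obtain a where a: "a \<in> ?S" "\<And>t. t \<in> ?S \<Longrightarrow> a \<le> t"
      using compact_attains_inf[OF \<open>compact ?S\<close> False] by blast
    obtain b where b: "b \<in> ?S" "\<And>t. t \<in> ?S \<Longrightarrow> t \<le> b"
      using compact_attains_sup[OF \<open>compact ?S\<close> False] by blast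
    have "\<phi> t = 0" if "t \<notin> {a..b}" for t
      using a(2)[of t] b(2)[of t] that closure_subset[of "{t. \<phi> t \<noteq> 0}"] by (cases "\<phi> t = 0") auto
    then show ?thesis using a(1) b(1) \<open>?S \<subseteq> \<I>\<close>
      by (intro exI[of _ a] exI[of _ b]) (auto simp: vanishes_outside_def)
  qed
  moreover have "compact ?S \<and> ?S \<subseteq> \<I>" if "-1 < a" "b < 1" "vanishes_outside a b \<phi>" for a b
  proof -
    have "{t. \<phi> t \<noteq> 0} \<subseteq> {a..b}" using that by (auto simp: vanishes_outside_def)
    then have *: "?S \<subseteq> {a..b}" by (simp add: closure_minimal)
    then have "compact ?S"
      using compact_closure bounded_closed_interval bounded_subset closure_subset by (metis subset_trans)
    then show ?thesis using * that by auto
  qed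
  ultimately show ?thesis unfolding test_function_def test_def sm by blast
qed

lemma test_add: "test f \<Longrightarrow> test g \<Longrightarrow> test (\<lambda>t. f t + g t)"
proof -
  assume f: "test f" and g: "test g"
  obtain a b where ab: "-1 < a" "b < 1" "vanishes_outside a b f" using f by (auto simp: test_def)
  obtain a' b' where ab': "-1 < a'" "b' < 1" "a' \<le> a" "b \<le> b'" "vanishes_outside a' b' g"
    using test_bounds[OF g ab(1,2)] by blast
  have "vanishes_outside a' b' (\<lambda>t. f t + g t)"
    using ab(3) ab'(3-5) by (auto simp: vanishes_outside_def)
  then show ?thesis using testI smooth_add test_smooth f g ab' by metis
qed

lemma test_linear: "bounded_linear h \<Longrightarrow> test f \<Longrightarrow> test (\<lambda>t. h (f t))"
  unfolding test_def vanishes_outside_def using smooth_linear(1)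
  by (metis (mono_tags, lifting) bounded_linear.axioms(1) linear_0 linear_simps(3))

lemma test_cmult: "test f \<Longrightarrow> test (\<lambda>t. c * f t)" for c :: "'a::real_normed_algebra"
  by (rule test_linear[OF bounded_linear_mult_right])

lemma test_mult: "test f \<Longrightarrow> smooth g \<Longrightarrow> test (\<lambda>t. g t * f t)" for f :: "real \<Rightarrow> 'a::real_normed_algebra"
  unfolding test_def vanishes_outside_def using smooth_mult(1) by (metis mult_zero_right)

lemma test_zero [simp]: "test (\<lambda>_. 0)"
  by (rule testI[of _ 0 0]) (auto simp: vanishes_outside_def)

text \<open>The formal adjoint of d/dt. Absorbing the sign here removes the factors (-1)^i from all
  weak identities.\<close>

definition neg_deriv :: "(real \<Rightarrow> 'a::real_normed_vector) \<Rightarrow> real \<Rightarrow> 'a" where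
  "neg_deriv f = (\<lambda>t. - vd f t)"

lemma smooth_neg_deriv: "smooth f \<Longrightarrow> smooth (neg_deriv f)"
  unfolding neg_deriv_def by (intro smooth_minus smooth_vd)

lemma vanishes_outside_neg_deriv: "vanishes_outside a b f \<Longrightarrow> vanishes_outside a b (neg_deriv f)"
  using vanishes_outside_vd[of a b f] by (simp add: vanishes_outside_def neg_deriv_def)

lemma test_neg_deriv: "test f \<Longrightarrow> test (neg_deriv f)"
  unfolding test_def using smooth_neg_deriv vanishes_outside_neg_deriv by metis

lemma neg_deriv_add: "smooth f \<Longrightarrow> smooth g \<Longrightarrow>
    neg_deriv (\<lambda>t. f t + g t) = (\<lambda>t. neg_deriv f t + neg_deriv g t)"
  by (simp add: neg_deriv_def smooth_add)

lemma neg_deriv_linear: "bounded_linear h \<Longrightarrow> smooth f \<Longrightarrow> neg_deriv (\<lambda>t. h (f t)) = (\<lambda>t. h (neg_deriv f t))"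
  by (simp add: neg_deriv_def smooth_linear linear_neg bounded_linear.linear)

lemma neg_deriv_cmult: "smooth f \<Longrightarrow> neg_deriv (\<lambda>t. c * f t) = (\<lambda>t. c * neg_deriv f t)"
  for c :: "'a::real_normed_algebra"
  by (rule neg_deriv_linear[OF bounded_linear_mult_right])

lemma neg_deriv_zero [simp]: "neg_deriv (\<lambda>_. 0) = (\<lambda>_. 0)"
  by (simp add: neg_deriv_def)

lemma smooth_funpow_vd: "smooth f \<Longrightarrow> smooth ((vd ^^ k) f)"
  by (induction k) (auto simp: smooth_vd)

lemma funpow_neg_deriv: "smooth f \<Longrightarrow> (neg_deriv ^^ k) f = (\<lambda>t. (-1) ^ k * (vd ^^ k) f t)"
  for f :: "real \<Rightarrow> 'a::real_normed_algebra_1"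
proof (induction k)
  case (Suc k)
  have "(neg_deriv ^^ Suc k) f = neg_deriv (\<lambda>t. (-1) ^ k * (vd ^^ k) f t)"
    using Suc by simp
  also have "\<dots> = (\<lambda>t. (-1) ^ Suc k * (vd ^^ Suc k) f t)"
    using smooth_funpow_vd[OF Suc.prems] by (simp add: neg_deriv_cmult) (simp add: neg_deriv_def)
  finally show ?case .
qed simp

lemma smooth_funpow_neg_deriv: "smooth f \<Longrightarrow> smooth ((neg_deriv ^^ k) f)"
  by (induction k) (auto simp: smooth_neg_deriv)

text \<open>The differential operator \<open>P(-d/dt)\<close>, that is, the formal adjoint of \<open>P(d/dt)\<close>.\<close>

definition dop :: "'a::real_normed_field poly \<Rightarrow> (real \<Rightarrow> 'a) \<Rightarrow> real \<Rightarrow> 'a" where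
  "dop P f t = (\<Sum>k\<le>degree P. coeff P k * (neg_deriv ^^ k) f t)"

lemma dop_eq_sum: "degree P \<le> n \<Longrightarrow> dop P f t = (\<Sum>k\<le>n. coeff P k * (neg_deriv ^^ k) f t)"
  unfolding dop_def by (rule sum.mono_neutral_left) (auto simp: coeff_eq_0)

lemma dop_0 [simp]: "dop 0 f = (\<lambda>t. 0)"
  by (auto simp: dop_def)

lemma dop_pCons: "dop (pCons a Q) f = (\<lambda>t. a * f t + dop Q (neg_deriv f) t)"
proof
  fix t
  have "dop (pCons a Q) f t = (\<Sum>k\<le>Suc (degree Q). coeff (pCons a Q) k * (neg_deriv ^^ k) f t)"
    by (rule dop_eq_sum) (rule degree_pCons_le)
  also have "\<dots> = a * f t + dop Q (neg_deriv f) t"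
    unfolding dop_def by (subst sum.atMost_Suc_shift) (simp add: funpow_Suc_right del: funpow.simps(2))
  finally show "dop (pCons a Q) f t = a * f t + dop Q (neg_deriv f) t" .
qed

lemma dop_add: "dop (P + Q) f t = dop P f t + dop Q f t"
proof -
  let ?n = "max (degree P) (degree Q)"
  show ?thesis
    using dop_eq_sum[of P ?n f t] dop_eq_sum[of Q ?n f t] dop_eq_sum[of "P + Q" ?n f t]
    by (simp add: degree_add_le_max distrib_right sum.distrib)
qed

lemma dop_smult: "dop (Polynomial.smult c P) f t = c * dop P f t"
  using dop_eq_sum[of "Polynomial.smult c P" "degree P" f t] by (simp add: dop_def sum_distrib_left degree_smult_le mult.assoc)

lemma dop_sum: "dop (\<Sum>i\<in>I. P i) f t = (\<Sum>i\<in>I. dop (P i) f t)"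
  by (induction I rule: infinite_finite_induct) (auto simp: dop_add)

lemma dop_zero_fun [simp]: "dop P (\<lambda>_. 0) = (\<lambda>_. 0)"
  by (induction P) (auto simp: dop_pCons)

lemma smooth_dop: "smooth f \<Longrightarrow> smooth (dop P f)"
  by (induction P arbitrary: f) (auto simp: dop_pCons intro!: smooth_add smooth_cmult smooth_neg_deriv)

lemma test_dop: "test f \<Longrightarrow> test (dop P f)"
  by (induction P arbitrary: f) (auto simp: dop_pCons intro!: test_add test_cmult test_neg_deriv)

lemma vanishes_outside_dop: "vanishes_outside a b f \<Longrightarrow> vanishes_outside a b (dop P f)"
proof (induction P arbitrary: f)
  case (pCons c P)
  then show ?case using pCons.IH[OF vanishes_outside_neg_deriv[OF pCons.prems]]
    by (auto simp: vanishes_outside_def dop_pCons)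
qed (auto simp: vanishes_outside_def)

lemma dop_add_fun: "smooth f \<Longrightarrow> smooth g \<Longrightarrow> dop P (\<lambda>t. f t + g t) = (\<lambda>t. dop P f t + dop P g t)"
  by (induction P arbitrary: f g)
    (auto simp: dop_pCons neg_deriv_add smooth_neg_deriv algebra_simps)

lemma dop_cmult_fun: "smooth f \<Longrightarrow> dop P (\<lambda>t. c * f t) = (\<lambda>t. c * dop P f t)"
  by (induction P arbitrary: f) (auto simp: dop_pCons neg_deriv_cmult smooth_neg_deriv algebra_simps)

lemma neg_deriv_dop: "smooth f \<Longrightarrow> neg_deriv (dop P f) = dop P (neg_deriv f)"
  by (induction P arbitrary: f)
    (auto simp: dop_pCons neg_deriv_add neg_deriv_cmult smooth_neg_deriv smooth_cmult smooth_dop)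

lemma dop_mult: "smooth f \<Longrightarrow> dop (P * Q) f = dop P (dop Q f)"
proof (induction P arbitrary: f)
  case (pCons a P)
  have "dop (pCons a P * Q) f = (\<lambda>t. a * dop Q f t + dop (P * Q) (neg_deriv f) t)"
    by (auto simp: mult_pCons_left dop_add dop_smult dop_pCons)
  then show ?case
    using pCons.IH[OF smooth_neg_deriv[OF pCons.prems]] pCons.prems by (simp add: dop_pCons neg_deriv_dop)
qed simp

text \<open>Real coefficients commute with taking real parts; by this, results obtained over the
  complex numbers descend to real operators.\<close>

lemma dop_Re: "smooth f \<Longrightarrow> dop P (\<lambda>t. Re (f t)) = (\<lambda>t. Re (dop (map_poly complex_of_real P) f t))"
proof (induction P arbitrary: f)
  case (pCons a P)
  then show ?case
    by (simp add: map_poly_pCons dop_pCons neg_deriv_linear[OF bounded_linear_Re] smooth_neg_deriv)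
qed simp

section \<open>Square integrable functions on the interval\<close>

abbreviation MI :: "real measure" where
  "MI \<equiv> lebesgue_on \<I>"

lemma sets_I [simp]: "\<I> \<in> sets lebesgue"
  by simp

lemma finite_measure_MI: "finite_measure MI"
  by (rule finite_measure_lebesgue_on) simp

interpretation MI: finite_measure MI
  by (rule finite_measure_MI)

lemma set_integral_I: "(LINT t:\<I>|lebesgue. f t) = integral\<^sup>L MI f"
  for f :: "real \<Rightarrow> 'a::{banach, second_countable_topology}"
  by (simp add: set_lebesgue_integral_def integral_restrict_space)

lemma AE_I: "(AE t\<in>\<I> in lebesgue. P t) \<longleftrightarrow> (AE t in MI. P t)"
  by (simp add: AE_restrict_space_iff)

lemma continuous_MI_measurable: "continuous_on {-1..1} f \<Longrightarrow> f \<in> borel_measurable MI"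
  for f :: "real \<Rightarrow> 'a::euclidean_space"
  by (rule continuous_imp_measurable_on_sets_lebesgue) (auto elim: continuous_on_subset)

lemma integrable_MI_bounded:
  fixes f :: "real \<Rightarrow> 'a::euclidean_space"
  assumes "f \<in> borel_measurable MI" "\<And>t. t \<in> \<I> \<Longrightarrow> norm (f t) \<le> B"
  shows "integrable MI f"
  by (rule MI.integrable_const_bound[of _ B]) (use assms in \<open>auto intro!: AE_I2\<close>)

lemma continuous_bounded:
  fixes f :: "real \<Rightarrow> 'a::real_normed_vector"
  assumes "continuous_on {-1..1} f" obtains B where "\<And>t. t \<in> {-1..1} \<Longrightarrow> norm (f t) \<le> B"
proof -
  have "bounded (f ` {-1..1})"
    by (rule compact_imp_bounded[OF compact_continuous_image[OF assms]]) simp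
  then show thesis using that unfolding bounded_iff by blast
qed

lemma continuous_integrable_MI:
  fixes f :: "real \<Rightarrow> 'a::euclidean_space"
  assumes "continuous_on {-1..1} f" shows "integrable MI f" "integral\<^sup>L MI f = integral {-1..1} f"
proof -
  obtain B where B: "\<And>t. t \<in> {-1..1} \<Longrightarrow> norm (f t) \<le> B"
    using continuous_bounded[OF assms] by blast
  show "integrable MI f"
    by (rule integrable_MI_bounded[of _ B]) (use B assms in \<open>auto intro: continuous_MI_measurable\<close>)
  then show "integral\<^sup>L MI f = integral {-1..1} f"
    using lebesgue_integral_eq_integral[of \<I> f] by (simp add: integral_open_interval_real)
qed

definition L2I :: "(real \<Rightarrow> 'a::{real_normed_field, euclidean_space}) set" where
  "L2I = {f. f \<in> borel_measurable MI \<and> integrable MI (\<lambda>t. (norm (f t))\<^sup>2)}"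

lemma L2_scalar_eq: "L2_scalar = L2I"
  unfolding L2_scalar_def L2I_def set_integrable_def set_borel_measurable_def
  by (auto simp: borel_measurable_restrict_space_iff integrable_restrict_space)

lemma L2I_measurable: "f \<in> L2I \<Longrightarrow> f \<in> borel_measurable MI"
  by (simp add: L2I_def)

lemma L2I_integrable: "f \<in> L2I \<Longrightarrow> integrable MI f"
proof -
  assume f: "f \<in> L2I"
  have [measurable]: "f \<in> borel_measurable MI" using f by (simp add: L2I_def)
  have "integrable MI (\<lambda>t. 1 + (norm (f t))\<^sup>2)" using f by (auto simp: L2I_def)
  then show ?thesis
  proof (rule Bochner_Integration.integrable_bound)
    show "AE x in MI. norm (f x) \<le> norm (1 + (norm (f x))\<^sup>2)"
    proof (rule AE_I2)
      fix x
      have "2 * norm (f x) \<le> 1 + (norm (f x))\<^sup>2"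
        using zero_le_power2[of "norm (f x) - 1"] by (simp add: power2_diff)
      then show "norm (f x) \<le> norm (1 + (norm (f x))\<^sup>2)"
        using norm_ge_zero[of "f x"] by (simp del: norm_ge_zero)
    qed
  qed simp
qed

lemma L2I_bounded:
  assumes "f \<in> borel_measurable MI" "\<And>t. t \<in> \<I> \<Longrightarrow> norm (f t) \<le> B"
  shows "f \<in> L2I"
proof -
  have "integrable MI (\<lambda>t. (norm (f t))\<^sup>2)"
    by (rule integrable_MI_bounded[of _ "B\<^sup>2"]) (use assms in \<open>auto intro!: power_mono\<close>)
  then show ?thesis using assms by (simp add: L2I_def)
qed

lemma L2I_continuous: "continuous_on {-1..1} f \<Longrightarrow> f \<in> L2I"
  using continuous_bounded[of f] continuous_MI_measurable[of f] L2I_bounded[of f]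
  by (metis atLeastAtMost_iff greaterThanLessThan_iff less_eq_real_def)

lemma L2I_mult_bounded:
  assumes f: "f \<in> L2I" and g: "g \<in> borel_measurable MI" "\<And>t. t \<in> \<I> \<Longrightarrow> norm (g t) \<le> B"
  shows "(\<lambda>t. g t * f t) \<in> L2I"
proof -
  have [measurable]: "f \<in> borel_measurable MI" "g \<in> borel_measurable MI" using f g by (simp_all add: L2I_def)
  have "integrable MI (\<lambda>t. B\<^sup>2 * (norm (f t))\<^sup>2)" using f by (simp add: L2I_def)
  then have "integrable MI (\<lambda>t. (norm (g t * f t))\<^sup>2)"
  proof (rule Bochner_Integration.integrable_bound)
    show "AE x in MI. norm ((norm (g x * f x))\<^sup>2) \<le> norm (B\<^sup>2 * (norm (f x))\<^sup>2)"
      by (rule AE_I2) (use g in \<open>auto simp: norm_mult power_mult_distrib intro!: mult_right_mono power_mono\<close>)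
  qed measurable
  then show ?thesis by (simp add: L2I_def)
qed

lemma L2I_cmult: "f \<in> L2I \<Longrightarrow> (\<lambda>t. c * f t) \<in> L2I"
  by (rule L2I_mult_bounded[of _ _ "norm c"]) auto

lemma L2I_zero [simp]: "(\<lambda>_. 0) \<in> L2I"
  by (simp add: L2I_def)

lemma L2I_add: assumes f: "f \<in> L2I" and g: "g \<in> L2I" shows "(\<lambda>t. f t + g t) \<in> L2I"
proof -
  have [measurable]: "f \<in> borel_measurable MI" "g \<in> borel_measurable MI" using f g by (simp_all add: L2I_def)
  have "integrable MI (\<lambda>t. 2 * (norm (f t))\<^sup>2 + 2 * (norm (g t))\<^sup>2)"
    using f g by (simp add: L2I_def)
  then have "integrable MI (\<lambda>t. (norm (f t + g t))\<^sup>2)"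
  proof (rule Bochner_Integration.integrable_bound)
    show "AE x in MI. norm ((norm (f x + g x))\<^sup>2) \<le> norm (2 * (norm (f x))\<^sup>2 + 2 * (norm (g x))\<^sup>2)"
    proof (rule AE_I2)
      fix x
      have "(norm (f x + g x))\<^sup>2 \<le> (norm (f x) + norm (g x))\<^sup>2"
        by (intro power_mono norm_triangle_ineq) auto
      also have "\<dots> \<le> 2 * (norm (f x))\<^sup>2 + 2 * (norm (g x))\<^sup>2"
        using zero_le_power2[of "norm (f x) - norm (g x)"] by (simp add: power2_diff power2_sum)
      finally show "norm ((norm (f x + g x))\<^sup>2) \<le> norm (2 * (norm (f x))\<^sup>2 + 2 * (norm (g x))\<^sup>2)" by simp
    qed
  qed measurable
  then show ?thesis by (simp add: L2I_def)
qed

lemma L2I_sum: "(\<And>i. i \<in> S \<Longrightarrow> f i \<in> L2I) \<Longrightarrow> (\<lambda>t. \<Sum>i\<in>S. f i t) \<in> L2I"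
  by (induction S rule: infinite_finite_induct) (auto intro: L2I_add)

lemma L2I_smooth: "smooth f \<Longrightarrow> f \<in> L2I"
  by (intro L2I_continuous smooth_continuous)

lemma L2I_mult_smooth_integrable: "f \<in> L2I \<Longrightarrow> smooth \<phi> \<Longrightarrow> integrable MI (\<lambda>t. f t * \<phi> t)"
proof -
  assume f: "f \<in> L2I" and \<phi>: "smooth \<phi>"
  obtain B where "\<And>t. t \<in> {-1..1} \<Longrightarrow> norm (\<phi> t) \<le> B"
    using continuous_bounded[OF smooth_continuous[OF \<phi>]] by blast
  then have "(\<lambda>t. \<phi> t * f t) \<in> L2I"
    by (intro L2I_mult_bounded[OF f, where B = B]) (auto intro!: continuous_MI_measurable smooth_continuous \<phi>)
  then show ?thesis using L2I_integrable by (simp add: mult.commute)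
qed

lemma L2I_mult_integrable: "f \<in> L2I \<Longrightarrow> g \<in> L2I \<Longrightarrow> integrable MI (\<lambda>t. f t * g t)" 
proof -
  assume f: "f \<in> L2I" and g: "g \<in> L2I"
  have [measurable]: "f \<in> borel_measurable MI" "g \<in> borel_measurable MI" using f g by (simp_all add: L2I_def)
  have "integrable MI (\<lambda>t. (norm (f t))\<^sup>2 + (norm (g t))\<^sup>2)" using f g by (simp add: L2I_def)
  then show ?thesis
  proof (rule Bochner_Integration.integrable_bound)
    show "AE x in MI. norm (f x * g x) \<le> norm ((norm (f x))\<^sup>2 + (norm (g x))\<^sup>2)"
    proof (rule AE_I2)
      fix x
      have "2 * (norm (f x) * norm (g x)) \<le> (norm (f x))\<^sup>2 + (norm (g x))\<^sup>2"
        using zero_le_power2[of "norm (f x) - norm (g x)"] by (simp add: power2_diff)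
      moreover have "0 \<le> norm (f x) * norm (g x)" by simp
      ultimately have "norm (f x) * norm (g x) \<le> (norm (f x))\<^sup>2 + (norm (g x))\<^sup>2" by linarith
      then show "norm (f x * g x) \<le> norm ((norm (f x))\<^sup>2 + (norm (g x))\<^sup>2)"
        by (simp add: norm_mult)
    qed
  qed measurable
qed

text \<open>Bilinear also for complex values: without conjugation, scalars and operator coefficients
  pass through unchanged.\<close>

definition pairing :: "(real \<Rightarrow> 'a::{real_normed_field, euclidean_space}) \<Rightarrow> (real \<Rightarrow> 'a) \<Rightarrow> 'a" where
  "pairing f \<phi> = integral\<^sup>L MI (\<lambda>t. f t * \<phi> t)"

lemma pairing_add: "f \<in> L2I \<Longrightarrow> smooth \<phi> \<Longrightarrow> smooth \<psi> \<Longrightarrow>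
    pairing f (\<lambda>t. \<phi> t + \<psi> t) = pairing f \<phi> + pairing f \<psi>"
  by (simp add: pairing_def distrib_left L2I_mult_smooth_integrable Bochner_Integration.integral_add)

lemma pairing_cmult: "pairing f (\<lambda>t. c * \<phi> t) = c * pairing f \<phi>"
  unfolding pairing_def by (simp add: mult.left_commute[of _ c] del: mult.commute)

lemma pairing_zero [simp]: "pairing f (\<lambda>_. 0) = 0"
  by (simp add: pairing_def)

lemma pairing_add_left: "f \<in> L2I \<Longrightarrow> g \<in> L2I \<Longrightarrow> smooth \<phi> \<Longrightarrow>
    pairing (\<lambda>t. f t + g t) \<phi> = pairing f \<phi> + pairing g \<phi>"
  by (simp add: pairing_def distrib_right L2I_mult_smooth_integrable Bochner_Integration.integral_add)

lemma pairing_cmult_left: "pairing (\<lambda>t. c * f t) \<phi> = c * pairing f \<phi>"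
  by (simp add: pairing_def mult.assoc)

lemma pairing_zero_left [simp]: "pairing (\<lambda>_. 0) \<phi> = 0"
  by (simp add: pairing_def)

lemma pairing_sum_left: "(\<And>i. i \<in> S \<Longrightarrow> f i \<in> L2I) \<Longrightarrow> smooth \<phi> \<Longrightarrow>
    pairing (\<lambda>t. \<Sum>i\<in>S. f i t) \<phi> = (\<Sum>i\<in>S. pairing (f i) \<phi>)"
  by (induction S rule: infinite_finite_induct) (auto simp: pairing_add_left L2I_sum)

lemma pairing_sum: "f \<in> L2I \<Longrightarrow> (\<And>i. i \<in> S \<Longrightarrow> smooth (\<phi> i)) \<Longrightarrow>
    pairing f (\<lambda>t. \<Sum>i\<in>S. \<phi> i t) = (\<Sum>i\<in>S. pairing f (\<phi> i)) \<and> smooth (\<lambda>t. \<Sum>i\<in>S. \<phi> i t)"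
  by (induction S rule: infinite_finite_induct) (auto simp: pairing_add smooth_add)

lemma pairing_cong: "(\<And>t. t \<in> \<I> \<Longrightarrow> f t * \<phi> t = g t * \<psi> t) \<Longrightarrow> pairing f \<phi> = pairing g \<psi>"
  unfolding pairing_def by (rule Bochner_Integration.integral_cong) auto

lemma pairing_cong_AE: "f \<in> borel_measurable MI \<Longrightarrow> g \<in> borel_measurable MI \<Longrightarrow> smooth \<phi> \<Longrightarrow>
    (AE t in MI. f t * \<phi> t = g t * \<phi> t) \<Longrightarrow> pairing f \<phi> = pairing g \<phi>"
  unfolding pairing_def using continuous_MI_measurable[OF smooth_continuous, of \<phi>]
  by (intro integral_cong_AE borel_measurable_times) auto

text \<open>The test function vanishes at -1 and 1, so no boundary terms remain and one-sided
  derivatives of f at the end points are enough.\<close>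

lemma pairing_parts:
  fixes f :: "real \<Rightarrow> 'a::{real_normed_field, euclidean_space}"
  assumes f: "\<And>t. t \<in> {-1..1} \<Longrightarrow> (f has_vector_derivative f' t) (at t within {-1..1})"
    and f': "continuous_on {-1..1} f'" and \<phi>: "test \<phi>"
  shows "pairing f (neg_deriv \<phi>) = pairing f' \<phi>"
proof -
  have sm: "smooth \<phi>" by (rule test_smooth[OF \<phi>])
  have cf: "continuous_on {-1..1} f"
    using f by (meson continuous_on_eq_continuous_within has_vector_derivative_continuous)
  have c: "continuous_on {-1..1} (\<lambda>t. f t * neg_deriv \<phi> t)" "continuous_on {-1..1} (\<lambda>t. f' t * \<phi> t)"
    by (intro continuous_on_mult cf f' smooth_continuous smooth_neg_deriv sm)+
  have "((\<lambda>t. f t * vd \<phi> t + f' t * \<phi> t) has_integral (f 1 * \<phi> 1 - f (-1) * \<phi> (-1))) {-1..1}"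
  proof (rule fundamental_theorem_of_calculus)
    fix t :: real assume "t \<in> {-1..1}"
    then show "((\<lambda>t. f t * \<phi> t) has_vector_derivative f t * vd \<phi> t + f' t * \<phi> t) (at t within {-1..1})"
      by (intro has_vector_derivative_mult f has_vector_derivative_at_within[OF smooth_has_vd[OF sm]])
  qed simp
  moreover have "\<phi> 1 = 0" "\<phi> (-1) = 0" using \<phi> by (auto simp: test_def vanishes_outside_def)
  ultimately have "integral {-1..1} (\<lambda>t. f t * vd \<phi> t + f' t * \<phi> t) = 0" by auto
  moreover have "integral {-1..1} (\<lambda>t. f' t * \<phi> t) - integral {-1..1} (\<lambda>t. f t * neg_deriv \<phi> t)
    = integral {-1..1} (\<lambda>t. f' t * \<phi> t - f t * neg_deriv \<phi> t)"
    by (rule integral_diff[symmetric]) (intro integrable_continuous_interval c)+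
  ultimately have "integral {-1..1} (\<lambda>t. f' t * \<phi> t) = integral {-1..1} (\<lambda>t. f t * neg_deriv \<phi> t)"
    by (simp add: neg_deriv_def add.commute eq_neg_iff_add_eq_0)
  then show ?thesis
    unfolding pairing_def continuous_integrable_MI(2)[OF c(1)] continuous_integrable_MI(2)[OF c(2)] by simp
qed

section \<open>The fundamental lemma of the calculus of variations\<close>

lemma Int_stable_greaterThanLessThan: "Int_stable (range (\<lambda>(a, b). {a<..<b::real}))"
proof (rule Int_stableI_image)
  fix i j :: "real \<times> real"
  show "\<exists>k\<in>UNIV. (case i of (a, b) \<Rightarrow> {a<..<b}) \<inter> (case j of (a, b) \<Rightarrow> {a<..<b}) = (case k of (a, b) \<Rightarrow> {a<..<b})"
    by (cases i; cases j) (auto intro!: bexI[of _ "(max (fst i) (fst j), min (snd i) (snd j))"])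
qed

lemma borel_eq_open_intervals: "borel = sigma UNIV (range (\<lambda>(a, b). {a<..<b::real}))"
  using borel_eq_box[where 'a = real] by (simp add: box_real(1))

lemma range_subset_Pow_UNIV: "range (\<lambda>(a, b). {a<..<b::real}) \<subseteq> Pow UNIV"
  by simp

lemma ident_MI: "(\<lambda>t. t) \<in> borel_measurable MI"
  by (rule continuous_MI_measurable) simp

text \<open>Indicators of open intervals are bounded limits of bumps.\<close>

lemma integral_interval_eq_0:
  fixes f :: "real \<Rightarrow> real"
  assumes f: "f \<in> L2I" and 0: "\<And>\<phi>. test \<phi> \<Longrightarrow> pairing f \<phi> = 0"
  shows "integral\<^sup>L MI (\<lambda>t. indicator {a<..<b} t * f t) = 0"
proof -
  have [measurable]: "f \<in> borel_measurable MI" by (rule L2I_measurable[OF f])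
  have int: "integrable MI (\<lambda>t. norm (f t))" using L2I_integrable[OF f] by simp
  have m: "A \<in> sets borel \<Longrightarrow> (\<lambda>t. indicator A t * f t) \<in> borel_measurable MI" for A :: "real set"
    by (intro borel_measurable_times measurable_compose[OF ident_MI borel_measurable_indicator]) auto
  have inner: "integral\<^sup>L MI (\<lambda>t. indicator {a<..<b} t * f t) = 0" if ab: "-1 < a" "b < 1" for a b
  proof -
    have t: "test (bump (real (Suc n)) a b)" for n
      using ab by (intro testI[of _ a b] smooth_bump) (auto simp: vanishes_outside_def bump_outside)
    have "(\<lambda>n. integral\<^sup>L MI (\<lambda>t. f t * bump (real (Suc n)) a b t)) \<longlonglongrightarrow> integral\<^sup>L MI (\<lambda>t. indicator {a<..<b} t * f t)"
    proof (rule integral_dominated_convergence[where w = "\<lambda>t. norm (f t)"])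
      show "AE x in MI. (\<lambda>n. f x * bump (real (Suc n)) a b x) \<longlonglongrightarrow> indicat_real {a<..<b} x * f x"
        using tendsto_mult[OF tendsto_const bump_tendsto] by (intro AE_I2) (simp add: mult.commute)
      show "AE x in MI. norm (f x * bump (real (Suc n)) a b x) \<le> norm (f x)" for n
        by (rule AE_I2) (use bump_bounds in \<open>auto simp: abs_mult intro: mult_left_le\<close>)
      show "(\<lambda>x. f x * bump (real (Suc n)) a b x) \<in> borel_measurable MI" for n
        using continuous_MI_measurable[OF smooth_continuous[OF smooth_bump]] by measurable
    qed (use int m in auto)
    then show ?thesis using 0[OF t] by (simp add: pairing_def LIMSEQ_const_iff)
  qed
  \<comment> \<open>An interval that reaches the ends of the time interval does not carry test
    functions, so it is exhausted from inside by admissible ones.\<close>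
  define a' where "a' n = max a (-1 + 1 / real (n + 2))" for n
  define b' where "b' n = min b (1 - 1 / real (n + 2))" for n
  have "(\<lambda>n. integral\<^sup>L MI (\<lambda>t. indicator {a' n<..<b' n} t * f t)) \<longlonglongrightarrow> integral\<^sup>L MI (\<lambda>t. indicator {a<..<b} t * f t)"
  proof (rule integral_dominated_convergence[where w = "\<lambda>t. norm (f t)"])
    show "AE x in MI. (\<lambda>n. indicat_real {a' n<..<b' n} x * f x) \<longlonglongrightarrow> indicat_real {a<..<b} x * f x"
    proof (rule AE_I2)
      fix x assume x: "x \<in> space MI"
      define e where "e = min (x + 1) (1 - x)"
      have "e > 0" using x by (auto simp: e_def)
      have "(\<lambda>n. 1 / real (n + 2)) \<longlonglongrightarrow> 0" 
        using LIMSEQ_ignore_initial_segment[OF lim_1_over_n, of 2] by simp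
      then have "\<forall>\<^sub>F n in sequentially. 1 / real (n + 2) < e"
        using \<open>e > 0\<close> by (rule order_tendstoD)
      then have "\<forall>\<^sub>F n in sequentially. indicat_real {a<..<b} x * f x = indicat_real {a' n<..<b' n} x * f x"
        by eventually_elim (auto simp: e_def a'_def b'_def indicator_def)
      then show "(\<lambda>n. indicat_real {a' n<..<b' n} x * f x) \<longlonglongrightarrow> indicat_real {a<..<b} x * f x"
        by (rule Lim_transform_eventually[OF tendsto_const])
    qed
    show "AE x in MI. norm (indicat_real {a' n<..<b' n} x * f x) \<le> norm (f x)" for n
      by (rule AE_I2) (auto simp: indicator_def)
  qed (use int m in auto)
  moreover have "integral\<^sup>L MI (\<lambda>t. indicator {a' n<..<b' n} t * f t) = 0" for n
  proof (rule inner)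
    have "0 < 1 / real (n + 2)" by simp
    then show "-1 < a' n" "b' n < 1" unfolding a'_def b'_def by linarith+
  qed
  ultimately show ?thesis by (simp add: LIMSEQ_const_iff)
qed

text \<open>The integral of f vanishes over open intervals, hence over Borel sets by a Dynkin system
  argument, hence over Lebesgue sets, which differ from Borel sets by null sets.\<close>

lemma pairing_eq_0_imp_AE_0:
  fixes f :: "real \<Rightarrow> real"
  assumes f: "f \<in> L2I" and 0: "\<And>\<phi>. test \<phi> \<Longrightarrow> pairing f \<phi> = 0"
  shows "AE t in MI. f t = 0"
proof (rule MI.density_zero)
  show int: "integrable MI f" by (rule L2I_integrable[OF f])
  have meas: "A \<in> sets borel \<Longrightarrow> A \<inter> \<I> \<in> sets MI" for A
    by (auto simp: sets_restrict_space_iff image_iff sets_completionI_sets intro!: exI[of _ A])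
  have ind: "integrable MI (\<lambda>t. indicator A t * f t)" if "A \<in> sets borel" for A
    using integrable_mult_indicator[OF meas[OF that] int]
    by (rule Bochner_Integration.integrable_cong[THEN iffD1, rotated -1]) (auto simp: indicator_def)
  have borel: "integral\<^sup>L MI (\<lambda>t. indicator A t * f t) = 0" if "A \<in> sets borel" for A
  proof -
    have "A \<in> sigma_sets UNIV (range (\<lambda>(a, b). {a<..<b::real}))"
      using that by (simp add: borel_eq_open_intervals)
    then show ?thesis
    proof (induction rule: sigma_sets_induct_disjoint[OF Int_stable_greaterThanLessThan range_subset_Pow_UNIV,
        consumes 1, case_names basic empty compl union])
      case (compl A)
      have A: "A \<in> sets borel" using compl by (simp add: borel_eq_open_intervals)
      \<comment> \<open>This interval covers the whole time interval, so the total integral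
        vanishes, as complements require.\<close>
      have "integral\<^sup>L MI (\<lambda>t. indicator {-2<..<2} t * f t) = 0"
        by (rule integral_interval_eq_0[OF f 0])
      moreover have "integral\<^sup>L MI (\<lambda>t. indicator {-2<..<2} t * f t) =
          integral\<^sup>L MI (\<lambda>t. indicator A t * f t + indicator (UNIV - A) t * f t)"
        by (rule Bochner_Integration.integral_cong) (auto simp: indicator_def)
      ultimately show ?case using compl A by (simp add: ind Bochner_Integration.integral_add)
    next
      case (union A)
      have A: "A i \<in> sets borel" for i using union by (auto simp: borel_eq_open_intervals)
      have "set_lebesgue_integral MI (\<Union>i. A i \<inter> \<I>) f = (\<Sum>i. set_lebesgue_integral MI (A i \<inter> \<I>) f)"
      proof (rule lebesgue_integral_countable_add)
        show "A i \<inter> \<I> \<in> sets MI" for i by (rule meas[OF A])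
        show "i \<noteq> j \<Longrightarrow> A i \<inter> \<I> \<inter> (A j \<inter> \<I>) = {}" for i j
          using union by (auto simp: disjoint_family_on_def)
        show "set_integrable MI (\<Union>i. A i \<inter> \<I>) f"
          unfolding set_integrable_def by (intro integrable_mult_indicator int sets.countable_UN image_subsetI meas[OF A])
      qed
      moreover have "set_lebesgue_integral MI (B \<inter> \<I>) f = integral\<^sup>L MI (\<lambda>t. indicator B t * f t)" for B
        unfolding set_lebesgue_integral_def by (rule Bochner_Integration.integral_cong) (auto simp: indicator_def)
      moreover have "(\<Union>i. A i \<inter> \<I>) = (\<Union>i. A i) \<inter> \<I>" by auto
      ultimately show ?case using union.IH by (simp del: UN_simps)
    qed (auto simp: integral_interval_eq_0[OF f 0])
  qed
  fix A assume A: "A \<in> sets MI"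
  then have "A \<in> sets lebesgue" by (simp add: sets_restrict_space_iff)
  then obtain S N N' where SN: "A = S \<union> N" "N \<subseteq> N'" "N' \<in> null_sets lborel" "S \<in> sets lborel"
    by (rule sets_completionE) auto
  have "AE t in lebesgue. t \<notin> N'"
    by (intro AE_completion AE_not_in SN)
  then have "AE t in MI. t \<notin> N'" by (auto simp: AE_restrict_space_iff elim: eventually_mono)
  then have "AE t in MI. indicator A t * f t = indicator S t * f t"
    by eventually_elim (use SN in \<open>auto simp: indicator_def\<close>)
  then have "integral\<^sup>L MI (\<lambda>t. indicator A t * f t) = integral\<^sup>L MI (\<lambda>t. indicator S t * f t)"
    using ind[of S] SN integrable_mult_indicator[OF A int] by (intro integral_cong_AE) auto
  also have "\<dots> = 0" using SN by (intro borel) simp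
  finally show "set_lebesgue_integral MI A f = 0" by (simp add: set_lebesgue_integral_def)
qed

section \<open>Primitives\<close>

lemma pair_MI: "pair_sigma_finite MI MI"
  by (intro pair_sigma_finite.intro MI.sigma_finite_measure_axioms)

text \<open>The integral of F from -1 to t, written over the fixed interval with a cut-off so that
  Fubini applies directly.\<close>

definition primitive :: "(real \<Rightarrow> 'a::{real_normed_field, euclidean_space}) \<Rightarrow> real \<Rightarrow> 'a" where
  "primitive F t = integral\<^sup>L MI (\<lambda>s. if s < t then F s else 0)"

lemma primitive_kernel_measurable:
  fixes F G :: "real \<Rightarrow> 'a::{real_normed_field, euclidean_space}"
  assumes [measurable]: "F \<in> borel_measurable MI" "G \<in> borel_measurable MI"
  shows "(\<lambda>(t, s). if s < t then F s * G t else 0) \<in> borel_measurable (MI \<Otimes>\<^sub>M MI)"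
proof -
  have [measurable]: "(\<lambda>t. t) \<in> borel_measurable MI" by (rule continuous_MI_measurable) simp
  show ?thesis by measurable
qed

lemma primitive_L2I:
  assumes F: "F \<in> L2I" shows "primitive F \<in> L2I"
proof (rule L2I_bounded[where B = "integral\<^sup>L MI (\<lambda>s. norm (F s))"])
  have [measurable]: "F \<in> borel_measurable MI" by (rule L2I_measurable[OF F])
  have "(\<lambda>(t, s). if s < t then F s * 1 else 0) \<in> borel_measurable (MI \<Otimes>\<^sub>M MI)"
    by (rule primitive_kernel_measurable) auto
  from MI.borel_measurable_lebesgue_integral[OF this] 
  show "primitive F \<in> borel_measurable MI"
    by (simp add: primitive_def[abs_def] cong: if_cong)
  fix t
  have "norm (primitive F t) \<le> integral\<^sup>L MI (\<lambda>s. norm (if s < t then F s else 0))"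
    unfolding primitive_def by simp
  also have "\<dots> \<le> integral\<^sup>L MI (\<lambda>s. norm (F s))"
    by (rule integral_mono') (use L2I_integrable[OF F] in auto)
  finally show "norm (primitive F t) \<le> integral\<^sup>L MI (\<lambda>s. norm (F s))" .
qed

lemma integral_tail:
  assumes \<phi>: "test \<phi>" and s: "s \<in> \<I>"
  shows "integral\<^sup>L MI (\<lambda>t. if s < t then neg_deriv \<phi> t else 0) = (\<phi> s :: 'a::{real_normed_field, euclidean_space})"
proof -
  have sm: "smooth \<phi>" by (rule test_smooth[OF \<phi>])
  have "integral\<^sup>L MI (\<lambda>t. if s < t then neg_deriv \<phi> t else 0)
      = integral\<^sup>L (lebesgue_on {s<..<1}) (neg_deriv \<phi>)"
    by (simp add: integral_restrict_space)
      (rule Bochner_Integration.integral_cong, use s in \<open>auto simp: indicator_def\<close>)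
  also have "\<dots> = integral {s<..<1} (neg_deriv \<phi>)"
  proof (rule lebesgue_integral_eq_integral)
    have subset: "{s<..<1} \<subseteq> \<I>" using s by (intro subsetI) simp
    have "integrable (lebesgue_on \<I>) (neg_deriv \<phi>)"
      by (intro continuous_integrable_MI smooth_continuous smooth_neg_deriv sm)
    then show "integrable (lebesgue_on {s<..<1}) (neg_deriv \<phi>)"
      using set_integrable_subset[of lebesgue \<I> "neg_deriv \<phi>" "{s<..<1}"] subset
      by (simp add: integrable_restrict_space set_integrable_def)
  qed simp
  also have "\<dots> = integral {s..1} (neg_deriv \<phi>)" by (simp add: integral_open_interval_real)
  also have "\<dots> = (- \<phi> 1) - (- \<phi> s)"
  proof (rule integral_unique, rule fundamental_theorem_of_calculus)
    fix t :: real
    show "((\<lambda>t. - \<phi> t) has_vector_derivative neg_deriv \<phi> t) (at t within {s..1})"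
      unfolding neg_deriv_def
      by (intro has_vector_derivative_minus has_vector_derivative_at_within[OF smooth_has_vd[OF sm]])
  qed (use s in auto)
  also have "\<phi> 1 = 0" using \<phi> by (auto simp: test_def vanishes_outside_def)
  finally show ?thesis by simp
qed

text \<open>After exchanging the integrals, what remains for each s is the integral of -\<phi>' over
  (s, 1), which is \<phi>(s). So F is the weak derivative of its primitive, with no appeal to
  pointwise differentiation.\<close>

lemma pairing_primitive:
  assumes F: "F \<in> L2I" and \<phi>: "test \<phi>"
  shows "pairing (primitive F) (neg_deriv \<phi>) = pairing F \<phi>"
proof -
  interpret MM: pair_sigma_finite MI MI by (rule pair_MI)
  have sm: "smooth (neg_deriv \<phi>)" by (intro smooth_neg_deriv test_smooth[OF \<phi>])
  have Fm[measurable]: "F \<in> borel_measurable MI" by (rule L2I_measurable[OF F])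
  have Gm[measurable]: "neg_deriv \<phi> \<in> borel_measurable MI"
    by (intro continuous_MI_measurable smooth_continuous sm)
  let ?f = "\<lambda>t s. if s < t then F s * neg_deriv \<phi> t else 0"
  have int_s: "integrable MI (?f t)" for t
  proof (rule Bochner_Integration.integrable_bound)
    have "integrable MI F" by (rule L2I_integrable[OF F])
    then show "integrable MI (\<lambda>s. F s * neg_deriv \<phi> t)" by simp
    have [measurable]: "(\<lambda>t. t) \<in> borel_measurable MI" by (rule continuous_MI_measurable) simp
    show "?f t \<in> borel_measurable MI" by measurable
  qed auto
  have m: "(\<lambda>(t, s). ?f t s) \<in> borel_measurable (MI \<Otimes>\<^sub>M MI)"
    by (rule primitive_kernel_measurable) fact+
  have int: "integrable (MI \<Otimes>\<^sub>M MI) (\<lambda>(t, s). ?f t s)"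
  proof (rule MM.Fubini_integrable)
    obtain B where B: "\<And>t. t \<in> {-1..1} \<Longrightarrow> norm (neg_deriv \<phi> t) \<le> B"
      using continuous_bounded[OF smooth_continuous[OF sm]] by blast
    show "integrable MI (\<lambda>t. LINT s|MI. norm (case (t, s) of (t, s) \<Rightarrow> ?f t s))"
    proof (rule integrable_MI_bounded)
      have "(\<lambda>(t, s). norm (?f t s)) \<in> borel_measurable (MI \<Otimes>\<^sub>M MI)"
        using measurable_compose[OF m borel_measurable_norm] by (simp add: split_beta')
      from MI.borel_measurable_lebesgue_integral[OF this]
      show "(\<lambda>t. LINT s|MI. norm (case (t, s) of (t, s) \<Rightarrow> ?f t s)) \<in> borel_measurable MI"
        by simp
      fix t assume t: "t \<in> \<I>"
      have "(LINT s|MI. norm (?f t s)) \<le> (LINT s|MI. norm (F s) * B)"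
      proof (rule integral_mono')
        fix s
        have "0 \<le> B" "norm (neg_deriv \<phi> t) \<le> B"
          using order_trans[OF norm_ge_zero B[of t]] B[of t] t by auto
        then show "norm (?f t s) \<le> norm (F s) * B" "0 \<le> norm (F s) * B"
          by (auto simp: norm_mult intro: mult_left_mono)
      qed (use L2I_integrable[OF F] in auto)
      moreover have "0 \<le> (LINT s|MI. norm (?f t s))" by (rule Bochner_Integration.integral_nonneg) auto
      ultimately show "norm (LINT s|MI. norm (case (t, s) of (t, s) \<Rightarrow> ?f t s)) \<le> (LINT s|MI. norm (F s) * B)"
        by simp
    qed
  qed (use m int_s in auto)
  have "pairing (primitive F) (neg_deriv \<phi>) = (LINT t|MI. LINT s|MI. ?f t s)"
    unfolding pairing_def primitive_def
    by (rule Bochner_Integration.integral_cong) (auto simp flip: integral_mult_left_zero intro!: Bochner_Integration.integral_cong)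
  also have "\<dots> = (LINT s|MI. LINT t|MI. ?f t s)"
    using MM.Fubini_integral[OF int] by simp
  also have "\<dots> = (LINT s|MI. F s * \<phi> s)"
  proof (rule Bochner_Integration.integral_cong)
    fix s assume "s \<in> space MI"
    then have "F s * integral\<^sup>L MI (\<lambda>t. if s < t then neg_deriv \<phi> t else 0) = F s * \<phi> s"
      using integral_tail[OF \<phi>, of s] by simp
    moreover have "(LINT t|MI. ?f t s) = F s * integral\<^sup>L MI (\<lambda>t. if s < t then neg_deriv \<phi> t else 0)"
      unfolding integral_mult_right_zero[symmetric] by (rule Bochner_Integration.integral_cong) auto
    ultimately show "(LINT t|MI. ?f t s) = F s * \<phi> s" by simp
  qed simp
  finally show ?thesis by (simp add: pairing_def)
qed

section \<open>Decomposition of test functions and regularity\<close>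

lemma bump_normalized:
  assumes "a < b" "-1 < a" "b < 1"
  obtains \<beta> :: "real \<Rightarrow> complex" where "smooth \<beta>" "vanishes_outside a b \<beta>" "integral {-1..1} \<beta> = 1"
proof -
  let ?b = "bump 1 a b"
  have c: "continuous_on {-1..1} ?b" by (intro smooth_continuous smooth_bump)
  have "integral {-1..1} ?b \<noteq> 0"
  proof
    assume "integral {-1..1} ?b = 0"
    then have "?b ((a + b) / 2) = 0"
      using integral_eq_0_iff[OF c] bump_bounds(1) assms by auto
    then show False using bump_pos[of 1 a "(a + b) / 2" b] assms by simp
  qed
  moreover define \<kappa> where "\<kappa> = integral {-1..1} ?b"
  ultimately have \<kappa>: "\<kappa> \<noteq> 0" by simp
  define \<beta> where "\<beta> t = complex_of_real (inverse \<kappa> * ?b t)" for t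
  show thesis
  proof (rule that)
    show "smooth \<beta>" unfolding \<beta>_def
      by (intro smooth_linear[OF bounded_linear_of_real] smooth_cmult smooth_bump)
    show "vanishes_outside a b \<beta>" by (auto simp: \<beta>_def vanishes_outside_def bump_outside)
    have "((\<lambda>t. inverse \<kappa> * ?b t) has_integral inverse \<kappa> * \<kappa>) {-1..1}"
      unfolding \<kappa>_def by (intro has_integral_mult_right integrable_integral integrable_continuous_interval c)
    from has_integral_linear[OF this bounded_linear_of_real[where 'a = complex]]
    show "integral {-1..1} \<beta> = 1" using \<kappa> by (intro integral_unique) (simp add: \<beta>_def[abs_def] o_def)
  qed
qed

lemma integral_zero_ext: "(\<And>t. t \<in> S \<Longrightarrow> f t = 0) \<Longrightarrow> integral S f = 0"
  by (metis integral_0 integral_cong)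

text \<open>Here \<open>dop [:-c, 1:] \<psi> = -\<psi>' - c \<psi>\<close>, with integrating factor \<open>exp (c t)\<close>.\<close>

lemma first_order_solution:
  fixes g :: "real \<Rightarrow> complex"
  assumes g: "test g" and 0: "integral {-1..1} (\<lambda>s. exp (c * of_real s) * g s) = 0"
  obtains \<psi> where "test \<psi>" "dop [:-c, 1:] \<psi> = g"
proof -
  have sg: "smooth g" by (rule test_smooth[OF g])
  obtain a b where ab: "-1 < a" "b < 1" and a0: "a \<le> 0" and b0: "0 \<le> b" and va: "vanishes_outside a b g"
    using test_bounds[OF g, of 0 0] by auto
  define F where "F s = exp (c * of_real s) * g s" for s
  have F: "F s = 0" if "s \<notin> {a..b}" for s using that va by (simp add: F_def vanishes_outside_def)
  have cF: "continuous_on S F" for S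
    unfolding F_def by (intro smooth_continuous smooth_mult smooth_exp sg)
  have iF: "F integrable_on {u..v}" for u v by (intro integrable_continuous_interval cF)
  define H where "H t = integral {-1..t} F" for t
  have H0: "H t = 0" if "t < a" for t
    unfolding H_def by (rule integral_zero_ext) (use that F in auto)
  \<comment> \<open>To the right of the support of g, H is the full weighted integral of g, which
    vanishes by hypothesis; this is what gives the solution compact support.\<close>
  have H1: "H t = 0" if "b < t" "t < 1" for t
  proof -
    have "integral {-1..t} F + integral {t..1} F = integral {-1..1} F"
      by (rule Henstock_Kurzweil_Integration.integral_combine) (use that ab a0 b0 iF in auto)
    moreover have "integral {t..1} F = 0" by (rule integral_zero_ext) (use that F in auto)
    moreover have "integral {-1..1} F = 0" using 0 by (simp add: F_def[abs_def])
    ultimately show ?thesis by (simp add: H_def)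
  qed
  define \<psi> where "\<psi> t = (if t \<in> {-1<..<1} then - exp (- c * of_real t) * H t else 0)" for t
  have v\<psi>: "vanishes_outside a b \<psi>"
    unfolding vanishes_outside_def \<psi>_def using H0 H1 by (auto simp: not_le)
  have d: "(\<psi> has_vector_derivative (- c * \<psi> t + - g t)) (at t)" for t
  proof (cases "t \<in> {-1<..<1}")
    case True
    have "(H has_vector_derivative F t) (at t within {-1..1})"
      unfolding H_def using True by (intro integral_has_vector_derivative cF) auto
    then have H: "(H has_vector_derivative F t) (at t)"
      using True at_within_Icc_at[of "-1" t 1] by simp
    have e: "((\<lambda>t. exp (- c * of_real t)) has_vector_derivative (- c * exp (- c * of_real t))) (at t)"
      using smooth_has_vd[OF smooth_exp(1)[of "- c"]] by (simp only: smooth_exp(2))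
    have "((\<lambda>t. - (exp (- c * of_real t) * H t)) has_vector_derivative
        - (exp (- c * of_real t) * F t + - c * exp (- c * of_real t) * H t)) (at t)"
      by (intro has_vector_derivative_minus has_vector_derivative_mult e H)
    moreover have "exp (- c * of_real t) * F t = g t"
      by (simp add: F_def exp_minus)
    ultimately have "((\<lambda>t. - (exp (- c * of_real t) * H t)) has_vector_derivative (- c * \<psi> t + - g t)) (at t)"
      using True by (simp add: \<psi>_def algebra_simps)
    then show ?thesis
      by (rule has_vector_derivative_transform_within_open[of _ _ _ "{-1<..<1}"]) (use True in \<open>auto simp: \<psi>_def\<close>)
  next
    case False
    then have t: "t \<notin> {a..b}" using ab by auto
    have "((\<lambda>_. 0) has_vector_derivative 0) (at t)" by simp
    then have "(\<psi> has_vector_derivative 0) (at t)"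
      by (rule has_vector_derivative_transform_within_open[of _ _ _ "- {a..b}"])
        (use v\<psi> t in \<open>auto simp: vanishes_outside_def\<close>)
    then show ?thesis using t va v\<psi> by (simp add: vanishes_outside_def)
  qed
  \<comment> \<open>Since \<psi>' = -c \<psi> - g, the functions d \<psi> + h with h smooth form a
    set stable under differentiation.\<close>
  have "smooth \<psi>"
  proof (rule smooth_coinduct[of _ "{\<lambda>t. d * \<psi> t + h t |d h. smooth h}"])
    show "\<psi> \<in> {\<lambda>t. d * \<psi> t + h t |d h. smooth h}"
      by (auto intro!: exI[of _ 1] exI[of _ "\<lambda>_. 0"])
    fix k assume "k \<in> {\<lambda>t. d * \<psi> t + h t |d h. smooth h}"
    then obtain e h where k: "k = (\<lambda>t. e * \<psi> t + h t)" and h: "smooth h" by auto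
    have dk: "(k has_vector_derivative e * (- c * \<psi> t + - g t) + vd h t) (at t)" for t
      unfolding k by (intro has_vector_derivative_add smooth_has_vd h
          bounded_linear.has_vector_derivative[OF bounded_linear_mult_right] d)
    then have "vd k = (\<lambda>t. (e * - c) * \<psi> t + (- e * g t + vd h t))"
      by (subst vd_eqI[OF dk]) (simp add: algebra_simps)
    moreover have "smooth (\<lambda>t. - e * g t + vd h t)" by (intro smooth_add smooth_cmult sg smooth_vd h)
    ultimately have "\<exists>d h. vd k = (\<lambda>t. d * \<psi> t + h t) \<and> smooth h"
      by (intro exI[of _ "e * - c"] exI[of _ "\<lambda>t. - e * g t + vd h t"] conjI)
    then show "(\<forall>t. k differentiable at t) \<and> vd k \<in> {\<lambda>t. d * \<psi> t + h t |d h. smooth h}"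
      using differentiableI_vector[OF dk] by simp
  qed
  moreover have "dop [:-c, 1:] \<psi> = g"
    using vd_eqI[OF d] by (simp add: dop_pCons neg_deriv_def)
  ultimately show thesis using that testI v\<psi> ab by blast
qed

text \<open>The pairing with exp(c t) is the only obstruction to solving -\<psi>' - c \<psi> =
  \<phi> in test functions. It is removed by subtracting a multiple of one fixed \<rho>, whose
  support may be placed in any inner interval.\<close>

lemma first_order_decomposition:
  assumes "a < b" "-1 < a" "b < 1"
  obtains \<rho> :: "real \<Rightarrow> complex" where "test \<rho>" "vanishes_outside a b \<rho>"
    "\<And>\<phi>. test \<phi> \<Longrightarrow> \<exists>\<psi>. test \<psi> \<and> \<phi> = (\<lambda>t. pairing (\<lambda>s. exp (c * of_real s)) \<phi> * \<rho> t + dop [:-c, 1:] \<psi> t)"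
proof -
  obtain \<beta> :: "real \<Rightarrow> complex" where \<beta>: "smooth \<beta>" "vanishes_outside a b \<beta>" "integral {-1..1} \<beta> = 1"
    using bump_normalized[OF assms] by blast
  \<comment> \<open>The factor exp(-c t) makes the pairing of exp(c t) with \<rho> equal to the
    integral of \<beta>, that is, to 1.\<close>
  define \<rho> where "\<rho> t = exp (- c * of_real t) * \<beta> t" for t
  have \<rho>: "vanishes_outside a b \<rho>" using \<beta>(2) by (auto simp: vanishes_outside_def \<rho>_def)
  have s\<rho>: "smooth \<rho>" unfolding \<rho>_def by (intro smooth_mult smooth_exp \<beta>)
  have t\<rho>: "test \<rho>" by (rule testI[OF s\<rho> \<rho>]) (use assms in auto)
  have "\<exists>\<psi>. test \<psi> \<and> \<phi> = (\<lambda>t. pairing (\<lambda>s. exp (c * of_real s)) \<phi> * \<rho> t + dop [:-c, 1:] \<psi> t)"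
    if \<phi>: "test \<phi>" for \<phi>
  proof -
    define \<alpha> where "\<alpha> = pairing (\<lambda>s. exp (c * of_real s)) \<phi>"
    have c: "continuous_on {-1..1} (\<lambda>s. exp (c * of_real s) * \<phi> s)"
      by (intro smooth_continuous smooth_mult smooth_exp test_smooth[OF \<phi>])
    have \<alpha>: "((\<lambda>s. exp (c * of_real s) * \<phi> s) has_integral \<alpha>) {-1..1}"
      unfolding \<alpha>_def pairing_def continuous_integrable_MI(2)[OF c]
      by (intro integrable_integral integrable_continuous_interval c)
    have "(\<beta> has_integral 1) {-1..1}"
      using \<beta>(3) integrable_integral[OF integrable_continuous_interval[OF smooth_continuous[OF \<beta>(1)]]] by metis
    then have "((\<lambda>s. exp (c * of_real s) * \<phi> s + - \<alpha> * \<beta> s) has_integral \<alpha> + - \<alpha> * 1) {-1..1}"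
      by (intro has_integral_add \<alpha> has_integral_mult_right)
    moreover have "(\<lambda>s. exp (c * of_real s) * \<phi> s + - \<alpha> * \<beta> s) = (\<lambda>s. exp (c * of_real s) * (\<phi> s + - \<alpha> * \<rho> s))"
      by (auto simp: \<rho>_def exp_minus field_simps)
    ultimately have "integral {-1..1} (\<lambda>s. exp (c * of_real s) * (\<phi> s + - \<alpha> * \<rho> s)) = 0"
      by (intro integral_unique) simp
    moreover have "test (\<lambda>s. \<phi> s + - \<alpha> * \<rho> s)" by (intro test_add test_cmult t\<rho> \<phi>)
    ultimately obtain \<psi> where \<psi>: "test \<psi>" "dop [:-c, 1:] \<psi> = (\<lambda>s. \<phi> s + - \<alpha> * \<rho> s)"
      using first_order_solution by blast
    then show ?thesis by (intro exI[of _ \<psi>]) (auto simp: \<alpha>_def)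
  qed
  then show thesis using that t\<rho> \<rho> by blast
qed

text \<open>Modulo the range of P(-d/dt), every test function can be moved into a prescribed
  interval. The fundamental theorem of algebra splits off a linear factor; the remainder of the
  first-order step is hit by the operator of the other factor, which does not enlarge
  supports.\<close>

lemma test_decomposition_complex:
  fixes P :: "complex poly"
  assumes "a < b" "-1 < a" "b < 1"
  shows "P \<noteq> 0 \<Longrightarrow> test \<phi> \<Longrightarrow> \<exists>\<rho> \<psi>. test \<rho> \<and> vanishes_outside a b \<rho> \<and> test \<psi> \<and> \<phi> = (\<lambda>t. \<rho> t + dop P \<psi> t)"
proof (induction "degree P" arbitrary: P \<phi>)
  case 0
  then obtain k where k: "P = [:k:]" "k \<noteq> 0" by (metis degree_eq_zeroE pCons_0_0)
  have "\<phi> = (\<lambda>t. 0 + dop P (\<lambda>t. inverse k * \<phi> t) t)"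
    using k by (simp add: dop_pCons flip: mult.assoc)
  moreover have "vanishes_outside a b (\<lambda>_. 0 :: complex)" by (simp add: vanishes_outside_def)
  ultimately show ?case using test_cmult[OF 0(3), of "inverse k"] test_zero by blast
next
  case (Suc n)
  have "\<not> constant (poly P)" using Suc.hyps(2) by (simp add: constant_degree)
  then obtain c where "poly P c = 0" using fundamental_theorem_of_algebra by blast
  then obtain Q where Q: "P = [:-c, 1:] * Q" using poly_eq_0_iff_dvd by (metis dvdE)
  then have Q0: "Q \<noteq> 0" "[:-c, 1:] \<noteq> 0" using Suc.prems by auto
  have "degree P = 1 + degree Q" using Q0 unfolding Q by (subst degree_mult_eq) auto
  then have "n = degree Q" using Suc.hyps(2) by simp
  then obtain \<rho>1 \<psi>1 where 1: "test \<rho>1" "vanishes_outside a b \<rho>1" "test \<psi>1" "\<phi> = (\<lambda>t. \<rho>1 t + dop Q \<psi>1 t)"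
    using Suc.hyps(1)[of Q \<phi>] Q0 Suc.prems by blast
  obtain \<rho> where \<rho>: "test \<rho>" "vanishes_outside a b \<rho>"
    "\<And>\<phi>. test \<phi> \<Longrightarrow> \<exists>\<psi>. test \<psi> \<and> \<phi> = (\<lambda>t. pairing (\<lambda>s. exp (c * of_real s)) \<phi> * \<rho> t + dop [:-c, 1:] \<psi> t)"
    using first_order_decomposition[OF assms] by blast
  define \<alpha> where "\<alpha> = pairing (\<lambda>s. exp (c * of_real s)) \<psi>1"
  obtain \<psi> where \<psi>: "test \<psi>" "\<psi>1 = (\<lambda>t. \<alpha> * \<rho> t + dop [:-c, 1:] \<psi> t)"
    using \<rho>(3)[OF 1(3)] \<alpha>_def by blast
  define \<rho>2 where "\<rho>2 t = \<rho>1 t + \<alpha> * dop Q \<rho> t" for t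
  have "test \<rho>2" unfolding \<rho>2_def by (intro test_add test_cmult test_dop 1 \<rho>)
  moreover have "vanishes_outside a b \<rho>2"
    using 1(2) vanishes_outside_dop[OF \<rho>(2), of Q] by (auto simp: vanishes_outside_def \<rho>2_def)
  moreover have "\<phi> = (\<lambda>t. \<rho>2 t + dop P \<psi> t)"
  proof -
    have "dop Q \<psi>1 = (\<lambda>t. \<alpha> * dop Q \<rho> t + dop (Q * [:-c, 1:]) \<psi> t)"
      unfolding \<psi>(2) using \<rho>(1) \<psi>(1)
      by (simp only: dop_add_fun dop_cmult_fun dop_mult smooth_cmult smooth_dop test_smooth)
    then show ?thesis unfolding 1(4) \<rho>2_def Q by (simp only: mult.commute[of Q] add.assoc)
  qed
  ultimately show ?case using \<psi>(1) by blast
qed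

lemma test_of_real: "test \<phi> \<Longrightarrow> test (\<lambda>t. complex_of_real (\<phi> t))"
  by (rule test_linear[OF bounded_linear_of_real])

text \<open>Complexify and take real parts; the coefficients of P are real, so Re passes through the
  operator.\<close>

lemma test_decomposition:
  fixes P :: "real poly"
  assumes ab: "a < b" "-1 < a" "b < 1" and P: "P \<noteq> 0" and \<phi>: "test \<phi>"
  obtains \<rho> \<psi> where "test \<rho>" "vanishes_outside a b \<rho>" "test \<psi>" "\<phi> = (\<lambda>t. \<rho> t + dop P \<psi> t)"
proof -
  have "map_poly complex_of_real P \<noteq> 0" using P by (simp add: map_poly_eq_0_iff)
  then obtain \<rho> \<psi> where *: "test \<rho>" "vanishes_outside a b \<rho>" "test \<psi>"
      "(\<lambda>t. complex_of_real (\<phi> t)) = (\<lambda>t. \<rho> t + dop (map_poly complex_of_real P) \<psi> t)"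
    using test_decomposition_complex[OF ab _ test_of_real[OF \<phi>], of "map_poly complex_of_real P"] by metis
  show thesis
  proof (rule that)
    show "test (\<lambda>t. Re (\<rho> t))" "test (\<lambda>t. Re (\<psi> t))"
      by (intro test_linear[OF bounded_linear_Re] *)+
    show "vanishes_outside a b (\<lambda>t. Re (\<rho> t))" using *(2) by (auto simp: vanishes_outside_def)
    show "\<phi> = (\<lambda>t. Re (\<rho> t) + dop P (\<lambda>t. Re (\<psi> t)) t)"
    proof
      fix t
      have "\<phi> t = Re (complex_of_real (\<phi> t))" by simp
      also have "\<dots> = Re (\<rho> t + dop (map_poly complex_of_real P) \<psi> t)" using fun_cong[OF *(4), of t] by simp
      finally show "\<phi> t = Re (\<rho> t) + dop P (\<lambda>t. Re (\<psi> t)) t"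
        by (simp add: dop_Re test_smooth[OF *(3)])
    qed
  qed
qed

text \<open>Linear functionals on test functions stand for distributions; continuity is never needed.\<close>

definition test_linear :: "((real \<Rightarrow> 'a::real_normed_field) \<Rightarrow> 'a) \<Rightarrow> bool" where
  "test_linear T \<longleftrightarrow> (\<forall>\<phi> \<psi>. test \<phi> \<longrightarrow> test \<psi> \<longrightarrow> T (\<lambda>t. \<phi> t + \<psi> t) = T \<phi> + T \<psi>) \<and>
     (\<forall>c \<phi>. test \<phi> \<longrightarrow> T (\<lambda>t. c * \<phi> t) = c * T \<phi>)"

lemma test_linear_dop: "test_linear T \<Longrightarrow> test_linear (\<lambda>\<phi>. T (dop P \<phi>))"
  unfolding test_linear_def by (auto simp: dop_add_fun dop_cmult_fun test_smooth test_dop)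

lemma test_linear_pairing: "f \<in> L2I \<Longrightarrow> test_linear (pairing f)"
  unfolding test_linear_def by (auto simp: pairing_add pairing_cmult test_smooth)

text \<open>\<open>f0\<close> is the variation of constants solution. The difference between T and
  the pairing with \<open>f0\<close> kills the range of the first-order operator, so by the
  decomposition it is determined by its value k at \<rho> and equals the pairing with k exp(c
  t).\<close>

lemma first_order_regularity:
  fixes T :: "(real \<Rightarrow> complex) \<Rightarrow> complex"
  assumes T: "test_linear T" and F: "F \<in> L2I"
    and eq: "\<And>\<phi>. test \<phi> \<Longrightarrow> T (dop [:-c, 1:] \<phi>) = pairing F \<phi>"
  obtains f where "f \<in> L2I" "\<And>\<phi>. test \<phi> \<Longrightarrow> T \<phi> = pairing f \<phi>"
proof -
  let ?E = "\<lambda>t. exp (c * of_real t)" and ?E' = "\<lambda>t. exp (- c * of_real t)"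
  have bdd: "(\<lambda>t. exp (d * of_real t) * f t) \<in> L2I" if "f \<in> L2I" for f :: "real \<Rightarrow> complex" and d
  proof -
    have c: "continuous_on {-1..1} (\<lambda>t. exp (d * complex_of_real t))" by (intro smooth_continuous smooth_exp)
    obtain B where "\<And>t. t \<in> {-1..1} \<Longrightarrow> norm (exp (d * complex_of_real t)) \<le> B"
      using continuous_bounded[OF c] by blast
    then show ?thesis by (intro L2I_mult_bounded[OF that, where B = B] continuous_MI_measurable[OF c]) auto
  qed
  define f0 where "f0 t = ?E t * primitive (\<lambda>s. ?E' s * F s) t" for t
  have f0: "f0 \<in> L2I" unfolding f0_def by (intro bdd primitive_L2I F)
  have f0_eq: "pairing f0 (dop [:-c, 1:] \<phi>) = pairing F \<phi>" if \<phi>: "test \<phi>" for \<phi>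
  proof -
    have "neg_deriv (\<lambda>t. ?E t * \<phi> t) = (\<lambda>t. ?E t * dop [:-c, 1:] \<phi> t)"
      unfolding neg_deriv_def smooth_mult(2)[OF smooth_exp(1) test_smooth[OF \<phi>]]
      by (simp add: smooth_exp dop_pCons neg_deriv_def algebra_simps)
    then have "pairing f0 (dop [:-c, 1:] \<phi>) = pairing (primitive (\<lambda>s. ?E' s * F s)) (neg_deriv (\<lambda>t. ?E t * \<phi> t))"
      unfolding f0_def by (intro pairing_cong) (simp add: mult_ac)
    also have "\<dots> = pairing (\<lambda>s. ?E' s * F s) (\<lambda>t. ?E t * \<phi> t)"
      by (intro pairing_primitive bdd F test_mult smooth_exp \<phi>)
    also have "\<dots> = pairing F \<phi>" by (intro pairing_cong) (simp add: exp_minus field_simps)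
    finally show ?thesis .
  qed
  have half: "-1/2 < (1/2 :: real)" "-1 < (-1/2 :: real)" "1/2 < (1 :: real)" by simp_all
  obtain \<rho> where \<rho>: "test \<rho>"
    "\<And>\<phi>. test \<phi> \<Longrightarrow> \<exists>\<psi>. test \<psi> \<and> \<phi> = (\<lambda>t. pairing ?E \<phi> * \<rho> t + dop [:-c, 1:] \<psi> t)"
    using first_order_decomposition[OF half, of c] by blast
  define k where "k = T \<rho> - pairing f0 \<rho>"
  define f where "f t = f0 t + k * ?E t" for t
  have E: "?E \<in> L2I" by (intro L2I_smooth smooth_exp)
  have "T \<phi> = pairing f \<phi>" if \<phi>: "test \<phi>" for \<phi>
  proof -
    obtain \<psi> where \<psi>: "test \<psi>" "\<phi> = (\<lambda>t. pairing ?E \<phi> * \<rho> t + dop [:-c, 1:] \<psi> t)"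
      using \<rho>(2)[OF \<phi>] by blast
    define \<alpha> where "\<alpha> = pairing ?E \<phi>"
    have \<phi>_eq: "\<phi> = (\<lambda>t. \<alpha> * \<rho> t + dop [:-c, 1:] \<psi> t)" using \<psi>(2) by (simp add: \<alpha>_def)
    have lin: "S \<phi> = \<alpha> * S \<rho> + S (dop [:-c, 1:] \<psi>)" if "test_linear S" for S
      unfolding \<phi>_eq using that \<rho>(1) \<psi>(1) unfolding test_linear_def
      by (simp only: test_cmult test_dop)
    have "pairing f \<phi> = pairing f0 \<phi> + k * \<alpha>"
      unfolding f_def \<alpha>_def using \<phi>
      by (simp add: pairing_add_left pairing_cmult_left f0 L2I_cmult E test_smooth)
    also have "\<dots> = \<alpha> * pairing f0 \<rho> + pairing F \<psi> + k * \<alpha>"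
      unfolding lin[OF test_linear_pairing[OF f0]] by (simp add: f0_eq \<psi>(1))
    also have "\<dots> = T \<phi>" unfolding lin[OF T] by (simp add: eq \<psi>(1) k_def algebra_simps)
    finally show ?thesis by simp
  qed
  moreover have "f \<in> L2I" unfolding f_def by (intro L2I_add f0 L2I_cmult E)
  ultimately show thesis using that by blast
qed

text \<open>Peeling off a linear factor shows that T composed with the operator of Q is given by a
  square integrable function, which is the same problem for a polynomial of smaller degree.\<close>

lemma regularity_complex:
  fixes P :: "complex poly"
  shows "P \<noteq> 0 \<Longrightarrow> test_linear T \<Longrightarrow> F \<in> L2I \<Longrightarrow> (\<And>\<phi>. test \<phi> \<Longrightarrow> T (dop P \<phi>) = pairing F \<phi>)
    \<Longrightarrow> \<exists>f\<in>L2I. \<forall>\<phi>. test \<phi> \<longrightarrow> T \<phi> = pairing f \<phi>"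
proof (induction "degree P" arbitrary: P F)
  case 0
  then obtain k where k: "P = [:k:]" "k \<noteq> 0" by (metis degree_eq_zeroE pCons_0_0)
  have "T \<phi> = pairing (\<lambda>t. inverse k * F t) \<phi>" if \<phi>: "test \<phi>" for \<phi>
  proof -
    have "k * T \<phi> = T (dop P \<phi>)" using k \<phi> 0(3) by (simp add: test_linear_def dop_pCons)
    then have "T \<phi> = inverse k * pairing F \<phi>" using 0(5)[OF \<phi>] k by (simp add: field_simps)
    then show ?thesis by (simp only: pairing_cmult_left)
  qed
  then show ?case using L2I_cmult[OF 0(4), of "inverse k"] by blast
next
  case (Suc n)
  have "\<not> constant (poly P)" using Suc.hyps(2) by (simp add: constant_degree)
  then obtain c where "poly P c = 0" using fundamental_theorem_of_algebra by blast
  then obtain Q where Q: "P = Q * [:-c, 1:]" using poly_eq_0_iff_dvd by (metis dvdE mult.commute)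
  then have Q0: "Q \<noteq> 0" "[:-c, 1:] \<noteq> 0" using Suc.prems by auto
  have "degree P = 1 + degree Q" using Q0 unfolding Q by (subst degree_mult_eq) auto
  then have n: "n = degree Q" using Suc.hyps(2) by simp
  have "T (dop Q (dop [:-c, 1:] \<phi>)) = pairing F \<phi>" if "test \<phi>" for \<phi>
    using Suc.prems(4)[OF that] that unfolding Q by (simp only: dop_mult test_smooth)
  then obtain f where f: "f \<in> L2I" "\<And>\<phi>. test \<phi> \<Longrightarrow> T (dop Q \<phi>) = pairing f \<phi>"
    using first_order_regularity[OF test_linear_dop[OF Suc.prems(2)] Suc.prems(3), where c = c and P1 = Q] by blast
  then show ?case using Suc.hyps(1)[OF n Q0(1) Suc.prems(2)] by blast
qed

lemma L2I_of_real: "f \<in> L2I \<Longrightarrow> (\<lambda>t. complex_of_real (f t)) \<in> L2I"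
  by (auto simp: L2I_def)

lemma L2I_Re: assumes "f \<in> L2I" shows "(\<lambda>t. Re (f t)) \<in> L2I"
proof -
  have [measurable]: "f \<in> borel_measurable MI" using assms by (simp add: L2I_def)
  have "integrable MI (\<lambda>t. (norm (f t))\<^sup>2)" using assms by (simp add: L2I_def)
  then have "integrable MI (\<lambda>t. (norm (Re (f t)))\<^sup>2)"
  proof (rule Bochner_Integration.integrable_bound)
    show "AE t in MI. norm ((norm (Re (f t)))\<^sup>2) \<le> norm ((norm (f t))\<^sup>2)"
    proof (rule AE_I2)
      fix t
      have "\<bar>Re (f t)\<bar>\<^sup>2 \<le> (norm (f t))\<^sup>2" by (intro power_mono abs_Re_le_cmod abs_ge_zero)
      then show "norm ((norm (Re (f t)))\<^sup>2) \<le> norm ((norm (f t))\<^sup>2)" by simp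
    qed
  qed measurable
  then show ?thesis by (simp add: L2I_def)
qed

lemma dop_Im: "smooth f \<Longrightarrow> dop P (\<lambda>t. Im (f t)) = (\<lambda>t. Im (dop (map_poly complex_of_real P) f t))"
proof (induction P arbitrary: f)
  case (pCons a P)
  then show ?case
    by (simp add: map_poly_pCons dop_pCons neg_deriv_linear[OF bounded_linear_Im] smooth_neg_deriv)
qed simp

lemma pairing_complex:
  assumes F: "F \<in> L2I" and \<phi>: "smooth \<phi>"
  shows "pairing (\<lambda>t. complex_of_real (F t)) \<phi> = Complex (pairing F (\<lambda>t. Re (\<phi> t))) (pairing F (\<lambda>t. Im (\<phi> t)))"
proof -
  have "integrable MI (\<lambda>t. complex_of_real (F t) * \<phi> t)"
    by (intro L2I_mult_smooth_integrable L2I_of_real F \<phi>)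
  then show ?thesis
    unfolding pairing_def complex_eq_iff
    by (simp flip: integral_Re integral_Im)
qed

text \<open>A distribution solving an ordinary differential equation with square integrable
  right-hand side is itself square integrable. T is extended to complex test functions by acting on
  real and imaginary parts, so that P can be factored.\<close>

lemma regularity:
  fixes P :: "real poly" and T :: "(real \<Rightarrow> real) \<Rightarrow> real"
  assumes P: "P \<noteq> 0" and T: "test_linear T" and F: "F \<in> L2I"
    and eq: "\<And>\<phi>. test \<phi> \<Longrightarrow> T (dop P \<phi>) = pairing F \<phi>"
  obtains f where "f \<in> L2I" "\<And>\<phi>. test \<phi> \<Longrightarrow> T \<phi> = pairing f \<phi>"
proof -
  define S where "S \<phi> = Complex (T (\<lambda>t. Re (\<phi> t))) (T (\<lambda>t. Im (\<phi> t)))" for \<phi>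
  have ri: "test (\<lambda>t. Re (\<phi> t))" "test (\<lambda>t. Im (\<phi> t))" if "test \<phi>" for \<phi>
    by (intro test_linear[OF bounded_linear_Re] test_linear[OF bounded_linear_Im] that)+
  have T_add: "T (\<lambda>t. \<phi> t + \<psi> t) = T \<phi> + T \<psi>" if "test \<phi>" "test \<psi>" for \<phi> \<psi>
    using T that by (simp add: test_linear_def)
  have T_mult: "T (\<lambda>t. c * \<phi> t) = c * T \<phi>" if "test \<phi>" for \<phi> c
    using T that by (simp add: test_linear_def)
  have T_diff: "T (\<lambda>t. c * \<phi> t - d * \<psi> t) = c * T \<phi> - d * T \<psi>" if "test \<phi>" "test \<psi>" for \<phi> \<psi> c d
  proof -
    have "T (\<lambda>t. c * \<phi> t + - d * \<psi> t) = T (\<lambda>t. c * \<phi> t) + T (\<lambda>t. - d * \<psi> t)"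
      by (intro T_add test_cmult that)
    then show ?thesis unfolding T_mult[OF that(1)] T_mult[OF that(2)] by simp
  qed
  have "test_linear S"
    unfolding test_linear_def
  proof (intro conjI allI impI)
    fix \<phi> \<psi> :: "real \<Rightarrow> complex" and c assume \<phi>: "test \<phi>"
    show "S (\<lambda>t. c * \<phi> t) = c * S \<phi>"
      using ri[OF \<phi>] by (simp add: S_def complex_eq_iff T_diff T_add T_mult test_cmult)
    assume "test \<psi>"
    then show "S (\<lambda>t. \<phi> t + \<psi> t) = S \<phi> + S \<psi>"
      using ri \<phi> by (simp add: S_def T_add complex_eq_iff)
  qed
  moreover have "S (dop (map_poly complex_of_real P) \<phi>) = pairing (\<lambda>t. complex_of_real (F t)) \<phi>" if \<phi>: "test \<phi>" for \<phi>
    unfolding S_def pairing_complex[OF F test_smooth[OF \<phi>]]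
    using dop_Re[OF test_smooth[OF \<phi>], of P] dop_Im[OF test_smooth[OF \<phi>], of P] eq ri[OF \<phi>] by metis
  moreover have "map_poly complex_of_real P \<noteq> 0" using P by (simp add: map_poly_eq_0_iff)
  ultimately obtain f where f: "f \<in> L2I" "\<And>\<phi>. test \<phi> \<Longrightarrow> S \<phi> = pairing f \<phi>"
    using regularity_complex[of "map_poly complex_of_real P" S] L2I_of_real[OF F] by blast
  have "T \<phi> = pairing (\<lambda>t. Re (f t)) \<phi>" if \<phi>: "test \<phi>" for \<phi>
  proof -
    have "T \<phi> = Re (S (\<lambda>t. complex_of_real (\<phi> t)))" by (simp add: S_def)
    also have "\<dots> = Re (pairing f (\<lambda>t. complex_of_real (\<phi> t)))" using f(2)[OF test_of_real[OF \<phi>]] by simp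
    also have "\<dots> = pairing (\<lambda>t. Re (f t)) \<phi>"
      unfolding pairing_def using L2I_mult_smooth_integrable[OF f(1) test_smooth[OF test_of_real[OF \<phi>]]]
      by (simp flip: integral_Re)
    finally show ?thesis .
  qed
  then show thesis using that L2I_Re[OF f(1)] by blast
qed

section \<open>Linear algebra\<close>

lemma square_injective_inverse:
  assumes A: "A \<in> carrier_mat n n" and inj: "\<And>v. v \<in> carrier_vec n \<Longrightarrow> A *\<^sub>v v = 0\<^sub>v n \<Longrightarrow> v = 0\<^sub>v n"
  obtains B :: "real mat" where "B \<in> carrier_mat n n" "A * B = 1\<^sub>m n" "B * A = 1\<^sub>m n"
proof -
  have "det A \<noteq> 0" using det_0_iff_vec_prod_zero_field[OF A] inj by blast
  from det_non_zero_imp_unit[OF A this, of "()"] show thesis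
    using that by (auto simp: Units_def ring_mat_def)
qed

lemma mat_unit_vec_col:
  assumes "(M :: real mat) \<in> carrier_mat n k" "j < k" shows "M *\<^sub>v unit_vec k j = col M j"
  by (rule eq_vecI) (use assms in auto)

lemma mult_mat_zero_vec: "(M :: real mat) \<in> carrier_mat n k \<Longrightarrow> M *\<^sub>v 0\<^sub>v k = 0\<^sub>v n"
  by (rule eq_vecI) auto

lemma scalar_prod_transpose:
  assumes "A \<in> carrier_mat r n" "v \<in> carrier_vec r" "w \<in> carrier_vec n"
  shows "v \<bullet> (A *\<^sub>v w) = (transpose_mat A *\<^sub>v v) \<bullet> (w :: real vec)"
proof -
  have "v \<bullet> (A *\<^sub>v w) = (\<Sum>i<r. \<Sum>j<n. v $ i * (A $$ (i, j) * w $ j))"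
    using assms by (simp add: scalar_prod_def sum_distrib_left atLeast0LessThan)
  also have "\<dots> = (\<Sum>j<n. \<Sum>i<r. v $ i * (A $$ (i, j) * w $ j))" by (rule sum.swap)
  also have "\<dots> = (transpose_mat A *\<^sub>v v) \<bullet> w"
    using assms by (simp add: scalar_prod_def sum_distrib_left sum_distrib_right atLeast0LessThan mult_ac)
  finally show ?thesis .
qed

lemma vec_eq_of_scalar_prod:
  assumes "x \<in> carrier_vec n" "y \<in> carrier_vec n"
    and "\<And>v. v \<in> carrier_vec n \<Longrightarrow> x \<bullet> v = y \<bullet> (v :: real vec)"
  shows "x = y"
proof (rule eq_vecI)
  fix i assume "i < dim_vec y"
  then have "i < n" using assms by simp
  then show "x $ i = y $ i" using assms(3)[of "unit_vec n i"] assms(1,2) by simp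
qed (use assms in auto)

lemma vec_diff_eq_0D: "x - y = 0\<^sub>v n \<Longrightarrow> x \<in> carrier_vec n \<Longrightarrow> y \<in> carrier_vec n \<Longrightarrow> x = (y :: real vec)"
proof (rule eq_vecI)
  fix i assume xy: "x - y = 0\<^sub>v n" "x \<in> carrier_vec n" "y \<in> carrier_vec n" "i < dim_vec y"
  have "x $ i - y $ i = (x - y) $ i" using xy(4) by simp
  also have "\<dots> = 0" unfolding xy(1) using xy(3,4) by simp
  finally show "x $ i = y $ i" by simp
qed simp

text \<open>T gives coordinates on the quotient by its kernel, S is a chosen section, and 1 - S T
  projects onto the kernel. Carrying the section along replaces dimension theory by matrix
  identities.\<close>

definition splitting :: "nat \<Rightarrow> nat \<Rightarrow> real mat \<Rightarrow> real mat \<Rightarrow> bool" where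
  "splitting r n T S \<longleftrightarrow> T \<in> carrier_mat r n \<and> S \<in> carrier_mat n r \<and> T * S = 1\<^sub>m r"

lemma splittingD:
  assumes "splitting r n T S"
  shows "T \<in> carrier_mat r n" "S \<in> carrier_mat n r" "T * S = 1\<^sub>m r"
    and "x \<in> carrier_vec r \<Longrightarrow> T *\<^sub>v (S *\<^sub>v x) = x"
proof -
  show *: "T \<in> carrier_mat r n" "S \<in> carrier_mat n r" "T * S = 1\<^sub>m r"
    using assms by (auto simp: splitting_def)
  show "T *\<^sub>v (S *\<^sub>v x) = x" if "x \<in> carrier_vec r"
    using assoc_mult_mat_vec[OF *(1,2) that] * that by simp
qed

lemma splitting_remainder:
  assumes TS: "splitting r n T S" and x: "x \<in> carrier_vec n"
  shows "x - S *\<^sub>v (T *\<^sub>v x) \<in> carrier_vec n" "T *\<^sub>v (x - S *\<^sub>v (T *\<^sub>v x)) = 0\<^sub>v r"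
proof -
  note D = splittingD[OF TS]
  have Tx: "T *\<^sub>v x \<in> carrier_vec r" using D(1) x by simp
  then have STx: "S *\<^sub>v (T *\<^sub>v x) \<in> carrier_vec n" using D(2) by simp
  show "x - S *\<^sub>v (T *\<^sub>v x) \<in> carrier_vec n" using x STx by simp
  have "T *\<^sub>v (x - S *\<^sub>v (T *\<^sub>v x)) = T *\<^sub>v x - T *\<^sub>v (S *\<^sub>v (T *\<^sub>v x))"
    by (rule mult_minus_distrib_mat_vec[OF D(1) x STx])
  then show "T *\<^sub>v (x - S *\<^sub>v (T *\<^sub>v x)) = 0\<^sub>v r" using D(4)[OF Tx] Tx by simp
qed

text \<open>Coordinates on the quotient by the line of f are x_k - (f_k / f_i) x_i for k different
  from a pivot i with f_i nonzero; \<sigma> enumerates these k.\<close>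

lemma splitting_line:
  assumes f: "f \<in> carrier_vec r" "f \<noteq> 0\<^sub>v r"
  obtains Q S where "splitting (r - 1) r Q S" "0 < r"
    "\<And>x. x \<in> carrier_vec r \<Longrightarrow> Q *\<^sub>v x = 0\<^sub>v (r - 1) \<Longrightarrow> \<exists>\<kappa>. x = \<kappa> \<cdot>\<^sub>v f"
proof -
  obtain i where i: "i < r" "f $ i \<noteq> 0"
    using f by (metis carrier_vecD eq_vecI index_zero_vec)
  define \<sigma> where "\<sigma> j = (if j < i then j else Suc j)" for j
  have \<sigma>: "\<sigma> j < r" "\<sigma> j \<noteq> i" if "j < r - 1" for j using that i by (auto simp: \<sigma>_def)
  have \<sigma>_inj: "\<sigma> j = \<sigma> k \<longleftrightarrow> j = k" for j k by (auto simp: \<sigma>_def)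
  have \<sigma>_surj: "\<exists>j < r - 1. k = \<sigma> j" if "k < r" "k \<noteq> i" for k
    using that i by (intro exI[of _ "if k < i then k else k - 1"]) (auto simp: \<sigma>_def)
  define Q where "Q = mat (r - 1) r (\<lambda>(j, k). if k = \<sigma> j then 1 else if k = i then - f $ \<sigma> j / f $ i else 0)"
  define S :: "real mat" where "S = mat r (r - 1) (\<lambda>(k, j). if k = \<sigma> j then 1 else 0)"
  have "Q * S = 1\<^sub>m (r - 1)"
  proof (rule eq_matI)
    fix j j' assume j: "j < dim_row (1\<^sub>m (r - 1))" "j' < dim_col (1\<^sub>m (r - 1))"
    have "(Q * S) $$ (j, j') = (\<Sum>k<r. Q $$ (j, k) * (if k = \<sigma> j' then 1 else 0))"
      using j by (simp add: Q_def S_def scalar_prod_def atLeast0LessThan)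
    also have "\<dots> = Q $$ (j, \<sigma> j')" using \<sigma>[of j'] j by (simp add: if_distrib cong: if_cong)
    also have "\<dots> = 1\<^sub>m (r - 1) $$ (j, j')" using j \<sigma>[of j'] \<sigma>_inj by (auto simp: Q_def)
    finally show "(Q * S) $$ (j, j') = 1\<^sub>m (r - 1) $$ (j, j')" .
  qed (auto simp: Q_def S_def)
  then have "splitting (r - 1) r Q S" by (simp add: splitting_def Q_def S_def)
  moreover have "\<exists>\<kappa>. x = \<kappa> \<cdot>\<^sub>v f" if x: "x \<in> carrier_vec r" and Qx: "Q *\<^sub>v x = 0\<^sub>v (r - 1)" for x
  proof -
    have *: "x $ \<sigma> j = x $ i / f $ i * f $ \<sigma> j" if j: "j < r - 1" for j
    proof -
      have "0 = (Q *\<^sub>v x) $ j" using Qx j by simp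
      also have "\<dots> = (\<Sum>k<r. Q $$ (j, k) * x $ k)"
        using j x by (simp add: Q_def scalar_prod_def atLeast0LessThan)
      also have "\<dots> = (\<Sum>k\<in>{\<sigma> j, i}. Q $$ (j, k) * x $ k)"
        by (rule sum.mono_neutral_right) (use \<sigma>[OF j] i j in \<open>auto simp: Q_def\<close>)
      also have "\<dots> = x $ \<sigma> j - f $ \<sigma> j / f $ i * x $ i"
        using \<sigma>[OF j] i j by (auto simp: Q_def)
      finally show ?thesis by simp
    qed
    have "x = (x $ i / f $ i) \<cdot>\<^sub>v f"
    proof (rule eq_vecI)
      fix k assume "k < dim_vec ((x $ i / f $ i) \<cdot>\<^sub>v f)"
      then have k: "k < r" using f by simp
      show "x $ k = ((x $ i / f $ i) \<cdot>\<^sub>v f) $ k"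
        using * \<sigma>_surj[OF k] k i f by (cases "k = i") auto
    qed (use x f in simp)
    then show ?thesis by blast
  qed
  ultimately show thesis using that i by auto
qed

text \<open>Among the split surjections whose kernel is contained in \<open>U\<close> take one with smallest image.\<close>

lemma subspace_splitting:
  assumes U: "U \<subseteq> carrier_vec n" "0\<^sub>v n \<in> U"
    and lin: "\<And>x y \<kappa>. x \<in> U \<Longrightarrow> y \<in> U \<Longrightarrow> x + \<kappa> \<cdot>\<^sub>v y \<in> U"
  obtains r T S where "splitting r n T S" "\<And>x. x \<in> carrier_vec n \<Longrightarrow> T *\<^sub>v x = 0\<^sub>v r \<longleftrightarrow> x \<in> U"
    "U \<noteq> {0\<^sub>v n} \<Longrightarrow> r < n" "r \<le> n"
proof -
  let ?P = "\<lambda>r. \<exists>T S. splitting r n T S \<and> (\<forall>x \<in> carrier_vec n. T *\<^sub>v x = 0\<^sub>v r \<longrightarrow> x \<in> U)"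
  \<comment> \<open>If T does not kill some e in U, composing with the quotient by the line of T e
    lowers r. A vector of the new kernel differs from one of the old kernel by a multiple of e, so
    it still lies in U.\<close>
  have reduce: "?P (r - 1) \<and> 0 < r"
    if TS: "splitting r n T S" and ker: "\<forall>x \<in> carrier_vec n. T *\<^sub>v x = 0\<^sub>v r \<longrightarrow> x \<in> U"
      and e: "e \<in> U" "T *\<^sub>v e \<noteq> 0\<^sub>v r" for r T S e
  proof -
    note D = splittingD[OF TS]
    have ec: "e \<in> carrier_vec n" using e U by auto
    have f: "T *\<^sub>v e \<in> carrier_vec r" using D(1) ec by simp
    obtain Q S' where Q: "splitting (r - 1) r Q S'" "0 < r"
      "\<And>x. x \<in> carrier_vec r \<Longrightarrow> Q *\<^sub>v x = 0\<^sub>v (r - 1) \<Longrightarrow> \<exists>\<kappa>. x = \<kappa> \<cdot>\<^sub>v (T *\<^sub>v e)"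
      using splitting_line[OF f e(2)] by blast
    note D' = splittingD[OF Q(1)]
    have "(Q * T) * (S * S') = Q * (T * (S * S'))" by (rule assoc_mult_mat) (use D D' in auto)
    also have "T * (S * S') = (T * S) * S'" by (rule assoc_mult_mat[symmetric]) (use D D' in auto)
    finally have "(Q * T) * (S * S') = 1\<^sub>m (r - 1)" using D D' by simp
    then have "splitting (r - 1) n (Q * T) (S * S')" using D D' by (auto simp: splitting_def)
    moreover have "x \<in> U" if x: "x \<in> carrier_vec n" and 0: "(Q * T) *\<^sub>v x = 0\<^sub>v (r - 1)" for x
    proof -
      have "Q *\<^sub>v (T *\<^sub>v x) = 0\<^sub>v (r - 1)" using 0 assoc_mult_mat_vec[OF D'(1) D(1) x] by simp
      then obtain \<kappa> where \<kappa>: "T *\<^sub>v x = \<kappa> \<cdot>\<^sub>v (T *\<^sub>v e)" using Q(3)[of "T *\<^sub>v x"] D(1) x by force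
      have "T *\<^sub>v (x - \<kappa> \<cdot>\<^sub>v e) = T *\<^sub>v x - T *\<^sub>v (\<kappa> \<cdot>\<^sub>v e)"
        by (rule mult_minus_distrib_mat_vec[OF D(1) x]) (use ec in simp)
      also have "\<dots> = 0\<^sub>v r" using \<kappa> mult_mat_vec[OF D(1) ec] f by simp
      finally have "x - \<kappa> \<cdot>\<^sub>v e \<in> U" using ker x ec by auto
      from lin[OF this e(1), of \<kappa>] have "(x - \<kappa> \<cdot>\<^sub>v e) + \<kappa> \<cdot>\<^sub>v e \<in> U" .
      moreover have "(x - \<kappa> \<cdot>\<^sub>v e) + \<kappa> \<cdot>\<^sub>v e = x" using x ec by auto
      ultimately show ?thesis by simp
    qed
    ultimately show ?thesis using Q(2) by blast
  qed
  have n: "splitting n n (1\<^sub>m n) (1\<^sub>m n)" "\<forall>x \<in> carrier_vec n. 1\<^sub>m n *\<^sub>v x = 0\<^sub>v n \<longrightarrow> x \<in> U"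
    using U by (auto simp: splitting_def)
  then have Pn: "?P n" by blast
  define r where "r = (LEAST r. ?P r)"
  have Pr: "?P r" unfolding r_def by (rule LeastI[of ?P, OF Pn])
  have le: "r \<le> r'" if "?P r'" for r' unfolding r_def by (rule Least_le[of ?P, OF that])
  obtain T S where TS: "splitting r n T S" and ker: "\<forall>x \<in> carrier_vec n. T *\<^sub>v x = 0\<^sub>v r \<longrightarrow> x \<in> U"
    using Pr by blast
  have "T *\<^sub>v e = 0\<^sub>v r" if "e \<in> U" for e
  proof (rule ccontr)
    assume "T *\<^sub>v e \<noteq> 0\<^sub>v r"
    from reduce[OF TS ker that this] have Pr1: "?P (r - 1)" and "0 < r" by blast+
    moreover have "r \<le> r - 1" by (rule le[OF Pr1])
    ultimately show False by linarith
  qed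
  moreover have "r < n" if "U \<noteq> {0\<^sub>v n}"
  proof -
    have "\<exists>e. e \<in> U \<and> e \<noteq> 0\<^sub>v n"
    proof (rule ccontr)
      assume "\<not> ?thesis"
      then have "U \<subseteq> {0\<^sub>v n}" by blast
      then show False using that U(2) by blast
    qed
    then obtain e where e: "e \<in> U" "e \<noteq> 0\<^sub>v n" by blast
    have "e \<in> carrier_vec n" using e(1) U(1) by (rule subsetD[rotated])
    then have "1\<^sub>m n *\<^sub>v e \<noteq> 0\<^sub>v n" using e(2) by simp
    from reduce[OF n e(1) this] have Pn1: "?P (n - 1)" and "0 < n" by blast+
    moreover have "r \<le> n - 1" by (rule le[OF Pn1])
    ultimately show ?thesis by linarith
  qed
  ultimately show thesis using that[OF TS] ker le[OF Pn] by blast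
qed

lemma rank_eq_of_col_space:
  assumes "A \<in> carrier_mat N a" "B \<in> carrier_mat N b"
    and "\<And>x. x \<in> carrier_vec a \<Longrightarrow> \<exists>y \<in> carrier_vec b. A *\<^sub>v x = B *\<^sub>v y"
    and "\<And>y. y \<in> carrier_vec b \<Longrightarrow> \<exists>x \<in> carrier_vec a. B *\<^sub>v y = A *\<^sub>v x"
  shows "vec_space.rank N A = vec_space.rank N (B :: real mat)"
proof -
  interpret V: vec_space "TYPE(real)" N .
  have "V.col_space A = V.col_space B"
    using assms by (subst (1 2) V.col_space_eq) (auto, metis+)
  then show ?thesis by (simp add: V.rank_def V.col_space_def)
qed

lemma rank_injective:
  fixes F :: "real mat"
  assumes F: "F \<in> carrier_mat N r" and inj: "\<And>x. x \<in> carrier_vec r \<Longrightarrow> F *\<^sub>v x = 0\<^sub>v N \<Longrightarrow> x = 0\<^sub>v r"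
  shows "vec_space.rank N F = (r :: nat)"
proof -
  interpret V: vec_space "TYPE(real)" N .
  have d: "distinct (cols F)"
  proof -
    have "col F i \<noteq> col F j" if ij: "i < r" "j < r" "i \<noteq> j" for i j
    proof
      assume eq: "col F i = col F j"
      have "F *\<^sub>v (unit_vec r i - unit_vec r j) = F *\<^sub>v unit_vec r i - F *\<^sub>v unit_vec r j"
        by (rule mult_minus_distrib_mat_vec[OF F]) auto
      also have "\<dots> = col F i - col F j" using F ij by (simp add: mat_unit_vec_col)
      also have "\<dots> = 0\<^sub>v N" using eq F ij by auto
      finally have "unit_vec r i - unit_vec r j = (0\<^sub>v r :: real vec)" by (intro inj) auto
      then have "(unit_vec r i - unit_vec r j) $ i = (0\<^sub>v r :: real vec) $ i" by simp
      then show False using ij by simp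
    qed
    then show ?thesis using F by (auto simp: distinct_conv_nth)
  qed
  moreover have "V.lin_indpt (set (cols F))"
  proof
    assume "V.lin_dep (set (cols F))"
    then obtain v where "v \<in> carrier_vec r" "v \<noteq> 0\<^sub>v r" "F *\<^sub>v v = 0\<^sub>v N"
      using V.lin_depE[OF F _ d] by metis
    then show False using inj by blast
  qed
  ultimately show ?thesis by (rule V.lin_indpt_full_rank[OF F])
qed

text \<open>G is the injective matrix \<open>G * S\<close> after the surjection T, so its column
  space is spanned by the r independent columns of \<open>G * S\<close>.\<close>

lemma rank_splitting:
  fixes G :: "real mat"
  assumes G: "G \<in> carrier_mat N n" and TS: "splitting r n T S"
    and ker: "\<And>x. x \<in> carrier_vec n \<Longrightarrow> T *\<^sub>v x = 0\<^sub>v r \<longleftrightarrow> G *\<^sub>v x = 0\<^sub>v N"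
  shows "vec_space.rank N G = r"
    and "\<And>x. x \<in> carrier_vec n \<Longrightarrow> G *\<^sub>v x = (G * S) *\<^sub>v (T *\<^sub>v x)"
    and "\<And>x. x \<in> carrier_vec r \<Longrightarrow> (G * S) *\<^sub>v x = 0\<^sub>v N \<Longrightarrow> x = 0\<^sub>v r"
proof -
  note D = splittingD[OF TS]
  show fac: "G *\<^sub>v x = (G * S) *\<^sub>v (T *\<^sub>v x)" if x: "x \<in> carrier_vec n" for x
  proof -
    have Tx: "T *\<^sub>v x \<in> carrier_vec r" using D(1) x by simp
    then have STx: "S *\<^sub>v (T *\<^sub>v x) \<in> carrier_vec n" using D(2) by simp
    have "G *\<^sub>v (x - S *\<^sub>v (T *\<^sub>v x)) = 0\<^sub>v N"
      using splitting_remainder[OF TS x] ker by blast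
    then have "G *\<^sub>v x - G *\<^sub>v (S *\<^sub>v (T *\<^sub>v x)) = 0\<^sub>v N"
      using mult_minus_distrib_mat_vec[OF G x STx] by simp
    then have "G *\<^sub>v x = G *\<^sub>v (S *\<^sub>v (T *\<^sub>v x))"
      by (rule vec_diff_eq_0D) (use G x STx in auto)
    then show ?thesis using assoc_mult_mat_vec[OF G D(2) Tx] by simp
  qed
  have GS: "G * S \<in> carrier_mat N r" using G D by simp
  show inj: "x = 0\<^sub>v r" if x: "x \<in> carrier_vec r" and 0: "(G * S) *\<^sub>v x = 0\<^sub>v N" for x
  proof -
    have Sx: "S *\<^sub>v x \<in> carrier_vec n" using D(2) x by simp
    have "G *\<^sub>v (S *\<^sub>v x) = 0\<^sub>v N" using 0 assoc_mult_mat_vec[OF G D(2) x] by simp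
    then have "T *\<^sub>v (S *\<^sub>v x) = 0\<^sub>v r" using ker[OF Sx] by simp
    then show ?thesis using D(4)[OF x] by simp
  qed
  have "vec_space.rank N G = vec_space.rank N (G * S)"
  proof (rule rank_eq_of_col_space[OF G GS])
    show "\<exists>y\<in>carrier_vec r. G *\<^sub>v x = (G * S) *\<^sub>v y" if "x \<in> carrier_vec n" for x
      using fac[OF that] D(1) that by (intro bexI[of _ "T *\<^sub>v x"]) auto
    show "\<exists>x\<in>carrier_vec n. (G * S) *\<^sub>v y = G *\<^sub>v x" if "y \<in> carrier_vec r" for y
      using assoc_mult_mat_vec[OF G D(2) that] D(2) that by (intro bexI[of _ "S *\<^sub>v y"]) auto
  qed
  then show "vec_space.rank N G = r" using rank_injective[OF GS inj] by simp
qed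

lemma kernel_splitting:
  fixes G :: "real mat"
  assumes G: "G \<in> carrier_mat N n"
  obtains r T S where "splitting r n T S" "\<And>x. x \<in> carrier_vec n \<Longrightarrow> T *\<^sub>v x = 0\<^sub>v r \<longleftrightarrow> G *\<^sub>v x = 0\<^sub>v N"
proof -
  let ?U = "{x \<in> carrier_vec n. G *\<^sub>v x = 0\<^sub>v N}"
  have "0\<^sub>v n \<in> ?U" using G by (auto intro!: eq_vecI)
  moreover have "x + \<kappa> \<cdot>\<^sub>v y \<in> ?U" if "x \<in> ?U" "y \<in> ?U" for x y \<kappa>
    using that by (auto simp: mult_add_distrib_mat_vec[OF G] mult_mat_vec[OF G])
  ultimately obtain r T S where "splitting r n T S" "\<And>x. x \<in> carrier_vec n \<Longrightarrow> T *\<^sub>v x = 0\<^sub>v r \<longleftrightarrow> x \<in> ?U"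
    using subspace_splitting[of ?U n] by (metis (lifting) Collect_subset mem_Collect_eq subsetI)
  then show thesis using that by blast
qed

text \<open>Equal ranks mean that T and T' are quotient coordinates of the same dimension. The
  inclusion of kernels makes T factor through T' by the square matrix \<open>T * S'\<close>, which
  has the right inverse \<open>T' * S\<close>; it is therefore invertible and the kernels
  agree.\<close>

lemma rank_eq_kernel_eq:
  fixes G H :: "real mat"
  assumes G: "G \<in> carrier_mat N n" and H: "H \<in> carrier_mat M n"
    and sub: "\<And>x. x \<in> carrier_vec n \<Longrightarrow> H *\<^sub>v x = 0\<^sub>v M \<Longrightarrow> G *\<^sub>v x = 0\<^sub>v N"
    and rank: "vec_space.rank M H = vec_space.rank N G"
    and x: "x \<in> carrier_vec n" and Gx: "G *\<^sub>v x = 0\<^sub>v N"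
  shows "H *\<^sub>v x = 0\<^sub>v M"
proof -
  obtain r T S where TS: "splitting r n T S" and T: "\<And>x. x \<in> carrier_vec n \<Longrightarrow> T *\<^sub>v x = 0\<^sub>v r \<longleftrightarrow> G *\<^sub>v x = 0\<^sub>v N"
    using kernel_splitting[OF G] by blast
  obtain r' T' S' where TS': "splitting r' n T' S'" and T': "\<And>x. x \<in> carrier_vec n \<Longrightarrow> T' *\<^sub>v x = 0\<^sub>v r' \<longleftrightarrow> H *\<^sub>v x = 0\<^sub>v M"
    using kernel_splitting[OF H] by blast
  have r: "r' = r" using rank rank_splitting(1)[OF G TS T] rank_splitting(1)[OF H TS' T'] by simp
  note D = splittingD[OF TS] and D' = splittingD[OF TS'[unfolded r]]
  have fac: "T *\<^sub>v z = (T * S') *\<^sub>v (T' *\<^sub>v z)" if z: "z \<in> carrier_vec n" for z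
  proof -
    have T'z: "T' *\<^sub>v z \<in> carrier_vec r" using D'(1) z by simp
    then have c: "S' *\<^sub>v (T' *\<^sub>v z) \<in> carrier_vec n" using D'(2) by simp
    have "T *\<^sub>v (z - S' *\<^sub>v (T' *\<^sub>v z)) = 0\<^sub>v r"
      using splitting_remainder[OF TS' z] T T' sub by metis
    then have "T *\<^sub>v z - T *\<^sub>v (S' *\<^sub>v (T' *\<^sub>v z)) = 0\<^sub>v r"
      using mult_minus_distrib_mat_vec[OF D(1) z c] by simp
    then have "T *\<^sub>v z = T *\<^sub>v (S' *\<^sub>v (T' *\<^sub>v z))"
      by (rule vec_diff_eq_0D) (use D(1) z c in auto)
    then show ?thesis using assoc_mult_mat_vec[OF D(1) D'(2) T'z] by simp
  qed
  have "(T * S') * (T' * S) = 1\<^sub>m r"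
  proof (rule eq_matI)
    fix i j assume ij: "i < dim_row (1\<^sub>m r)" "j < dim_col (1\<^sub>m r)"
    have e: "unit_vec r j \<in> carrier_vec r" by simp
    have "((T * S') * (T' * S)) *\<^sub>v unit_vec r j = (T * S') *\<^sub>v (T' *\<^sub>v (S *\<^sub>v unit_vec r j))"
      using assoc_mult_mat_vec[of "T * S'" r r "T' * S" r "unit_vec r j"] assoc_mult_mat_vec[OF D'(1) D(2) e] D D' by simp
    also have "\<dots> = unit_vec r j" using fac[of "S *\<^sub>v unit_vec r j"] D(2,4) by simp
    finally have "((T * S') * (T' * S)) *\<^sub>v unit_vec r j = unit_vec r j" .
    then have "col ((T * S') * (T' * S)) j = unit_vec r j"
      using mat_unit_vec_col[OF mult_carrier_mat[OF mult_carrier_mat[OF D(1) D'(2)] mult_carrier_mat[OF D'(1) D(2)]], of j] ij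
      by simp
    then have "col ((T * S') * (T' * S)) j $ i = unit_vec r j $ i" by simp
    then show "((T * S') * (T' * S)) $$ (i, j) = 1\<^sub>m r $$ (i, j)"
      using ij D(1) D'(1) D(2) D'(2) by simp
  qed (use D D' in auto)
  then have inv: "(T' * S) * (T * S') = 1\<^sub>m r"
    by (rule mat_mult_left_right_inverse[rotated 2]) (use D D' in auto)
  have T'x: "T' *\<^sub>v x \<in> carrier_vec r" using D'(1) x by simp
  have "(T * S') *\<^sub>v (T' *\<^sub>v x) = 0\<^sub>v r" using fac[OF x] T[OF x] Gx by simp
  then have "(T' * S) *\<^sub>v ((T * S') *\<^sub>v (T' *\<^sub>v x)) = 0\<^sub>v r"
    using mult_mat_zero_vec[OF mult_carrier_mat[OF D'(1) D(2)]] by simp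
  then have "T' *\<^sub>v x = 0\<^sub>v r"
    using assoc_mult_mat_vec[of "T' * S" r r "T * S'" r "T' *\<^sub>v x"] inv D D' T'x by simp
  then show ?thesis using T'[OF x] r by simp
qed

text \<open>On the complement of the kernel given by S the quadratic form is definite, so S^T G S is
  invertible and H = S (S^T G S)^-1 S^T inverts G on the orthogonal complement of its kernel. One
  constant matrix serves all z, which later keeps the solution g square integrable.\<close>

lemma psd_right_inverse:
  fixes G :: "real mat"
  assumes G: "G \<in> carrier_mat N N" and sym: "transpose_mat G = G"
    and psd: "\<And>x. x \<in> carrier_vec N \<Longrightarrow> x \<bullet> (G *\<^sub>v x) = 0 \<Longrightarrow> G *\<^sub>v x = 0\<^sub>v N"
  obtains H :: "real mat" where "H \<in> carrier_mat N N"
    "\<And>z. z \<in> carrier_vec N \<Longrightarrow> (\<And>v. v \<in> carrier_vec N \<Longrightarrow> G *\<^sub>v v = 0\<^sub>v N \<Longrightarrow> z \<bullet> v = 0) \<Longrightarrow> G *\<^sub>v (H *\<^sub>v z) = z"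
proof -
  obtain r T S where TS: "splitting r N T S" and T: "\<And>x. x \<in> carrier_vec N \<Longrightarrow> T *\<^sub>v x = 0\<^sub>v r \<longleftrightarrow> G *\<^sub>v x = 0\<^sub>v N"
    using kernel_splitting[OF G] by blast
  note D = splittingD[OF TS]
  let ?Tt = "transpose_mat T" and ?St = "transpose_mat S"
  have Dt: "?Tt \<in> carrier_mat N r" "?St \<in> carrier_mat r N" using D by auto
  have fac: "G *\<^sub>v x = (G * S) *\<^sub>v (T *\<^sub>v x)" if "x \<in> carrier_vec N" for x by (rule rank_splitting(2)[OF G TS T that])
  define Q where "Q = ?St * (G * S)"
  have Qc: "Q \<in> carrier_mat r r" using D G by (simp add: Q_def)
  have Qv: "Q *\<^sub>v x = ?St *\<^sub>v (G *\<^sub>v (S *\<^sub>v x))" if "x \<in> carrier_vec r" for x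
    unfolding Q_def using assoc_mult_mat_vec[OF Dt(2), of "G * S" r x] assoc_mult_mat_vec[OF G D(2) that] D G that by simp
  have "x = 0\<^sub>v r" if x: "x \<in> carrier_vec r" and 0: "Q *\<^sub>v x = 0\<^sub>v r" for x
  proof -
    have Sx: "S *\<^sub>v x \<in> carrier_vec N" using D x by simp
    then have GSx: "G *\<^sub>v (S *\<^sub>v x) \<in> carrier_vec N" using G by simp
    have "0 = x \<bullet> (?St *\<^sub>v (G *\<^sub>v (S *\<^sub>v x)))" using 0 Qv[OF x] x by simp
    also have "\<dots> = (S *\<^sub>v x) \<bullet> (G *\<^sub>v (S *\<^sub>v x))"
      using scalar_prod_transpose[OF Dt(2) x GSx] by simp
    finally have "G *\<^sub>v (S *\<^sub>v x) = 0\<^sub>v N" using psd[OF Sx] by simp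
    then have "T *\<^sub>v (S *\<^sub>v x) = 0\<^sub>v r" using T[OF Sx] by simp
    then show ?thesis using D(4)[OF x] by simp
  qed
  then obtain Qi where Qi: "Qi \<in> carrier_mat r r" "Q * Qi = 1\<^sub>m r" using square_injective_inverse[OF Qc] by blast
  define H where "H = S * (Qi * ?St)"
  have H: "H \<in> carrier_mat N N" using D Qi Dt by (simp add: H_def)
  have "G *\<^sub>v (H *\<^sub>v z) = z"
    if z: "z \<in> carrier_vec N" and perp: "\<And>v. v \<in> carrier_vec N \<Longrightarrow> G *\<^sub>v v = 0\<^sub>v N \<Longrightarrow> z \<bullet> v = 0" for z
  proof -
    define s where "s = ?St *\<^sub>v z"
    define w where "w = Qi *\<^sub>v s"
    have s: "s \<in> carrier_vec r" using Dt z by (simp add: s_def)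
    then have w: "w \<in> carrier_vec r" using Qi by (simp add: w_def)
    have Sw: "S *\<^sub>v w \<in> carrier_vec N" using D w by simp
    have Hz: "H *\<^sub>v z = S *\<^sub>v w"
      unfolding H_def w_def s_def
      using assoc_mult_mat_vec[OF D(2), of "Qi * ?St" N z] assoc_mult_mat_vec[OF Qi(1) Dt(2) z] Qi Dt z by simp
    have Qw: "Q *\<^sub>v w = s" using assoc_mult_mat_vec[OF Qc Qi(1) s] Qi s by (simp add: w_def)
    have key: "z \<bullet> v = s \<bullet> (T *\<^sub>v v)" if v: "v \<in> carrier_vec N" for v
    proof -
      have Tv: "T *\<^sub>v v \<in> carrier_vec r" using D v by simp
      then have STv: "S *\<^sub>v (T *\<^sub>v v) \<in> carrier_vec N" using D by simp
      have "z \<bullet> (v - S *\<^sub>v (T *\<^sub>v v)) = 0" using splitting_remainder[OF TS v] T perp by metis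
      then have "z \<bullet> v = z \<bullet> (S *\<^sub>v (T *\<^sub>v v))" using scalar_prod_minus_distrib[OF z v STv] by simp
      then show ?thesis using scalar_prod_transpose[OF D(2) z Tv] by (simp add: s_def)
    qed
    show ?thesis
    proof (rule vec_eq_of_scalar_prod)
      fix v :: "real vec" assume v: "v \<in> carrier_vec N"
      have Tv: "T *\<^sub>v v \<in> carrier_vec r" using D v by simp
      have Gv: "G *\<^sub>v v \<in> carrier_vec N" using G v by simp
      have STv: "S *\<^sub>v (T *\<^sub>v v) \<in> carrier_vec N" using D Tv by simp
      have "(G *\<^sub>v (H *\<^sub>v z)) \<bullet> v = (S *\<^sub>v w) \<bullet> (G *\<^sub>v v)"
        unfolding Hz using scalar_prod_transpose[OF G Sw v] sym by simp
      also have "G *\<^sub>v v = G *\<^sub>v (S *\<^sub>v (T *\<^sub>v v))" using fac[OF v] assoc_mult_mat_vec[OF G D(2) Tv] by simp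
      also have "(S *\<^sub>v w) \<bullet> \<dots> = (G *\<^sub>v (S *\<^sub>v w)) \<bullet> (S *\<^sub>v (T *\<^sub>v v))"
        using scalar_prod_transpose[OF G Sw STv] sym by simp
      also have "\<dots> = (?St *\<^sub>v (G *\<^sub>v (S *\<^sub>v w))) \<bullet> (T *\<^sub>v v)"
        by (rule scalar_prod_transpose[OF D(2) _ Tv]) (use G Sw in simp)
      also have "\<dots> = z \<bullet> v" using Qv[OF w] Qw key[OF v] by simp
      finally show "(G *\<^sub>v (H *\<^sub>v z)) \<bullet> v = z \<bullet> v" .
    qed (use G H z in auto)
  qed
  then show thesis using that H by blast
qed

section \<open>Rows modulo a state equation\<close>

text \<open>Fraction-free elimination of the last coordinate.\<close>

lemma module_dichotomy:
  fixes N :: "(nat \<Rightarrow> 'a::idom) set" and r :: "nat \<Rightarrow> 'a"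
  assumes "(\<lambda>_. 0) \<in> N"
    and "\<And>s s'. s \<in> N \<Longrightarrow> s' \<in> N \<Longrightarrow> (\<lambda>j. s j + s' j) \<in> N"
    and "\<And>s a. s \<in> N \<Longrightarrow> (\<lambda>j. a * s j) \<in> N"
  shows "(\<exists>d s. d \<noteq> 0 \<and> s \<in> N \<and> (\<forall>j<n. s j = d * r j)) \<or>
    (\<exists>q. (\<forall>s\<in>N. (\<Sum>j<n. s j * q j) = 0) \<and> (\<Sum>j<n. r j * q j) \<noteq> 0)"
  using assms
proof (induction n arbitrary: N r)
  case 0
  then show ?case by (intro disjI1 exI[of _ 1] exI[of _ "\<lambda>_. 0"]) auto
next
  case (Suc n)
  note N0 = Suc.prems(1) and Nadd = Suc.prems(2) and Nmult = Suc.prems(3)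
  show ?case
  proof (cases "\<forall>s\<in>N. s n = 0")
    case True
    show ?thesis
    proof (cases "r n = 0")
      case False
      then show ?thesis using True
        by (intro disjI2 exI[of _ "\<lambda>j. if j = n then 1 else 0"]) auto
    next
      case rn: True
      from Suc.IH[of N r, OF N0 Nadd Nmult] show ?thesis
      proof
        assume "\<exists>d s. d \<noteq> 0 \<and> s \<in> N \<and> (\<forall>j<n. s j = d * r j)"
        then obtain d s where ds: "d \<noteq> 0" "s \<in> N" "\<forall>j<n. s j = d * r j" by blast
        then have "\<forall>j<Suc n. s j = d * r j" using True rn by (auto simp: less_Suc_eq)
        then show ?thesis using ds by blast
      next
        assume "\<exists>q. (\<forall>s\<in>N. (\<Sum>j<n. s j * q j) = 0) \<and> (\<Sum>j<n. r j * q j) \<noteq> 0"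
        then obtain q where "\<forall>s\<in>N. (\<Sum>j<n. s j * q j) = 0" "(\<Sum>j<n. r j * q j) \<noteq> 0" by blast
        then show ?thesis using True rn by (intro disjI2 exI[of _ q]) auto
      qed
    qed
  next
    case False
    then obtain a where a: "a \<in> N" "a n \<noteq> 0" by blast
    define N' where "N' = {s \<in> N. s n = 0}"
    define red where "red s j = a n * s j + (- s n) * a j" for s j
    have red_n: "red s n = 0" for s by (simp add: red_def)
    have red_N: "red s \<in> N'" if "s \<in> N" for s
      using Nadd[OF Nmult[OF that, of "a n"] Nmult[OF a(1), of "- s n"]] red_n[of s]
      by (simp add: N'_def red_def[abs_def])
    have "(\<exists>d s. d \<noteq> 0 \<and> s \<in> N' \<and> (\<forall>j<n. s j = d * red r j)) \<or>
      (\<exists>q. (\<forall>s\<in>N'. (\<Sum>j<n. s j * q j) = 0) \<and> (\<Sum>j<n. red r j * q j) \<noteq> 0)"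
      by (rule Suc.IH) (use N0 Nadd Nmult in \<open>auto simp: N'_def\<close>)
    then show ?thesis
    proof
      assume "\<exists>d s. d \<noteq> 0 \<and> s \<in> N' \<and> (\<forall>j<n. s j = d * red r j)"
      then obtain d s where ds: "d \<noteq> 0" "s \<in> N'" "\<forall>j<n. s j = d * red r j" by blast
      have "(\<lambda>j. s j + d * r n * a j) \<in> N"
        using Nadd[OF _ Nmult[OF a(1), of "d * r n"]] ds(2) by (simp add: N'_def)
      moreover have "s j + d * r n * a j = d * a n * r j" if "j < Suc n" for j
        using that ds by (cases "j = n") (auto simp: N'_def red_def algebra_simps)
      moreover have "d * a n \<noteq> 0" using ds(1) a(2) by simp
      ultimately show ?thesis by blast
    next
      assume "\<exists>q. (\<forall>s\<in>N'. (\<Sum>j<n. s j * q j) = 0) \<and> (\<Sum>j<n. red r j * q j) \<noteq> 0"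
      then obtain q where q: "\<forall>s\<in>N'. (\<Sum>j<n. s j * q j) = 0" "(\<Sum>j<n. red r j * q j) \<noteq> 0" by blast
      \<comment> \<open>The last entry is chosen so that the product of s with q' is the product of
        its reduction with q; hence N is orthogonal to q' while r is not.\<close>
      define q' where "q' j = (if j < n then a n * q j else - (\<Sum>j<n. a j * q j))" for j
      have "(\<Sum>j<Suc n. s j * q' j) = (\<Sum>j<n. red s j * q j)" for s
        by (simp add: q'_def red_def algebra_simps sum.distrib sum_subtractf sum_distrib_left)
      then have "(\<forall>s\<in>N. (\<Sum>j<Suc n. s j * q' j) = 0) \<and> (\<Sum>j<Suc n. r j * q' j) \<noteq> 0"
        using q red_N by auto
      then show ?thesis by blast
    qed
  qed
qed

text \<open>Over a field the factor d of the dichotomy can be divided out, so a vector orthogonal to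
  everything that is orthogonal to all \<open>f k\<close> must be a combination of them.\<close>

lemma row_space_duality:
  fixes f :: "'k \<Rightarrow> nat \<Rightarrow> 'a::field"
  assumes fin: "finite K"
    and perp: "\<And>q. (\<And>k. k \<in> K \<Longrightarrow> (\<Sum>j<n. f k j * q j) = 0) \<Longrightarrow> (\<Sum>j<n. r j * q j) = 0"
  obtains \<nu> where "\<And>j. j < n \<Longrightarrow> r j = (\<Sum>k\<in>K. \<nu> k * f k j)"
proof -
  let ?N = "range (\<lambda>\<nu> j. \<Sum>k\<in>K. \<nu> k * f k j)"
  have "(\<exists>d s. d \<noteq> 0 \<and> s \<in> ?N \<and> (\<forall>j<n. s j = d * r j)) \<or>
    (\<exists>q. (\<forall>s\<in>?N. (\<Sum>j<n. s j * q j) = 0) \<and> (\<Sum>j<n. r j * q j) \<noteq> 0)"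
  proof (rule module_dichotomy)
    show "(\<lambda>_. 0) \<in> ?N" by (rule range_eqI[of _ _ "\<lambda>_. 0"]) simp
    fix s a assume "s \<in> ?N"
    then obtain \<nu> where s: "s = (\<lambda>j. \<Sum>k\<in>K. \<nu> k * f k j)" by blast
    show "(\<lambda>j. a * s j) \<in> ?N"
      by (rule range_eqI[of _ _ "\<lambda>k. a * \<nu> k"]) (simp add: s sum_distrib_left mult.assoc)
    fix s' assume "s' \<in> ?N"
    then obtain \<nu>' where s': "s' = (\<lambda>j. \<Sum>k\<in>K. \<nu>' k * f k j)" by blast
    show "(\<lambda>j. s j + s' j) \<in> ?N"
      by (rule range_eqI[of _ _ "\<lambda>k. \<nu> k + \<nu>' k"]) (simp add: s s' distrib_right sum.distrib)
  qed
  then show thesis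
  proof
    assume "\<exists>d s. d \<noteq> 0 \<and> s \<in> ?N \<and> (\<forall>j<n. s j = d * r j)"
    then obtain d \<nu> where d: "d \<noteq> 0" "\<forall>j<n. (\<Sum>k\<in>K. \<nu> k * f k j) = d * r j" by blast
    have "r j = (\<Sum>k\<in>K. (inverse d * \<nu> k) * f k j)" if "j < n" for j
    proof -
      have "(\<Sum>k\<in>K. (inverse d * \<nu> k) * f k j) = inverse d * (\<Sum>k\<in>K. \<nu> k * f k j)"
        by (simp add: sum_distrib_left mult.assoc)
      then show ?thesis using d that by simp
    qed
    then show thesis by (rule that)
  next
    assume "\<exists>q. (\<forall>s\<in>?N. (\<Sum>j<n. s j * q j) = 0) \<and> (\<Sum>j<n. r j * q j) \<noteq> 0"
    then obtain q where q: "\<forall>s\<in>?N. (\<Sum>j<n. s j * q j) = 0" "(\<Sum>j<n. r j * q j) \<noteq> 0" by blast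
    have "(\<Sum>j<n. f k j * q j) = 0" if "k \<in> K" for k
    proof -
      have "(\<lambda>j. \<Sum>k'\<in>K. (if k' = k then 1 else 0) * f k' j) \<in> ?N"
        by (rule range_eqI[of _ _ "\<lambda>k'. if k' = k then 1 else 0"]) (rule refl)
      from bspec[OF q(1) this] have "(\<Sum>j<n. (\<Sum>k'\<in>K. (if k' = k then 1 else 0) * f k' j) * q j) = 0" .
      moreover have "(\<Sum>k'\<in>K. (if k' = k then 1 else 0) * f k' j) = f k j" for j
        using fin that by (subst sum.remove[of _ k]) (auto intro: sum.neutral)
      ultimately show ?thesis by simp
    qed
    from perp[OF this] q(2) show thesis by simp
  qed
qed

text \<open>
  For the state equation \<open>x' = A x + B u\<close> and a polynomial \<open>P\<close> one has
  \<open>P(d/dt) (c\<^sup>T x) = (state_part P c)\<^sup>T x + (input_part P c)(d/dt) u\<close>: the operator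
  \<open>shift\<close> below is \<open>c \<mapsto> A\<^sup>T c\<close>, and \<open>inp\<close> is \<open>c \<mapsto> B\<^sup>T c\<close>.
\<close>

lemma smult_sum_right: "Polynomial.smult c (\<Sum>i\<in>I. f i) = (\<Sum>i\<in>I. Polynomial.smult c (f i))"
  by (induction I rule: infinite_finite_induct) (auto simp: smult_add_right)

locale state_system =
  fixes n :: nat and a b :: "nat \<Rightarrow> nat \<Rightarrow> real"
begin

definition shift :: "(nat \<Rightarrow> real) \<Rightarrow> nat \<Rightarrow> real" where
  "shift c j = (\<Sum>i<n. c i * a i j)"

definition inp :: "(nat \<Rightarrow> real) \<Rightarrow> nat \<Rightarrow> real" where
  "inp c j = (\<Sum>i<n. c i * b i j)"

definition state_part :: "real poly \<Rightarrow> (nat \<Rightarrow> real) \<Rightarrow> nat \<Rightarrow> real" where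
  "state_part P c i = (\<Sum>k\<le>degree P. coeff P k * (shift ^^ k) c i)"

text \<open>The formula is x^(k) = A^k x + (sum over l < k of A^(k-1-l) B u^(l)), read against
  c.\<close>

definition input_part :: "real poly \<Rightarrow> (nat \<Rightarrow> real) \<Rightarrow> nat \<Rightarrow> real poly" where
  "input_part P c j = (\<Sum>k\<le>degree P. Polynomial.smult (coeff P k) (\<Sum>l<k. monom (inp ((shift ^^ (k - 1 - l)) c) j) l))"

lemma state_part_eq_sum:
  "degree P \<le> N \<Longrightarrow> state_part P c i = (\<Sum>k\<le>N. coeff P k * (shift ^^ k) c i)"
  unfolding state_part_def by (rule sum.mono_neutral_left) (auto simp: coeff_eq_0)

lemma input_part_eq_sum:
  "degree P \<le> N \<Longrightarrow> input_part P c j =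
    (\<Sum>k\<le>N. Polynomial.smult (coeff P k) (\<Sum>l<k. monom (inp ((shift ^^ (k - 1 - l)) c) j) l))"
  unfolding input_part_def by (rule sum.mono_neutral_left) (auto simp: coeff_eq_0)

lemma state_part_0 [simp]: "state_part 0 c i = 0"
  by (simp add: state_part_def)

lemma input_part_0 [simp]: "input_part 0 c j = 0"
  by (simp add: input_part_def)

lemma state_part_pCons: "state_part (pCons \<alpha> Q) c i = \<alpha> * c i + state_part Q (shift c) i"
proof -
  have "state_part (pCons \<alpha> Q) c i = (\<Sum>k\<le>Suc (degree Q). coeff (pCons \<alpha> Q) k * (shift ^^ k) c i)"
    by (rule state_part_eq_sum) (rule degree_pCons_le)
  also have "\<dots> = \<alpha> * c i + state_part Q (shift c) i"
    unfolding state_part_def by (subst sum.atMost_Suc_shift) (simp add: funpow_Suc_right del: funpow.simps(2))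
  finally show ?thesis .
qed

lemma input_part_pCons: "input_part (pCons \<alpha> Q) c j = Polynomial.smult (inp c j) Q + input_part Q (shift c) j"
proof -
  have step: "(\<Sum>l<Suc k. monom (inp ((shift ^^ (Suc k - 1 - l)) c) j) l) =
      (\<Sum>l<k. monom (inp ((shift ^^ (k - 1 - l)) (shift c)) j) l) + monom (inp c j) k" for k
  proof -
    have "(shift ^^ (k - l)) c = (shift ^^ (k - 1 - l)) (shift c)" if "l < k" for l
    proof -
      have "k - l = Suc (k - 1 - l)" using that by simp
      then show ?thesis by (simp only: funpow_Suc_right o_apply)
    qed
    then show ?thesis by simp
  qed
  have "input_part (pCons \<alpha> Q) c j = (\<Sum>k\<le>Suc (degree Q). Polynomial.smult (coeff (pCons \<alpha> Q) k)
      (\<Sum>l<k. monom (inp ((shift ^^ (k - 1 - l)) c) j) l))"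
    by (rule input_part_eq_sum) (rule degree_pCons_le)
  also have "\<dots> = (\<Sum>k\<le>degree Q. Polynomial.smult (coeff Q k)
      ((\<Sum>l<k. monom (inp ((shift ^^ (k - 1 - l)) (shift c)) j) l) + monom (inp c j) k))"
    by (subst sum.atMost_Suc_shift) (simp only: step coeff_pCons_0 coeff_pCons_Suc, simp)
  also have "\<dots> = input_part Q (shift c) j + (\<Sum>k\<le>degree Q. Polynomial.smult (coeff Q k) (monom (inp c j) k))"
    by (simp add: smult_add_right sum.distrib input_part_def)
  also have "(\<Sum>k\<le>degree Q. Polynomial.smult (coeff Q k) (monom (inp c j) k)) = Polynomial.smult (inp c j) Q"
  proof -
    have "(\<Sum>k\<le>degree Q. Polynomial.smult (coeff Q k) (monom (inp c j) k)) =
        Polynomial.smult (inp c j) (\<Sum>k\<le>degree Q. monom (coeff Q k) k)"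
      by (simp add: Polynomial.smult_monom smult_sum_right mult.commute)
    then show ?thesis by (simp add: poly_as_sum_of_monoms)
  qed
  finally show ?thesis by simp
qed

lemma state_part_add: "state_part (P + Q) c i = state_part P c i + state_part Q c i"
proof -
  let ?n = "max (degree P) (degree Q)"
  show ?thesis
    using state_part_eq_sum[of P ?n c i] state_part_eq_sum[of Q ?n c i] state_part_eq_sum[of "P + Q" ?n c i]
    by (simp add: degree_add_le_max distrib_right sum.distrib)
qed

lemma state_part_smult: "state_part (Polynomial.smult \<alpha> P) c i = \<alpha> * state_part P c i"
  using state_part_eq_sum[of "Polynomial.smult \<alpha> P" "degree P" c i]
  by (simp add: state_part_def sum_distrib_left degree_smult_le mult.assoc)

lemma input_part_add: "input_part (P + Q) c j = input_part P c j + input_part Q c j"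
proof -
  let ?n = "max (degree P) (degree Q)"
  show ?thesis
    using input_part_eq_sum[of P ?n c j] input_part_eq_sum[of Q ?n c j] input_part_eq_sum[of "P + Q" ?n c j]
    by (simp add: degree_add_le_max smult_add_left sum.distrib)
qed

lemma input_part_smult: "input_part (Polynomial.smult \<alpha> P) c j = Polynomial.smult \<alpha> (input_part P c j)"
  using input_part_eq_sum[of "Polynomial.smult \<alpha> P" "degree P" c j]
  by (simp add: input_part_def smult_sum_right degree_smult_le)

lemma shift_zero [simp]: "shift (\<lambda>_. 0) = (\<lambda>_. 0)"
  by (auto simp: shift_def fun_eq_iff)

lemma inp_zero [simp]: "inp (\<lambda>_. 0) = (\<lambda>_. 0)"
  by (auto simp: inp_def fun_eq_iff)

lemma shift_lin: "shift (\<lambda>i. \<alpha> * c i + d i) = (\<lambda>j. \<alpha> * shift c j + shift d j)"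
  by (auto simp: shift_def distrib_right sum.distrib sum_distrib_left mult.assoc)

lemma inp_lin: "inp (\<lambda>i. \<alpha> * c i + d i) j = \<alpha> * inp c j + inp d j"
  by (auto simp: inp_def distrib_right sum.distrib sum_distrib_left mult.assoc)

lemma state_part_lin: "state_part P (\<lambda>i. \<alpha> * c i + d i) i = \<alpha> * state_part P c i + state_part P d i"
proof (induction P arbitrary: c d)
  case (pCons a P)
  show ?case unfolding state_part_pCons shift_lin pCons.IH by (simp add: algebra_simps)
qed simp

lemma input_part_lin: "input_part P (\<lambda>i. \<alpha> * c i + d i) j = Polynomial.smult \<alpha> (input_part P c j) + input_part P d j"
  by (induction P arbitrary: c d)
    (auto simp: input_part_pCons shift_lin inp_lin smult_add_right smult_add_left)

lemma state_part_cong: "(\<And>i. i < n \<Longrightarrow> c i = d i) \<Longrightarrow> i < n \<Longrightarrow> state_part P c i = state_part P d i"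
proof -
  assume eq: "\<And>i. i < n \<Longrightarrow> c i = d i" and i: "i < n"
  have "shift c = shift d" using eq by (auto simp: shift_def)
  then show ?thesis using eq i by (cases P) (simp add: state_part_pCons)
qed

lemma input_part_cong: "(\<And>i. i < n \<Longrightarrow> c i = d i) \<Longrightarrow> input_part P c j = input_part P d j"
proof -
  assume eq: "\<And>i. i < n \<Longrightarrow> c i = d i"
  have "shift c = shift d" "inp c j = inp d j" using eq by (auto simp: shift_def inp_def)
  then show ?thesis by (cases P) (simp add: input_part_pCons)
qed

lemma state_part_mult: "state_part (\<chi> * P) c = state_part \<chi> (state_part P c)"
proof (induction P arbitrary: c)
  case 0
  have "state_part \<chi> (\<lambda>i. 0 * c i + 0) i = 0 * state_part \<chi> c i + 0" for i
    by (induction \<chi> arbitrary: c) (auto simp: state_part_pCons shift_def)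
  then show ?case by (simp add: fun_eq_iff state_part_def[of 0, abs_def])
next
  case (pCons \<alpha> Q)
  have "state_part (\<chi> * pCons \<alpha> Q) c i = \<alpha> * state_part \<chi> c i + state_part (\<chi> * Q) (shift c) i" for i
    by (simp add: mult_pCons_right state_part_add state_part_smult state_part_pCons)
  moreover have "state_part \<chi> (state_part (pCons \<alpha> Q) c) i
      = \<alpha> * state_part \<chi> c i + state_part \<chi> (state_part Q (shift c)) i" for i
    using state_part_lin[of \<chi> \<alpha> c "state_part Q (shift c)" i]
    by (simp add: state_part_pCons[abs_def])
  ultimately show ?case using pCons.IH by (simp add: fun_eq_iff)
qed

lemma input_part_zero_fun: "input_part \<chi> (\<lambda>_. 0) j = 0"
  by (induction \<chi>) (auto simp: input_part_pCons shift_def inp_def)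

text \<open>Apply \<chi>(d/dt) to the identity for P: its input operator is multiplied by \<chi>,
  and its state term, being a constant functional of x, contributes a second input operator.\<close>

lemma input_part_mult: "input_part (\<chi> * P) c j = \<chi> * input_part P c j + input_part \<chi> (state_part P c) j"
proof (induction P arbitrary: c)
  case 0
  show ?case by (simp add: input_part_zero_fun state_part_def[of 0, abs_def])
next
  case (pCons \<alpha> Q)
  have "input_part (\<chi> * pCons \<alpha> Q) c j
    = Polynomial.smult \<alpha> (input_part \<chi> c j) + (Polynomial.smult (inp c j) (\<chi> * Q) + input_part (\<chi> * Q) (shift c) j)"
    by (simp add: mult_pCons_right input_part_add input_part_smult input_part_pCons)
  moreover have "input_part \<chi> (state_part (pCons \<alpha> Q) c) j
      = Polynomial.smult \<alpha> (input_part \<chi> c j) + input_part \<chi> (state_part Q (shift c)) j"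
    using input_part_lin[of \<chi> \<alpha> c "state_part Q (shift c)" j]
    by (simp add: state_part_pCons[abs_def])
  ultimately show ?case using pCons.IH
    by (simp add: input_part_pCons algebra_simps)
qed

text \<open>A k-th derivative of the state involves u only up to order k - 1. This strict drop keeps
  rows within their degree bounds; speaking of coefficients avoids exceptions for constant and zero
  polynomials.\<close>

lemma coeff_input_part_eq_0: "degree P \<le> k \<Longrightarrow> coeff (input_part P c j) k = 0"
  unfolding input_part_def by (auto simp: coeff_sum coeff_monom intro!: sum.neutral)

text \<open>The n + 1 vectors c, A^T c, ..., (A^T)^n c lie in R^n and are therefore dependent;
  dividing by the leading coefficient makes the relation monic.\<close>

lemma monic_annihilator:
  obtains \<chi> where "\<chi> \<noteq> 0" "lead_coeff \<chi> = 1" "degree \<chi> \<le> n" "\<And>i. i < n \<Longrightarrow> state_part \<chi> c i = 0"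
proof -
  \<comment> \<open>The zero row with index n makes the matrix square and singular, so the
    dependence comes from a vanishing determinant.\<close>
  define M where "M = mat (Suc n) (Suc n) (\<lambda>(i, k). if i < n then (shift ^^ k) c i else 0)"
  have M: "M \<in> carrier_mat (Suc n) (Suc n)" by (simp add: M_def)
  have "transpose_mat M *\<^sub>v unit_vec (Suc n) n = 0\<^sub>v (Suc n)"
    by (rule eq_vecI) (auto simp: M_def)
  moreover have "unit_vec (Suc n) n \<noteq> (0\<^sub>v (Suc n) :: real vec)" by simp
  ultimately have "det (transpose_mat M) = 0"
    using det_0_iff_vec_prod_zero_field[of "transpose_mat M" "Suc n"] M
    by (metis transpose_carrier_mat unit_vec_carrier)
  then have "det M = 0" by (simp add: det_transpose[OF M])
  then obtain \<nu> where \<nu>: "\<nu> \<in> carrier_vec (Suc n)" "\<nu> \<noteq> 0\<^sub>v (Suc n)" "M *\<^sub>v \<nu> = 0\<^sub>v (Suc n)"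
    using det_0_iff_vec_prod_zero_field[OF M] by blast
  define P where "P = (\<Sum>k\<le>n. monom (\<nu> $ k) k)"
  have coeff: "coeff P k = (if k \<le> n then \<nu> $ k else 0)" for k
    by (simp add: P_def coeff_sum coeff_monom)
  obtain k where "k < Suc n" "\<nu> $ k \<noteq> 0"
    using \<nu>(1,2) by (metis carrier_vecD eq_vecI index_zero_vec)
  then have P0: "P \<noteq> 0" using coeff[of k] by auto
  have degP: "degree P \<le> n" by (rule degree_le) (simp add: coeff)
  have "state_part P c i = 0" if "i < n" for i
  proof -
    have "0 = (M *\<^sub>v \<nu>) $ i" using \<nu>(3) that by simp
    also have "\<dots> = (\<Sum>k<Suc n. (shift ^^ k) c i * \<nu> $ k)"
      using that \<nu>(1) by (simp add: M_def scalar_prod_def atLeast0LessThan del: sum.lessThan_Suc)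
    also have "\<dots> = (\<Sum>k\<le>n. coeff P k * (shift ^^ k) c i)"
      by (intro sum.cong) (auto simp: coeff)
    finally show ?thesis using state_part_eq_sum[OF degP] by simp
  qed
  moreover define \<chi> where "\<chi> = Polynomial.smult (inverse (lead_coeff P)) P"
  ultimately have "state_part \<chi> c i = 0" if "i < n" for i
    using that by (simp add: state_part_smult)
  moreover have "\<chi> \<noteq> 0" "lead_coeff \<chi> = 1" "degree \<chi> \<le> n"
    using P0 degP by (auto simp: \<chi>_def)
  ultimately show thesis using that by blast
qed

end

section \<open>Annihilators\<close>

text \<open>The weak form of r(d/dt) w = 0, with all derivatives on the test function. Rows are
  total functions, of which only the entries below q act.\<close>

definition ann :: "nat \<Rightarrow> (real \<Rightarrow> real vec) \<Rightarrow> (nat \<Rightarrow> real poly) \<Rightarrow> bool" where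
  "ann q w r \<longleftrightarrow> (\<forall>\<phi>. test \<phi> \<longrightarrow> (\<Sum>j<q. pairing (\<lambda>t. w t $ j) (dop (r j) \<phi>)) = 0)"

lemma L2_vec_comp: "w \<in> L2_vec q \<Longrightarrow> j < q \<Longrightarrow> (\<lambda>t. w t $ j) \<in> L2I"
  by (simp add: L2_vec_def L2_scalar_eq)

lemma ann_cong: "(\<And>j. j < q \<Longrightarrow> r j = r' j) \<Longrightarrow> ann q w r \<longleftrightarrow> ann q w r'"
  by (simp add: ann_def)

lemma ann_add:
  assumes w: "w \<in> L2_vec q" and r: "ann q w r" "ann q w s" shows "ann q w (\<lambda>j. r j + s j)"
  unfolding ann_def
proof (intro allI impI)
  fix \<phi> :: "real \<Rightarrow> real" assume \<phi>: "test \<phi>"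
  have "pairing (\<lambda>t. w t $ j) (dop (r j + s j) \<phi>) =
      pairing (\<lambda>t. w t $ j) (dop (r j) \<phi>) + pairing (\<lambda>t. w t $ j) (dop (s j) \<phi>)" if "j < q" for j
    unfolding dop_add[abs_def]
    by (rule pairing_add) (use L2_vec_comp[OF w that] \<phi> in \<open>auto intro: smooth_dop test_smooth\<close>)
  then show "(\<Sum>j<q. pairing (\<lambda>t. w t $ j) (dop (r j + s j) \<phi>)) = 0"
    using r \<phi> by (simp add: ann_def sum.distrib)
qed

text \<open>Multiplying a row by P amounts to testing the original row with
  \<open>dop P \<phi>\<close>, again a test function.\<close>

lemma ann_mult:
  assumes r: "ann q w r" shows "ann q w (\<lambda>j. P * r j)"
  unfolding ann_def
proof (intro allI impI)
  fix \<phi> :: "real \<Rightarrow> real" assume \<phi>: "test \<phi>"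
  have "dop (P * r j) \<phi> = dop (r j) (dop P \<phi>)" for j
    using dop_mult[OF test_smooth[OF \<phi>], of "r j" P] by (simp add: mult.commute)
  then show "(\<Sum>j<q. pairing (\<lambda>t. w t $ j) (dop (P * r j) \<phi>)) = 0"
    using r test_dop[OF \<phi>] by (simp add: ann_def)
qed

lemma ann_zero: "ann q w (\<lambda>_. 0)"
  by (simp add: ann_def)

lemma ann_sum:
  assumes w: "w \<in> L2_vec q" shows "(\<And>i. i \<in> I \<Longrightarrow> ann q w (r i)) \<Longrightarrow> ann q w (\<lambda>j. \<Sum>i\<in>I. r i j)"
  by (induction I rule: infinite_finite_induct) (auto intro: ann_zero ann_add[OF w])

lemma dop_monom: "dop (monom c k) \<phi> t = c * (neg_deriv ^^ k) \<phi> t"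
  using dop_eq_sum[OF degree_monom_le, of c k \<phi> t] by (simp add: coeff_monom if_distrib if_distribR cong: if_cong)

lemma deriv_funpow: "test \<phi> \<Longrightarrow> (-1) ^ i * (deriv ^^ i) \<phi> t = (neg_deriv ^^ i) \<phi> t"
  using funpow_neg_deriv[OF test_smooth, of \<phi> i] by (simp add: deriv_eq_vd)

text \<open>The components of a vector of test functions can be chosen independently, and one with a
  single nonzero component isolates a single equation; so the system splits into scalar
  equations.\<close>

lemma weak_kernel_iff:
  assumes R: "\<And>i. i \<le> r \<Longrightarrow> R i \<in> carrier_mat g q"
  shows "w \<in> weak_kernel q g r R \<longleftrightarrow> w \<in> L2_vec q \<and> (\<forall>a<g. ann q w (\<lambda>j. \<Sum>i\<le>r. monom (R i $$ (a, j)) i))"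
proof (cases "w \<in> L2_vec q")
  case w: True
  let ?r = "\<lambda>a j. \<Sum>i\<le>r. monom (R i $$ (a, j)) i"
  have key: "(\<Sum>i\<le>r. (-1) ^ i * (LINT t:\<I>|lebesgue. (R i *\<^sub>v w t) \<bullet> vec g (\<lambda>j. (deriv ^^ i) (\<phi> j) t)))
      = (\<Sum>a<g. \<Sum>j<q. pairing (\<lambda>t. w t $ j) (dop (?r a j) (\<phi> a)))"
    if \<phi>: "\<forall>j<g. test_function (\<phi> j)" for \<phi>
  proof -
    have t: "test (\<phi> a)" if "a < g" for a using \<phi> that by (simp add: test_function_iff)
    have sm: "smooth ((neg_deriv ^^ i) (\<phi> a))" if "a < g" for a i
      by (intro smooth_funpow_neg_deriv test_smooth t that)
    have "(-1) ^ i * (LINT t:\<I>|lebesgue. (R i *\<^sub>v w t) \<bullet> vec g (\<lambda>j. (deriv ^^ i) (\<phi> j) t))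
      = (\<Sum>a<g. \<Sum>j<q. R i $$ (a, j) * pairing (\<lambda>t. w t $ j) ((neg_deriv ^^ i) (\<phi> a)))" if i: "i \<le> r" for i
    proof -
      have "(-1) ^ i * (LINT t:\<I>|lebesgue. (R i *\<^sub>v w t) \<bullet> vec g (\<lambda>j. (deriv ^^ i) (\<phi> j) t))
        = (LINT t|MI. (-1) ^ i * ((R i *\<^sub>v w t) \<bullet> vec g (\<lambda>j. (deriv ^^ i) (\<phi> j) t)))"
        unfolding set_integral_I by simp
      also have "\<dots> = (LINT t|MI. (\<Sum>a<g. \<Sum>j<q. R i $$ (a, j) * (w t $ j * (neg_deriv ^^ i) (\<phi> a) t)))"
      proof (rule Bochner_Integration.integral_cong)
        fix t assume "t \<in> space MI"
        then have wt: "w t \<in> carrier_vec q" using w by (simp add: L2_vec_def)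
        have "(-1) ^ i * ((R i *\<^sub>v w t) \<bullet> vec g (\<lambda>j. (deriv ^^ i) (\<phi> j) t))
          = (\<Sum>a<g. (\<Sum>j<q. R i $$ (a, j) * w t $ j) * ((-1) ^ i * (deriv ^^ i) (\<phi> a) t))"
          using R[OF i] wt by (simp add: scalar_prod_def atLeast0LessThan sum_distrib_left mult_ac)
        also have "\<dots> = (\<Sum>a<g. (\<Sum>j<q. R i $$ (a, j) * w t $ j) * (neg_deriv ^^ i) (\<phi> a) t)"
          by (rule sum.cong) (auto simp: deriv_funpow t)
        also have "\<dots> = (\<Sum>a<g. \<Sum>j<q. R i $$ (a, j) * (w t $ j * (neg_deriv ^^ i) (\<phi> a) t))"
          by (simp add: sum_distrib_right mult.assoc)
        finally show "(-1) ^ i * ((R i *\<^sub>v w t) \<bullet> vec g (\<lambda>j. (deriv ^^ i) (\<phi> j) t))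
          = (\<Sum>a<g. \<Sum>j<q. R i $$ (a, j) * (w t $ j * (neg_deriv ^^ i) (\<phi> a) t))" .
      qed simp
      also have "\<dots> = (\<Sum>a<g. \<Sum>j<q. LINT t|MI. R i $$ (a, j) * (w t $ j * (neg_deriv ^^ i) (\<phi> a) t))"
      proof -
        have int: "integrable MI (\<lambda>t. R i $$ (a, j) * (w t $ j * (neg_deriv ^^ i) (\<phi> a) t))"
          if "a < g" "j < q" for a j
          using L2I_mult_smooth_integrable[OF L2_vec_comp[OF w \<open>j < q\<close>] sm[OF \<open>a < g\<close>]] by simp
        show ?thesis
          by (subst Bochner_Integration.integral_sum)
            (auto intro!: Bochner_Integration.integrable_sum Bochner_Integration.integral_sum sum.cong
              simp del: integral_mult_right_zero intro: int)
      qed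
      finally show ?thesis by (simp add: pairing_def)
    qed
    then have "(\<Sum>i\<le>r. (-1) ^ i * (LINT t:\<I>|lebesgue. (R i *\<^sub>v w t) \<bullet> vec g (\<lambda>j. (deriv ^^ i) (\<phi> j) t)))
      = (\<Sum>i\<le>r. \<Sum>a<g. \<Sum>j<q. R i $$ (a, j) * pairing (\<lambda>t. w t $ j) ((neg_deriv ^^ i) (\<phi> a)))"
      by (intro sum.cong) auto
    also have "\<dots> = (\<Sum>a<g. \<Sum>i\<le>r. \<Sum>j<q. R i $$ (a, j) * pairing (\<lambda>t. w t $ j) ((neg_deriv ^^ i) (\<phi> a)))"
      by (rule sum.swap)
    also have "\<dots> = (\<Sum>a<g. \<Sum>j<q. \<Sum>i\<le>r. R i $$ (a, j) * pairing (\<lambda>t. w t $ j) ((neg_deriv ^^ i) (\<phi> a)))"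
      by (intro sum.cong sum.swap refl)
    also have "\<dots> = (\<Sum>a<g. \<Sum>j<q. pairing (\<lambda>t. w t $ j) (dop (?r a j) (\<phi> a)))"
    proof (intro sum.cong refl)
      fix a j assume aj: "a \<in> {..<g}" "j \<in> {..<q}"
      have "pairing (\<lambda>t. w t $ j) (\<lambda>t. \<Sum>i\<le>r. R i $$ (a, j) * (neg_deriv ^^ i) (\<phi> a) t) =
          (\<Sum>i\<le>r. pairing (\<lambda>t. w t $ j) (\<lambda>t. R i $$ (a, j) * (neg_deriv ^^ i) (\<phi> a) t))"
        using pairing_sum[OF L2_vec_comp[OF w], of j "{..r}" "\<lambda>i t. R i $$ (a, j) * (neg_deriv ^^ i) (\<phi> a) t"] sm aj
        by (auto intro: smooth_cmult)
      then show "(\<Sum>i\<le>r. R i $$ (a, j) * pairing (\<lambda>t. w t $ j) ((neg_deriv ^^ i) (\<phi> a))) =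
          pairing (\<lambda>t. w t $ j) (dop (?r a j) (\<phi> a))"
        by (simp add: pairing_cmult dop_sum[abs_def] dop_monom)
    qed
    finally show ?thesis .
  qed
  show ?thesis
  proof
    assume L: "w \<in> weak_kernel q g r R"
    have "ann q w (?r a)" if a: "a < g" for a
      unfolding ann_def
    proof (intro allI impI)
      fix \<phi> :: "real \<Rightarrow> real" assume \<phi>: "test \<phi>"
      define \<Phi> where "\<Phi> j = (if j = a then \<phi> else (\<lambda>_. 0))" for j
      have \<Phi>: "\<forall>j<g. test_function (\<Phi> j)" using \<phi> by (auto simp: \<Phi>_def test_function_iff)
      have "0 = (\<Sum>a'<g. \<Sum>j<q. pairing (\<lambda>t. w t $ j) (dop (?r a' j) (\<Phi> a')))"
        using L \<Phi> unfolding key[OF \<Phi>, symmetric] by (auto simp: weak_kernel_def)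
      also have "\<dots> = (\<Sum>a'<g. if a' = a then \<Sum>j<q. pairing (\<lambda>t. w t $ j) (dop (?r a j) \<phi>) else 0)"
        by (intro sum.cong) (auto simp: \<Phi>_def)
      finally show "(\<Sum>j<q. pairing (\<lambda>t. w t $ j) (dop (?r a j) \<phi>)) = 0"
        using a by simp
    qed
    then show "w \<in> L2_vec q \<and> (\<forall>a<g. ann q w (?r a))" using w by blast
  next
    assume "w \<in> L2_vec q \<and> (\<forall>a<g. ann q w (?r a))"
    then show "w \<in> weak_kernel q g r R"
      unfolding weak_kernel_def by (auto simp: key test_function_iff ann_def intro!: sum.neutral)
  qed
qed (simp add: weak_kernel_def)

lemma sum_lessThan_add: "(\<Sum>j<m + p. f j) = (\<Sum>j<m. f j) + (\<Sum>j<(p::nat). f (m + j))"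
  for f :: "nat \<Rightarrow> 'a::comm_monoid_add"
  by (induction p) (auto simp: add.assoc)

text \<open>The set where f is nonzero is open and negligible, hence empty.\<close>

lemma continuous_pairing_eq_0:
  assumes f: "continuous_on {-1..1} f" and 0: "\<And>\<phi>. test \<phi> \<Longrightarrow> pairing f \<phi> = (0 :: real)" and t: "t \<in> \<I>"
  shows "f t = 0"
proof (rule ccontr)
  assume ft: "f t \<noteq> 0"
  have "open {s \<in> \<I>. f s \<in> - {0}}"
    by (rule continuous_open_preimage[unfolded vimage_def Int_def, simplified])
      (use f in \<open>auto elim: continuous_on_subset\<close>)
  moreover have "negligible {s \<in> \<I>. f s \<in> - {0}}"
  proof -
    have "AE s in MI. f s = 0" by (rule pairing_eq_0_imp_AE_0[OF L2I_continuous[OF f] 0])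
    then have "AE s in lebesgue. s \<in> \<I> \<longrightarrow> f s = 0" by (simp add: AE_restrict_space_iff)
    then obtain N where N: "N \<in> null_sets lebesgue" "{s \<in> space lebesgue. \<not> (s \<in> \<I> \<longrightarrow> f s = 0)} \<subseteq> N"
      by (auto simp: eventually_ae_filter)
    then have "negligible N" by (simp add: negligible_iff_null_sets)
    then show ?thesis by (rule negligible_subset) (use N(2) in auto)
  qed
  ultimately have "{s \<in> \<I>. f s \<in> - {0}} = {}" using open_not_negligible by blast
  then show False using ft t by blast
qed

text \<open>A weak solution of f' = c f is an eigenfunction, on which P(d/dt) acts as the number
  P(c).\<close>

lemma exponential_pairing:
  assumes f: "\<And>\<phi>. test \<phi> \<Longrightarrow> pairing f (neg_deriv \<phi>) = c * pairing f \<phi>" and L2: "f \<in> L2I"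
  shows "test \<phi> \<Longrightarrow> pairing f (dop P \<phi>) = poly P c * pairing f (\<phi> :: real \<Rightarrow> real)"
proof (induction P arbitrary: \<phi>)
  case (pCons a P)
  have "pairing f (dop (pCons a P) \<phi>) = pairing f (\<lambda>t. a * \<phi> t) + pairing f (dop P (neg_deriv \<phi>))"
    unfolding dop_pCons
    by (rule pairing_add[OF L2]) (intro smooth_cmult smooth_dop smooth_neg_deriv test_smooth pCons.prems)+
  then show ?case
    using pCons.IH[OF test_neg_deriv[OF pCons.prems]] f[OF pCons.prems]
    by (simp add: pairing_cmult algebra_simps)
qed simp

lemma test_linear_zero:
  fixes T :: "(real \<Rightarrow> real) \<Rightarrow> real"
  assumes "test_linear T" shows "T (\<lambda>_. 0) = 0"
proof -
  have "T (\<lambda>t. 0 * (\<lambda>_. 0) t) = 0 * T (\<lambda>_. 0)"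
    using assms test_zero unfolding test_linear_def by blast
  then show ?thesis by simp
qed

section \<open>Trajectories of state systems\<close>

locale io_system = state_system n a b for n a b +
  fixes m p :: nat and c d :: "nat \<Rightarrow> nat \<Rightarrow> real"
begin

text \<open>Modulo the system equations the row \<open>r\<close> acts as \<open>row_state r\<close> on the state plus \<open>row_input r\<close> on the input.\<close>

definition row_state :: "(nat \<Rightarrow> real poly) \<Rightarrow> nat \<Rightarrow> real" where
  "row_state r i = (\<Sum>j<p. state_part (r (m + j)) (c j) i)"

definition row_input :: "(nat \<Rightarrow> real poly) \<Rightarrow> nat \<Rightarrow> real poly" where
  "row_input r i = r i + (\<Sum>j<p. Polynomial.smult (d j i) (r (m + j)) + input_part (r (m + j)) (c j) i)"

definition null_row :: "(nat \<Rightarrow> real poly) \<Rightarrow> bool" where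
  "null_row r \<longleftrightarrow> (\<forall>i<n. row_state r i = 0) \<and> (\<forall>i<m. row_input r i = 0)"

lemma row_state_add: "row_state (\<lambda>j. r j + s j) i = row_state r i + row_state s i"
  by (simp add: row_state_def state_part_add sum.distrib)

lemma row_input_add: "row_input (\<lambda>j. r j + s j) i = row_input r i + row_input s i"
  by (simp add: row_input_def input_part_add smult_add_right sum.distrib algebra_simps)

lemma state_part_zero_fun: "state_part P (\<lambda>_. 0) i = 0"
  by (induction P) (auto simp: state_part_pCons)

lemma state_part_sum: "state_part P (\<lambda>i. \<Sum>j<(k::nat). c' j i) i = (\<Sum>j<k. state_part P (c' j) i)"
proof (induction k)
  case 0
  show ?case by (simp add: state_part_zero_fun)
next
  case (Suc k)
  then show ?case using state_part_lin[of P 1 "\<lambda>i. \<Sum>j<k. c' j i" "c' k" i] by simp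
qed

lemma input_part_sum: "input_part P (\<lambda>i. \<Sum>j<(k::nat). c' j i) i = (\<Sum>j<k. input_part P (c' j) i)"
proof (induction k)
  case 0
  show ?case by (simp add: input_part_zero_fun)
next
  case (Suc k)
  then show ?case using input_part_lin[of P 1 "\<lambda>i. \<Sum>j<k. c' j i" "c' k" i] by simp
qed

lemma row_state_mult: "row_state (\<lambda>j. P * r j) i = state_part P (row_state r) i"
  unfolding row_state_def[abs_def] state_part_sum by (simp add: state_part_mult)

lemma row_input_mult: "row_input (\<lambda>j. P * r j) i = P * row_input r i + input_part P (row_state r) i"
  unfolding row_state_def[abs_def] input_part_sum row_input_def
  by (simp add: input_part_mult sum.distrib sum_distrib_left algebra_simps)

lemma null_row_add: "null_row r \<Longrightarrow> null_row s \<Longrightarrow> null_row (\<lambda>j. r j + s j)"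
  by (simp add: null_row_def row_state_add row_input_add)

lemma null_row_mult:
  assumes "null_row r" shows "null_row (\<lambda>j. P * r j)"
proof -
  have "state_part P (row_state r) i = 0" if "i < n" for i
    using state_part_cong[of "row_state r" "\<lambda>_. 0" i P] assms that
    by (simp add: null_row_def state_part_zero_fun)
  moreover have "input_part P (row_state r) i = 0" for i
    using input_part_cong[of "row_state r" "\<lambda>_. 0" P i] assms input_part_zero_fun by (simp add: null_row_def)
  ultimately show ?thesis using assms by (simp add: null_row_def row_state_mult row_input_mult)
qed

text \<open>Induction on P: each derivative of the state is traded for A and B by \<open>eq\<close>.
  States and inputs may be arbitrary linear functionals because only the weak state equation
  enters.\<close>

lemma state_identity:
  assumes U: "\<And>j. j < m \<Longrightarrow> test_linear (U j)" and X: "\<And>i. i < n \<Longrightarrow> test_linear (X i)"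
    and eq: "\<And>i \<phi>. i < n \<Longrightarrow> test \<phi> \<Longrightarrow> X i (neg_deriv \<phi>) = (\<Sum>l<n. a i l * X l \<phi>) + (\<Sum>j<m. b i j * U j \<phi>)"
    and \<phi>: "test \<phi>"
  shows "(\<Sum>i<n. e i * X i (dop P \<phi>)) = (\<Sum>i<n. state_part P e i * X i \<phi>) + (\<Sum>j<m. U j (dop (input_part P e j) \<phi>))"
proof (induction P arbitrary: e)
  case 0
  show ?case using U X by (simp add: test_linear_zero)
next
  case (pCons \<alpha> Q)
  have lin: "T (\<lambda>t. k * f t + g t) = k * T f + T g" if "test_linear T" "test f" "test g" for T f g and k :: real
    using that by (simp add: test_linear_def test_cmult)
  have tQ: "test (dop Q \<phi>)" by (rule test_dop[OF \<phi>])
  have "X i (dop (pCons \<alpha> Q) \<phi>) = \<alpha> * X i \<phi> + X i (neg_deriv (dop Q \<phi>))" if "i < n" for i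
    unfolding dop_pCons neg_deriv_dop[OF test_smooth[OF \<phi>]]
    by (rule lin) (use that X \<phi> in \<open>auto intro: test_dop test_neg_deriv\<close>)
  then have "(\<Sum>i<n. e i * X i (dop (pCons \<alpha> Q) \<phi>)) = (\<Sum>i<n. e i * (\<alpha> * X i \<phi> +
      ((\<Sum>l<n. a i l * X l (dop Q \<phi>)) + (\<Sum>j<m. b i j * U j (dop Q \<phi>)))))"
    by (simp add: eq tQ)
  also have "\<dots> = (\<Sum>i<n. \<alpha> * e i * X i \<phi>) + (\<Sum>i<n. \<Sum>l<n. e i * a i l * X l (dop Q \<phi>)) + (\<Sum>i<n. \<Sum>j<m. e i * b i j * U j (dop Q \<phi>))"
    by (simp add: distrib_left sum.distrib sum_distrib_left mult_ac)
  also have "(\<Sum>i<n. \<Sum>l<n. e i * a i l * X l (dop Q \<phi>)) = (\<Sum>l<n. shift e l * X l (dop Q \<phi>))"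
    by (subst sum.swap) (simp add: shift_def sum_distrib_right)
  also have "(\<Sum>i<n. \<Sum>j<m. e i * b i j * U j (dop Q \<phi>)) = (\<Sum>j<m. inp e j * U j (dop Q \<phi>))"
    by (subst sum.swap) (simp add: inp_def sum_distrib_right)
  also have "(\<Sum>l<n. shift e l * X l (dop Q \<phi>)) = (\<Sum>i<n. state_part Q (shift e) i * X i \<phi>) + (\<Sum>j<m. U j (dop (input_part Q (shift e) j) \<phi>))"
    by (rule pCons.IH)
  finally have 1: "(\<Sum>i<n. e i * X i (dop (pCons \<alpha> Q) \<phi>)) = (\<Sum>i<n. \<alpha> * e i * X i \<phi>) +
     ((\<Sum>i<n. state_part Q (shift e) i * X i \<phi>) + (\<Sum>j<m. U j (dop (input_part Q (shift e) j) \<phi>))) +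
     (\<Sum>j<m. inp e j * U j (dop Q \<phi>))" .
  have "U j (dop (input_part (pCons \<alpha> Q) e j) \<phi>) = inp e j * U j (dop Q \<phi>) + U j (dop (input_part Q (shift e) j) \<phi>)"
    if "j < m" for j
    unfolding input_part_pCons dop_add[abs_def] dop_smult
    by (rule lin) (use that U in \<open>auto intro: test_dop \<phi>\<close>)
  then show ?case using 1
    by (simp add: state_part_pCons distrib_right sum.distrib)
qed

text \<open>The output equation replaces Y by X and U, and \<open>state_identity\<close> then
  removes all derivatives of X; what remains is collected in \<open>row_input\<close> and
  \<open>row_state\<close>.\<close>

lemma row_identity:
  assumes U: "\<And>j. j < m \<Longrightarrow> test_linear (U j)" and X: "\<And>i. i < n \<Longrightarrow> test_linear (X i)"
    and eq: "\<And>i \<phi>. i < n \<Longrightarrow> test \<phi> \<Longrightarrow> X i (neg_deriv \<phi>) = (\<Sum>l<n. a i l * X l \<phi>) + (\<Sum>j<m. b i j * U j \<phi>)"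
    and Y: "\<And>j \<phi>. j < p \<Longrightarrow> test \<phi> \<Longrightarrow> Y j \<phi> = (\<Sum>i<n. c j i * X i \<phi>) + (\<Sum>i<m. d j i * U i \<phi>)"
    and \<phi>: "test \<phi>"
  shows "(\<Sum>j<m. U j (dop (r j) \<phi>)) + (\<Sum>j<p. Y j (dop (r (m + j)) \<phi>)) =
     (\<Sum>i<m. U i (dop (row_input r i) \<phi>)) + (\<Sum>i<n. row_state r i * X i \<phi>)"
proof -
  have add: "T (\<lambda>t. f t + g t) = T f + T g" if "test_linear T" "test f" "test g" for T and f g :: "real \<Rightarrow> real"
    using that by (simp add: test_linear_def)
  have mult: "T (\<lambda>t. k * f t) = k * T f" if "test_linear T" "test f" for T f and k :: real
    using that by (simp add: test_linear_def)
  have tsum: "test (dop (\<Sum>j<k. P j) \<phi>) \<and> T (dop (\<Sum>j<k. P j) \<phi>) = (\<Sum>j<k. T (dop (P j) \<phi>))"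
    if "test_linear T" for T k and P :: "nat \<Rightarrow> real poly"
  proof (induction k)
    case (Suc k)
    show ?case using Suc add[OF that, of "dop (\<Sum>j<k. P j) \<phi>" "dop (P k) \<phi>"] test_dop[OF \<phi>]
      test_add[OF test_dop[OF \<phi>] test_dop[OF \<phi>], of "\<Sum>j<k. P j" "P k"]
      by (simp add: dop_add[abs_def])
  qed (simp add: test_linear_zero that)
  have Yj: "Y j (dop P \<phi>) = (\<Sum>i<n. state_part P (c j) i * X i \<phi>) +
      (\<Sum>i<m. U i (dop (Polynomial.smult (d j i) P + input_part P (c j) i) \<phi>))" if j: "j < p" for j P
  proof -
    have "U i (dop (Polynomial.smult (d j i) P + input_part P (c j) i) \<phi>) =
        d j i * U i (dop P \<phi>) + U i (dop (input_part P (c j) i) \<phi>)" if "i < m" for i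
      unfolding dop_add[abs_def] dop_smult
      using add[OF U[OF that] test_cmult[OF test_dop[OF \<phi>]] test_dop[OF \<phi>]] mult[OF U[OF that] test_dop[OF \<phi>]]
      by simp
    moreover have "(\<Sum>i<n. c j i * X i (dop P \<phi>)) =
        (\<Sum>i<n. state_part P (c j) i * X i \<phi>) + (\<Sum>i<m. U i (dop (input_part P (c j) i) \<phi>))"
      by (rule state_identity) (fact U X eq \<phi>)+
    ultimately show ?thesis
      unfolding Y[OF j test_dop[OF \<phi>]] by (simp add: sum.distrib)
  qed
  have Ui: "U i (dop (row_input r i) \<phi>) = U i (dop (r i) \<phi>) +
      (\<Sum>j<p. U i (dop (Polynomial.smult (d j i) (r (m + j)) + input_part (r (m + j)) (c j) i) \<phi>))" if i: "i < m" for i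
    unfolding row_input_def dop_add[of "r i", abs_def]
    using add[OF U[OF i] test_dop[OF \<phi>] conjunct1[OF tsum[OF U[OF i]]]] conjunct2[OF tsum[OF U[OF i]]]
    by (simp only:)
  have "(\<Sum>j<p. Y j (dop (r (m + j)) \<phi>)) = (\<Sum>j<p. \<Sum>i<n. state_part (r (m + j)) (c j) i * X i \<phi>) +
      (\<Sum>j<p. \<Sum>i<m. U i (dop (Polynomial.smult (d j i) (r (m + j)) + input_part (r (m + j)) (c j) i) \<phi>))"
    by (simp add: Yj sum.distrib)
  also have "(\<Sum>j<p. \<Sum>i<n. state_part (r (m + j)) (c j) i * X i \<phi>) = (\<Sum>i<n. row_state r i * X i \<phi>)"
    by (subst sum.swap) (simp add: row_state_def sum_distrib_right)
  also have "(\<Sum>j<p. \<Sum>i<m. U i (dop (Polynomial.smult (d j i) (r (m + j)) + input_part (r (m + j)) (c j) i) \<phi>))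
    = (\<Sum>i<m. \<Sum>j<p. U i (dop (Polynomial.smult (d j i) (r (m + j)) + input_part (r (m + j)) (c j) i) \<phi>))"
    by (rule sum.swap)
  finally show ?thesis by (simp add: Ui sum.distrib)
qed

end

section \<open>Exponential solutions\<close>

definition mat_apply :: "nat \<Rightarrow> (nat \<Rightarrow> nat \<Rightarrow> real) \<Rightarrow> (nat \<Rightarrow> real) \<Rightarrow> nat \<Rightarrow> real" where
  "mat_apply N M x i = (\<Sum>j<N. M i j * x j)"

text \<open>The components of exp(t M) x as scalar power series, which avoids a topology on matrices
  of variable size.\<close>

definition exp_sol :: "nat \<Rightarrow> (nat \<Rightarrow> nat \<Rightarrow> real) \<Rightarrow> (nat \<Rightarrow> real) \<Rightarrow> nat \<Rightarrow> real \<Rightarrow> real" where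
  "exp_sol N M x i t = (\<Sum>k. (mat_apply N M ^^ k) x i / fact k * t ^ k)"

lemma mat_apply_pow_bound:
  "(\<Sum>i<N. \<bar>(mat_apply N M ^^ k) x i\<bar>) \<le> (\<Sum>i<N. \<Sum>j<N. \<bar>M i j\<bar>) ^ k * (\<Sum>i<N. \<bar>x i\<bar>)"
proof (induction k)
  case (Suc k)
  let ?y = "(mat_apply N M ^^ k) x" and ?K = "\<Sum>i<N. \<Sum>j<N. \<bar>M i j\<bar>"
  have "(\<Sum>i<N. \<bar>mat_apply N M ?y i\<bar>) \<le> (\<Sum>i<N. \<Sum>j<N. \<bar>M i j\<bar> * (\<Sum>l<N. \<bar>?y l\<bar>))"
  proof (rule sum_mono)
    fix i
    have "\<bar>mat_apply N M ?y i\<bar> \<le> (\<Sum>j<N. \<bar>M i j * ?y j\<bar>)" unfolding mat_apply_def by (rule sum_abs)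
    also have "\<dots> \<le> (\<Sum>j<N. \<bar>M i j\<bar> * (\<Sum>l<N. \<bar>?y l\<bar>))"
      by (intro sum_mono) (auto simp: abs_mult intro!: mult_left_mono member_le_sum)
    finally show "\<bar>mat_apply N M ?y i\<bar> \<le> (\<Sum>j<N. \<bar>M i j\<bar> * (\<Sum>l<N. \<bar>?y l\<bar>))" .
  qed
  also have "\<dots> = ?K * (\<Sum>l<N. \<bar>?y l\<bar>)" by (simp add: sum_distrib_right)
  also have "\<dots> \<le> ?K * (?K ^ k * (\<Sum>i<N. \<bar>x i\<bar>))"
    by (rule mult_left_mono[OF Suc]) (auto intro!: sum_nonneg)
  finally show ?case by (simp add: mult.assoc)
qed simp

lemma exp_sol_summable:
  assumes "i < N" shows "summable (\<lambda>k. (mat_apply N M ^^ k) x i / fact k * t ^ k)"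
proof (rule summable_comparison_test')
  let ?K = "\<Sum>i<N. \<Sum>j<N. \<bar>M i j\<bar>" and ?m = "\<Sum>i<N. \<bar>x i\<bar>"
  \<comment> \<open>The majorant is the exponential series of K |t|, where K is the sum of all |M i
    j| and bounds M in the l1 norm.\<close>
  show "summable (\<lambda>k. ?m * (inverse (fact k) * (?K * \<bar>t\<bar>) ^ k))"
    by (intro summable_mult summable_exp)
  fix k :: nat
  have "\<bar>(mat_apply N M ^^ k) x i\<bar> \<le> (\<Sum>i<N. \<bar>(mat_apply N M ^^ k) x i\<bar>)"
    by (rule member_le_sum) (use assms in auto)
  also have "\<dots> \<le> ?K ^ k * ?m" by (rule mat_apply_pow_bound)
  finally have "\<bar>(mat_apply N M ^^ k) x i\<bar> * (\<bar>t\<bar> ^ k / fact k) \<le> (?K ^ k * ?m) * (\<bar>t\<bar> ^ k / fact k)"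
    by (rule mult_right_mono) simp
  then show "norm ((mat_apply N M ^^ k) x i / fact k * t ^ k) \<le> ?m * (inverse (fact k) * (?K * \<bar>t\<bar>) ^ k)"
    by (simp add: abs_mult power_abs power_mult_distrib field_simps)
qed

lemma exp_sol_0: "exp_sol N M x i 0 = x i"
  using powser_zero[of "\<lambda>k. (mat_apply N M ^^ k) x i / fact k"] by (simp add: exp_sol_def)

lemma exp_sol_has_derivative:
  assumes i: "i < N"
  shows "(exp_sol N M x i has_real_derivative exp_sol N M (mat_apply N M x) i t) (at t)"
proof -
  let ?c = "\<lambda>k. (mat_apply N M ^^ k) x i / fact k"
  have "((\<lambda>t. \<Sum>k. ?c k * t ^ k) has_real_derivative (\<Sum>k. diffs ?c k * t ^ k)) (at t)"
    by (rule termdiffs_strong_converges_everywhere) (rule exp_sol_summable[OF i])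
  moreover have "diffs ?c k = (mat_apply N M ^^ k) (mat_apply N M x) i / fact k" for k
    unfolding diffs_def by (simp add: funpow_swap1 field_simps del: of_nat_Suc)
  ultimately show ?thesis by (simp add: exp_sol_def[abs_def])
qed

lemma exp_sol_mat_apply:
  assumes "i < N"
  shows "exp_sol N M (mat_apply N M x) i t = (\<Sum>j<N. M i j * exp_sol N M x j t)"
proof -
  have "(\<Sum>j<N. M i j * exp_sol N M x j t) = (\<Sum>j<N. \<Sum>k. M i j * ((mat_apply N M ^^ k) x j / fact k * t ^ k))"
    unfolding exp_sol_def by (intro sum.cong refl suminf_mult[symmetric] exp_sol_summable) auto
  also have "\<dots> = (\<Sum>k. \<Sum>j<N. M i j * ((mat_apply N M ^^ k) x j / fact k * t ^ k))"
    by (intro suminf_sum[symmetric] summable_mult exp_sol_summable) auto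
  also have "\<dots> = exp_sol N M (mat_apply N M x) i t"
  proof -
    have "(mat_apply N M ^^ k) (mat_apply N M x) i = (\<Sum>j<N. M i j * (mat_apply N M ^^ k) x j)" for k
      unfolding funpow_swap1[symmetric] by (simp only: mat_apply_def)
    then show ?thesis by (simp add: exp_sol_def sum_distrib_right sum_divide_distrib mult.assoc)
  qed
  finally show ?thesis by simp
qed

lemma smooth_closed_scalar_exp_sol:
  assumes i: "i < N" shows "smooth_closed_scalar (exp_sol N M x i)"
  unfolding smooth_closed_scalar_def
proof (intro exI[of _ "\<lambda>k. exp_sol N M ((mat_apply N M ^^ k) x) i"] conjI ballI allI)
  fix k t
  show "(exp_sol N M ((mat_apply N M ^^ k) x) i has_real_derivative exp_sol N M ((mat_apply N M ^^ Suc k) x) i t) (at t within {-1..1})"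
    using exp_sol_has_derivative[OF i, of M "(mat_apply N M ^^ k) x" t] by (simp add: has_field_derivative_at_within)
qed simp

lemma smooth_closed_scalar_lin:
  assumes "smooth_closed_scalar f" "smooth_closed_scalar g"
  shows "smooth_closed_scalar (\<lambda>t. \<alpha> * f t + g t)"
proof -
  obtain D E where D: "\<forall>t\<in>{-1..1}. D 0 t = f t" "\<forall>k. \<forall>t\<in>{-1..1}. (D k has_real_derivative D (Suc k) t) (at t within {-1..1})"
    and E: "\<forall>t\<in>{-1..1}. E 0 t = g t" "\<forall>k. \<forall>t\<in>{-1..1}. (E k has_real_derivative E (Suc k) t) (at t within {-1..1})"
    using assms by (auto simp: smooth_closed_scalar_def)
  show ?thesis unfolding smooth_closed_scalar_def
    by (intro exI[of _ "\<lambda>k t. \<alpha> * D k t + E k t"] conjI ballI allI)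
      (use D E in \<open>auto intro!: DERIV_add DERIV_cmult\<close>)
qed

lemma smooth_closed_scalar_zero: "smooth_closed_scalar (\<lambda>_. 0)"
  unfolding smooth_closed_scalar_def by (rule exI[of _ "\<lambda>_ _. 0"]) auto

lemma smooth_closed_scalar_sum:
  "(\<And>j. j \<in> S \<Longrightarrow> smooth_closed_scalar (f j)) \<Longrightarrow> smooth_closed_scalar (\<lambda>t. \<Sum>j\<in>S. \<alpha> j * f j t)"
  by (induction S rule: infinite_finite_induct)
    (auto simp: smooth_closed_scalar_zero intro!: smooth_closed_scalar_lin)

lemma smooth_closed_scalar_cong:
  "smooth_closed_scalar f \<Longrightarrow> (\<And>t. t \<in> {-1..1} \<Longrightarrow> f t = g t) \<Longrightarrow> smooth_closed_scalar g"
  unfolding smooth_closed_scalar_def by auto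

lemma smooth_closed_scalar_continuous: "smooth_closed_scalar f \<Longrightarrow> continuous_on {-1..1} f"
proof -
  assume "smooth_closed_scalar f"
  then obtain D where D: "\<forall>t\<in>{-1..1}. D 0 t = f t" "\<forall>k. \<forall>t\<in>{-1..1}. (D k has_real_derivative D (Suc k) t) (at t within {-1..1})"
    by (auto simp: smooth_closed_scalar_def)
  have "continuous_on {-1..1} (D 0)"
    using D(2) DERIV_continuous by (metis continuous_on_eq_continuous_within)
  then show ?thesis using D(1) continuous_on_cong[of "{-1..1}" "{-1..1}" "D 0" f] by simp
qed

lemma smooth_closed_comp_continuous: "f \<in> smooth_closed d \<Longrightarrow> j < d \<Longrightarrow> continuous_on {-1..1} (\<lambda>t. f t $ j)"
  by (intro smooth_closed_scalar_continuous) (simp add: smooth_closed_def)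

lemma smooth_closed_L2_vec: "f \<in> smooth_closed d \<Longrightarrow> f \<in> L2_vec d"
  unfolding L2_vec_def L2_scalar_eq
  by (auto intro: L2I_continuous smooth_closed_comp_continuous) (auto simp: smooth_closed_def)

lemma smooth_closed_vec: "(\<And>j. j < d \<Longrightarrow> smooth_closed_scalar (f j)) \<Longrightarrow> (\<lambda>t. vec d (\<lambda>j. f j t)) \<in> smooth_closed d"
  unfolding smooth_closed_def by auto

lemma col_fun_index:
  assumes "t \<in> \<I>" "u \<in> L2_vec m" "y \<in> L2_vec p"
  shows "j < m \<Longrightarrow> col_fun u y t $ j = u t $ j" "j < p \<Longrightarrow> col_fun u y t $ (m + j) = y t $ j"
proof -
  have "u t \<in> carrier_vec m" "y t \<in> carrier_vec p" using assms by (auto simp: L2_vec_def)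
  then show "j < m \<Longrightarrow> col_fun u y t $ j = u t $ j" "j < p \<Longrightarrow> col_fun u y t $ (m + j) = y t $ j"
    by (auto simp: col_fun_def)
qed

lemma pairing_col_fun:
  assumes "u \<in> L2_vec m" "y \<in> L2_vec p"
  shows "(\<Sum>j<m + p. pairing (\<lambda>t. col_fun u y t $ j) (dop (r j) \<phi>)) =
    (\<Sum>j<m. pairing (\<lambda>t. u t $ j) (dop (r j) \<phi>)) + (\<Sum>j<p. pairing (\<lambda>t. y t $ j) (dop (r (m + j)) \<phi>))"
  unfolding sum_lessThan_add
  by (intro arg_cong2[where f = "(+)"] sum.cong refl pairing_cong) (auto simp: col_fun_index[OF _ assms])

lemma col_fun_L2_vec:
  assumes "u \<in> L2_vec m" "y \<in> L2_vec p" shows "col_fun u y \<in> L2_vec (m + p)"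
proof -
  have "(\<lambda>t. col_fun u y t $ j) \<in> L2I" if "j < m + p" for j
  proof (cases "j < m")
    case True
    have "(\<lambda>t. u t $ j) \<in> L2I" by (rule L2_vec_comp[OF assms(1) True])
    then show ?thesis
      unfolding L2I_def mem_Collect_eq
      by (subst measurable_cong[of MI _ "\<lambda>t. u t $ j"], simp add: col_fun_index[OF _ assms] True)
        (subst Bochner_Integration.integrable_cong[of MI MI _ "\<lambda>t. (norm (u t $ j))\<^sup>2"], auto simp: col_fun_index[OF _ assms] True)
  next
    case False
    define k where "k = j - m"
    have k: "j = m + k" "k < p" using that False by (auto simp: k_def)
    have "(\<lambda>t. y t $ k) \<in> L2I" by (rule L2_vec_comp[OF assms(2) k(2)])
    then show ?thesis
      unfolding L2I_def mem_Collect_eq k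
      by (subst measurable_cong[of MI _ "\<lambda>t. y t $ k"], simp add: col_fun_index[OF _ assms] k(2))
        (subst Bochner_Integration.integrable_cong[of MI MI _ "\<lambda>t. (norm (y t $ k))\<^sup>2"], auto simp: col_fun_index[OF _ assms] k(2))
  qed
  then show ?thesis using assms by (auto simp: L2_vec_def L2_scalar_eq col_fun_def)
qed

section \<open>Matrix state systems\<close>

definition system_trajectory ::
  "nat \<Rightarrow> real mat \<Rightarrow> real mat \<Rightarrow> real mat \<Rightarrow> real mat \<Rightarrow> (real \<Rightarrow> real vec) \<Rightarrow> (real \<Rightarrow> real vec) \<Rightarrow> (real \<Rightarrow> real vec) \<Rightarrow> bool" where
  "system_trajectory n A B C D u y x \<longleftrightarrow> (\<forall>t\<in>{-1..1}.
     (\<forall>j<n. ((\<lambda>s. x s $ j) has_real_derivative (A *\<^sub>v x t + B *\<^sub>v u t) $ j) (at t within {-1..1})) \<and>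
     y t = C *\<^sub>v x t + D *\<^sub>v u t)"

locale matrix_system =
  fixes n m p :: nat and A B C D :: "real mat"
  assumes A: "A \<in> carrier_mat n n" and B: "B \<in> carrier_mat n m"
    and C: "C \<in> carrier_mat p n" and D: "D \<in> carrier_mat p m"
begin

sublocale io_system n "\<lambda>i j. A $$ (i, j)" "\<lambda>i j. B $$ (i, j)" m p "\<lambda>j i. C $$ (j, i)" "\<lambda>j i. D $$ (j, i)" .

lemma trajectory_row_identity:
  assumes u: "u \<in> smooth_closed m" and y: "y \<in> smooth_closed p" and x: "x \<in> smooth_closed n"
    and tr: "system_trajectory n A B C D u y x" and \<phi>: "test \<phi>"
  shows "(\<Sum>j<m + p. pairing (\<lambda>t. col_fun u y t $ j) (dop (r j) \<phi>)) =
     (\<Sum>i<m. pairing (\<lambda>t. u t $ i) (dop (row_input r i) \<phi>)) + (\<Sum>i<n. row_state r i * pairing (\<lambda>t. x t $ i) \<phi>)"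
  unfolding pairing_col_fun[OF smooth_closed_L2_vec[OF u] smooth_closed_L2_vec[OF y]]
proof (rule row_identity[OF _ _ _ _ \<phi>])
  have uL: "(\<lambda>t. u t $ j) \<in> L2I" if "j < m" for j by (rule L2_vec_comp[OF smooth_closed_L2_vec[OF u] that])
  have xL: "(\<lambda>t. x t $ j) \<in> L2I" if "j < n" for j by (rule L2_vec_comp[OF smooth_closed_L2_vec[OF x] that])
  have car: "u t \<in> carrier_vec m" "x t \<in> carrier_vec n" if "t \<in> {-1..1}" for t
    using u x that by (auto simp: smooth_closed_def)
  show "test_linear (pairing (\<lambda>t. u t $ j))" if "j < m" for j by (rule test_linear_pairing[OF uL[OF that]])
  show "test_linear (pairing (\<lambda>t. x t $ j))" if "j < n" for j by (rule test_linear_pairing[OF xL[OF that]])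
  have lin: "pairing (\<lambda>t. (\<Sum>l<n. \<alpha> l * x t $ l) + (\<Sum>j<m. \<beta> j * u t $ j)) \<psi> =
      (\<Sum>l<n. \<alpha> l * pairing (\<lambda>t. x t $ l) \<psi>) + (\<Sum>j<m. \<beta> j * pairing (\<lambda>t. u t $ j) \<psi>)" if "test \<psi>" for \<alpha> \<beta> \<psi>
  proof -
    have sm: "smooth \<psi>" by (rule test_smooth[OF that])
    have "pairing (\<lambda>t. (\<Sum>l<n. \<alpha> l * x t $ l) + (\<Sum>j<m. \<beta> j * u t $ j)) \<psi> =
        pairing (\<lambda>t. \<Sum>l<n. \<alpha> l * x t $ l) \<psi> + pairing (\<lambda>t. \<Sum>j<m. \<beta> j * u t $ j) \<psi>"
      by (intro pairing_add_left L2I_sum L2I_cmult xL uL sm) auto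
    also have "pairing (\<lambda>t. \<Sum>l<n. \<alpha> l * x t $ l) \<psi> = (\<Sum>l<n. pairing (\<lambda>t. \<alpha> l * x t $ l) \<psi>)"
      by (intro pairing_sum_left L2I_cmult xL sm) auto
    also have "pairing (\<lambda>t. \<Sum>j<m. \<beta> j * u t $ j) \<psi> = (\<Sum>j<m. pairing (\<lambda>t. \<beta> j * u t $ j) \<psi>)"
      by (intro pairing_sum_left L2I_cmult uL sm) auto
    finally show ?thesis by (simp add: pairing_cmult_left)
  qed
  fix i and \<psi> :: "real \<Rightarrow> real" assume \<psi>: "test \<psi>"
  let ?x' = "\<lambda>t. (\<Sum>l<n. A $$ (i, l) * x t $ l) + (\<Sum>j<m. B $$ (i, j) * u t $ j)"
  show "pairing (\<lambda>t. x t $ i) (neg_deriv \<psi>) =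
      (\<Sum>l<n. A $$ (i, l) * pairing (\<lambda>t. x t $ l) \<psi>) + (\<Sum>j<m. B $$ (i, j) * pairing (\<lambda>t. u t $ j) \<psi>)" if i: "i < n"
  proof -
    have "pairing (\<lambda>t. x t $ i) (neg_deriv \<psi>) = pairing ?x' \<psi>"
    proof (rule pairing_parts[OF _ _ \<psi>])
      show "continuous_on {-1..1} ?x'"
        by (intro continuous_on_add continuous_on_sum continuous_on_mult continuous_on_const)
          (auto intro: smooth_closed_comp_continuous[OF x] smooth_closed_comp_continuous[OF u])
      fix t :: real assume t: "t \<in> {-1..1}"
      have "(A *\<^sub>v x t + B *\<^sub>v u t) $ i = ?x' t"
        using A B i car[OF t] by (simp add: scalar_prod_def atLeast0LessThan)
      moreover have "((\<lambda>t. x t $ i) has_real_derivative (A *\<^sub>v x t + B *\<^sub>v u t) $ i) (at t within {-1..1})"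
        using tr t i unfolding system_trajectory_def by blast
      ultimately show "((\<lambda>t. x t $ i) has_vector_derivative ?x' t) (at t within {-1..1})"
        by (simp only: has_real_derivative_iff_has_vector_derivative)
    qed
    then show ?thesis using lin[OF \<psi>] by simp
  qed
  show "pairing (\<lambda>t. y t $ i) \<psi> =
      (\<Sum>l<n. C $$ (i, l) * pairing (\<lambda>t. x t $ l) \<psi>) + (\<Sum>j<m. D $$ (i, j) * pairing (\<lambda>t. u t $ j) \<psi>)" if i: "i < p"
  proof -
    have "y t $ i = (\<Sum>l<n. C $$ (i, l) * x t $ l) + (\<Sum>j<m. D $$ (i, j) * u t $ j)" if t: "t \<in> \<I>" for t
    proof -
      have "t \<in> {-1..1}" using t by simp
      then have "y t $ i = (C *\<^sub>v x t + D *\<^sub>v u t) $ i" using tr by (simp add: system_trajectory_def)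
      then show ?thesis using C D i car[OF \<open>t \<in> {-1..1}\<close>] by (simp add: scalar_prod_def atLeast0LessThan)
    qed
    then have "pairing (\<lambda>t. y t $ i) \<psi> = pairing (\<lambda>t. (\<Sum>l<n. C $$ (i, l) * x t $ l) + (\<Sum>j<m. D $$ (i, j) * u t $ j)) \<psi>"
      by (intro pairing_cong) simp
    then show ?thesis using lin[OF \<psi>] by simp
  qed
qed

end

text \<open>Representations only speak of trajectories smooth on the closed interval, so this weaker
  notion is the one that can be computed from the matrices.\<close>

definition smooth_ann :: "nat \<Rightarrow> nat \<Rightarrow> (real \<Rightarrow> real vec) set \<Rightarrow> (nat \<Rightarrow> real poly) \<Rightarrow> bool" where
  "smooth_ann m p \<B> r \<longleftrightarrow> (\<forall>u\<in>smooth_closed m. \<forall>y\<in>smooth_closed p. col_fun u y \<in> \<B> \<longrightarrow> ann (m + p) (col_fun u y) r)"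

locale representation = matrix_system +
  fixes \<B> :: "(real \<Rightarrow> real vec) set"
  assumes in_behavior: "\<And>u y. u \<in> smooth_closed m \<Longrightarrow> y \<in> smooth_closed p \<Longrightarrow>
    col_fun u y \<in> \<B> \<longleftrightarrow> (\<exists>x \<in> smooth_closed n. system_trajectory n A B C D u y x)"
begin

lemma null_row_smooth_ann: "null_row r \<Longrightarrow> smooth_ann m p \<B> r"
  unfolding smooth_ann_def ann_def
proof (intro ballI impI allI)
  fix u y and \<phi> :: "real \<Rightarrow> real"
  assume r: "null_row r" and u: "u \<in> smooth_closed m" and y: "y \<in> smooth_closed p" and B: "col_fun u y \<in> \<B>" and \<phi>: "test \<phi>"
  obtain x where x: "x \<in> smooth_closed n" "system_trajectory n A B C D u y x"
    using in_behavior[OF u y] B by blast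
  show "(\<Sum>j<m + p. pairing (\<lambda>t. col_fun u y t $ j) (dop (r j) \<phi>)) = 0"
    unfolding trajectory_row_identity[OF u y x \<phi>] using r by (simp add: null_row_def)
qed

text \<open>Two families of trajectories are enough. Zero input with a unit initial state forces
  \<open>row_state r\<close> to vanish; an input exp(\<gamma> t) in a single channel then forces
  \<open>row_input r\<close> to vanish at every real \<gamma>.\<close>

lemma smooth_ann_null_row:
  assumes r: "smooth_ann m p \<B> r" shows "null_row r"
proof -
  \<comment> \<open>A smooth solution of the state equation becomes a trajectory once its output is
    defined by C and D; the row identity then leaves only input and state terms.\<close>
  have id0: "(\<Sum>i<m. pairing (\<lambda>t. u t $ i) (dop (row_input r i) \<phi>)) + (\<Sum>i<n. row_state r i * pairing (\<lambda>t. x t $ i) \<phi>) = 0"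
    if u: "u \<in> smooth_closed m" and x: "x \<in> smooth_closed n"
      and der: "\<And>t j. t \<in> {-1..1} \<Longrightarrow> j < n \<Longrightarrow> ((\<lambda>s. x s $ j) has_real_derivative (A *\<^sub>v x t + B *\<^sub>v u t) $ j) (at t within {-1..1})"
      and \<phi>: "test \<phi>" for u x \<phi>
  proof -
    define y where "y t = C *\<^sub>v x t + D *\<^sub>v u t" for t
    have car: "u t \<in> carrier_vec m" "x t \<in> carrier_vec n" if "t \<in> {-1..1}" for t
      using u x that by (auto simp: smooth_closed_def)
    have "smooth_closed_scalar (\<lambda>t. y t $ j)" if j: "j < p" for j
    proof (rule smooth_closed_scalar_cong)
      show "smooth_closed_scalar (\<lambda>t. 1 * (\<Sum>l\<in>{..<n}. C $$ (j, l) * x t $ l) + (\<Sum>l\<in>{..<m}. D $$ (j, l) * u t $ l))"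
        by (intro smooth_closed_scalar_lin smooth_closed_scalar_sum) (use u x in \<open>auto simp: smooth_closed_def\<close>)
      show "1 * (\<Sum>l\<in>{..<n}. C $$ (j, l) * x t $ l) + (\<Sum>l\<in>{..<m}. D $$ (j, l) * u t $ l) = y t $ j" if "t \<in> {-1..1}" for t
        unfolding y_def using C D j car[OF that] by (simp add: scalar_prod_def atLeast0LessThan)
    qed
    moreover have "y t \<in> carrier_vec p" if "t \<in> {-1..1}" for t using C D car[OF that] by (simp add: y_def)
    ultimately have y: "y \<in> smooth_closed p" by (simp add: smooth_closed_def)
    have tr: "system_trajectory n A B C D u y x" using der by (simp add: system_trajectory_def y_def)
    then have "col_fun u y \<in> \<B>" using in_behavior[OF u y] x by blast
    then have "ann (m + p) (col_fun u y) r" using r u y by (simp add: smooth_ann_def)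
    then show ?thesis using trajectory_row_identity[OF u y x tr \<phi>, of r] \<phi> by (simp add: ann_def)
  qed
  have state0: "row_state r i0 = 0" if i0: "i0 < n" for i0
  proof -
    let ?M = "\<lambda>i j. A $$ (i, j)"
    define z where "z i = exp_sol n ?M (\<lambda>i. if i = i0 then 1 else 0) i" for i
    define x where "x t = vec n (\<lambda>i. z i t)" for t
    define u where "u t = vec m (\<lambda>_. 0 :: real)" for t :: real
    have u: "u \<in> smooth_closed m" unfolding u_def by (rule smooth_closed_vec) (rule smooth_closed_scalar_zero)
    have x: "x \<in> smooth_closed n" unfolding x_def z_def by (intro smooth_closed_vec smooth_closed_scalar_exp_sol)
    have der: "((\<lambda>s. x s $ j) has_real_derivative (A *\<^sub>v x t + B *\<^sub>v u t) $ j) (at t within {-1..1})" if j: "j < n" for t j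
    proof -
      have "(z j has_real_derivative (\<Sum>l<n. A $$ (j, l) * z l t)) (at t)"
        unfolding z_def using exp_sol_has_derivative[OF j] by (simp add: exp_sol_mat_apply[OF j])
      moreover have "(A *\<^sub>v x t + B *\<^sub>v u t) $ j = (\<Sum>l<n. A $$ (j, l) * z l t)"
        using A B j by (simp add: x_def u_def scalar_prod_def atLeast0LessThan)
      ultimately show ?thesis using j by (simp add: x_def has_field_derivative_at_within)
    qed
    have cz: "continuous_on {-1..1} (z i)" if "i < n" for i
      unfolding z_def by (intro smooth_closed_scalar_continuous smooth_closed_scalar_exp_sol that)
    have cz': "continuous_on {-1..1} (\<lambda>t. row_state r i * z i t)" if "i \<in> {..<n}" for i
      using continuous_on_mult_left[OF cz, of i "row_state r i"] that by simp
    \<comment> \<open>At time 0 the state is the unit vector of index i0, so evaluating there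
      singles out one coefficient.\<close>
    have "(\<Sum>i<n. row_state r i * z i 0) = 0"
    proof (rule continuous_pairing_eq_0[of "\<lambda>t. \<Sum>i<n. row_state r i * z i t"])
      show "continuous_on {-1..1} (\<lambda>t. \<Sum>i<n. row_state r i * z i t)"
        by (intro continuous_on_sum cz')
      fix \<phi> :: "real \<Rightarrow> real" assume \<phi>: "test \<phi>"
      have "pairing (\<lambda>t. \<Sum>i<n. row_state r i * z i t) \<phi> = (\<Sum>i<n. row_state r i * pairing (z i) \<phi>)"
        by (subst pairing_sum_left)
          (auto simp: pairing_cmult_left test_smooth[OF \<phi>] intro!: L2I_continuous cz')
      also have "\<dots> = (\<Sum>i<n. row_state r i * pairing (\<lambda>t. x t $ i) \<phi>)"
        by (intro sum.cong arg_cong2[where f = "(*)"] pairing_cong refl) (simp add: x_def)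
      also have "\<dots> = 0"
      proof -
        have "pairing (\<lambda>t. u t $ i) \<psi> = 0" if "i < m" for i \<psi>
          using pairing_zero_left[of \<psi>] that by (simp add: u_def)
        then show ?thesis using id0[OF u x der \<phi>] by simp
      qed
      finally show "pairing (\<lambda>t. \<Sum>i<n. row_state r i * z i t) \<phi> = 0" .
    qed simp
    then show ?thesis using i0 by (simp add: z_def exp_sol_0 if_distrib cong: if_cong)
  qed
  have "row_input r i0 = 0" if i0: "i0 < m" for i0
  proof -
    have "poly (row_input r i0) \<gamma> = 0" for \<gamma>
    proof -
      \<comment> \<open>The input is adjoined as an extra state with z_n' = \<gamma> z_n, so that
        one homogeneous exponential solution provides input and state together.\<close>
      define M where "M i j = (if i < n then if j < n then A $$ (i, j) else B $$ (i, i0) else if j = n then \<gamma> else 0)" for i j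
      define z where "z i = exp_sol (Suc n) M (\<lambda>i. if i = n then 1 else 0) i" for i
      define x where "x t = vec n (\<lambda>i. z i t)" for t
      define u where "u t = vec m (\<lambda>j. if j = i0 then z n t else 0)" for t
      have z: "smooth_closed_scalar (z i)" if "i < Suc n" for i
        unfolding z_def using that by (rule smooth_closed_scalar_exp_sol)
      have u: "u \<in> smooth_closed m" unfolding u_def
      proof (rule smooth_closed_vec)
        fix j
        show "smooth_closed_scalar (\<lambda>t. if j = i0 then z n t else 0)"
          using z[of n] smooth_closed_scalar_zero by (cases "j = i0") simp_all
      qed
      have x: "x \<in> smooth_closed n" unfolding x_def by (intro smooth_closed_vec z) simp
      have dz: "(z j has_real_derivative (\<Sum>l<Suc n. M j l * z l t)) (at t)" if j: "j < Suc n" for t j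
        unfolding z_def using exp_sol_has_derivative[OF j] by (simp only: exp_sol_mat_apply[OF j])
      have der: "((\<lambda>s. x s $ j) has_real_derivative (A *\<^sub>v x t + B *\<^sub>v u t) $ j) (at t within {-1..1})" if j: "j < n" for t j
      proof -
        have "(A *\<^sub>v x t + B *\<^sub>v u t) $ j = (\<Sum>l<Suc n. M j l * z l t)"
          using A B j i0 by (simp add: x_def u_def M_def scalar_prod_def atLeast0LessThan if_distrib cong: if_cong)
        then show ?thesis using dz[of j t] j by (simp add: x_def has_field_derivative_at_within)
      qed
      have zn: "pairing (z n) (neg_deriv \<phi>) = \<gamma> * pairing (z n) \<phi>" if \<phi>: "test \<phi>" for \<phi>
      proof -
        have "pairing (z n) (neg_deriv \<phi>) = pairing (\<lambda>t. \<gamma> * z n t) \<phi>"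
        proof (rule pairing_parts[OF _ _ \<phi>])
          show "continuous_on {-1..1} (\<lambda>t. \<gamma> * z n t)"
            by (intro continuous_on_mult continuous_on_const smooth_closed_scalar_continuous z) simp
          fix t
          show "(z n has_vector_derivative \<gamma> * z n t) (at t within {-1..1})"
            using dz[of n t] by (simp add: M_def has_vector_derivative_at_within has_real_derivative_iff_has_vector_derivative)
        qed
        then show ?thesis by (simp add: pairing_cmult_left)
      qed
      have L2: "z n \<in> L2I" by (intro L2I_continuous smooth_closed_scalar_continuous z) simp
      have "poly (row_input r i0) \<gamma> * pairing (z n) \<phi> = 0" if \<phi>: "test \<phi>" for \<phi>
      proof -
        have "(\<Sum>i<m. pairing (\<lambda>t. u t $ i) (dop (row_input r i) \<phi>)) = 0"
          using id0[OF u x der \<phi>] state0 by simp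
        moreover have "pairing (\<lambda>t. u t $ i) \<psi> = (if i = i0 then pairing (z n) \<psi> else 0)" if "i < m" for i \<psi>
          using that pairing_zero_left[of \<psi>] by (simp add: u_def)
        ultimately show ?thesis using i0 exponential_pairing[OF zn L2 \<phi>] by simp
      qed
      moreover have "\<exists>\<phi>. test \<phi> \<and> pairing (z n) \<phi> \<noteq> 0"
      proof (rule ccontr)
        assume "\<not> ?thesis"
        then have "z n 0 = 0"
          by (intro continuous_pairing_eq_0[of "z n"] smooth_closed_scalar_continuous z) auto
        then show False by (simp add: z_def exp_sol_0)
      qed
      ultimately show ?thesis by auto
    qed
    then show ?thesis using poly_all_0_iff_0 by blast
  qed
  then show ?thesis using state0 by (simp add: null_row_def)
qed

end

section \<open>Annihilators of a behavior\<close>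

definition behavior_ann :: "nat \<Rightarrow> (real \<Rightarrow> real vec) set \<Rightarrow> (nat \<Rightarrow> real poly) \<Rightarrow> bool" where
  "behavior_ann q \<B> r \<longleftrightarrow> (\<forall>w\<in>\<B>. ann q w r)"

text \<open>The rows of a kernel representation are themselves annihilators of the behavior, so
  imposing all annihilators adds nothing. After this the coefficient matrices R no longer
  occur.\<close>

lemma behavior_kernel:
  assumes "linear_differential_behavior q \<B>"
  shows "w \<in> \<B> \<longleftrightarrow> w \<in> L2_vec q \<and> (\<forall>r. behavior_ann q \<B> r \<longrightarrow> ann q w r)"
proof -
  obtain g k R where R: "\<forall>i\<le>k. R i \<in> carrier_mat g q" "\<B> = weak_kernel q g k R"
    using assms by (auto simp: linear_differential_behavior_def)
  have iff: "w \<in> \<B> \<longleftrightarrow> w \<in> L2_vec q \<and> (\<forall>a<g. ann q w (\<lambda>j. \<Sum>i\<le>k. monom (R i $$ (a, j)) i))" for w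
    unfolding R(2) by (rule weak_kernel_iff) (use R(1) in blast)
  then have "behavior_ann q \<B> (\<lambda>j. \<Sum>i\<le>k. monom (R i $$ (a, j)) i)" if "a < g" for a
    using that by (simp add: behavior_ann_def)
  then show ?thesis using iff by (auto simp: behavior_ann_def)
qed

lemma exp_pairing_nonzero: "\<exists>\<phi>. test \<phi> \<and> pairing (\<lambda>t. exp (\<gamma> * t)) \<phi> \<noteq> (0 :: real)"
proof (rule ccontr)
  assume "\<not> ?thesis"
  then have "exp (\<gamma> * 0) = (0 :: real)"
    by (intro continuous_pairing_eq_0[of "\<lambda>t. exp (\<gamma> * t)"]) (auto intro!: continuous_intros)
  then show False by simp
qed

lemma pairing_exp: "test \<phi> \<Longrightarrow> pairing (\<lambda>t. exp (\<gamma> * t)) (dop P \<phi>) = poly P \<gamma> * pairing (\<lambda>t. exp (\<gamma> * t)) \<phi>"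
  for \<phi> :: "real \<Rightarrow> real"
proof (rule exponential_pairing)
  have c: "continuous_on {-1..1} (\<lambda>t. exp (\<gamma> * t))" by (intro continuous_intros)
  then show "(\<lambda>t. exp (\<gamma> * t)) \<in> L2I" by (rule L2I_continuous)
  fix \<psi> :: "real \<Rightarrow> real" assume \<psi>: "test \<psi>"
  have "pairing (\<lambda>t. exp (\<gamma> * t)) (neg_deriv \<psi>) = pairing (\<lambda>t. \<gamma> * exp (\<gamma> * t)) \<psi>"
    by (rule pairing_parts[OF _ _ \<psi>])
      (auto intro!: derivative_eq_intros continuous_intros simp flip: has_real_derivative_iff_has_vector_derivative)
  then show "pairing (\<lambda>t. exp (\<gamma> * t)) (neg_deriv \<psi>) = \<gamma> * pairing (\<lambda>t. exp (\<gamma> * t)) \<psi>"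
    by (simp add: pairing_cmult_left)
qed

lemma smooth_closed_scalar_exp: "smooth_closed_scalar (\<lambda>t. \<alpha> * exp (\<gamma> * t))"
  unfolding smooth_closed_scalar_def
  by (rule exI[of _ "\<lambda>k t. \<alpha> * \<gamma> ^ k * exp (\<gamma> * t)"]) (auto intro!: derivative_eq_intros)

text \<open>Otherwise some exponential trajectory of the behavior is not annihilated by \<open>r\<close>.\<close>

lemma smooth_ann_multiple:
  assumes lin: "linear_differential_behavior (m + p) \<B>" and r: "smooth_ann m p \<B> r"
  obtains d where "d \<noteq> 0" "behavior_ann (m + p) \<B> (\<lambda>j. d * r j)"
proof -
  let ?N = "{s. behavior_ann (m + p) \<B> s}"
  have L2: "w \<in> L2_vec (m + p)" if "w \<in> \<B>" for w using behavior_kernel[OF lin, of w] that by blast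
  have "(\<exists>d s. d \<noteq> 0 \<and> s \<in> ?N \<and> (\<forall>j<m + p. s j = d * r j)) \<or>
    (\<exists>q. (\<forall>s\<in>?N. (\<Sum>j<m + p. s j * q j) = 0) \<and> (\<Sum>j<m + p. r j * q j) \<noteq> 0)"
    by (rule module_dichotomy) (auto simp: behavior_ann_def ann_zero intro: ann_add[OF L2] ann_mult)
  then show thesis
  proof
    assume "\<exists>d s. d \<noteq> 0 \<and> s \<in> ?N \<and> (\<forall>j<m + p. s j = d * r j)"
    then obtain d s where ds: "d \<noteq> 0" "behavior_ann (m + p) \<B> s" "\<forall>j<m + p. s j = d * r j" by blast
    have "ann (m + p) w s \<longleftrightarrow> ann (m + p) w (\<lambda>j. d * r j)" for w
      by (rule ann_cong) (use ds(3) in simp)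
    then show thesis using that ds by (simp add: behavior_ann_def)
  next
    assume "\<exists>q. (\<forall>s\<in>?N. (\<Sum>j<m + p. s j * q j) = 0) \<and> (\<Sum>j<m + p. r j * q j) \<noteq> 0"
    then obtain q where q: "\<And>s. behavior_ann (m + p) \<B> s \<Longrightarrow> (\<Sum>j<m + p. s j * q j) = 0" "(\<Sum>j<m + p. r j * q j) \<noteq> 0" by blast
    obtain \<gamma> where \<gamma>: "poly (\<Sum>j<m + p. r j * q j) \<gamma> \<noteq> 0" using q(2) poly_all_0_iff_0 by blast
    \<comment> \<open>The exponential with direction q(\<gamma>). Every annihilator s of the
      behavior satisfies s q = 0, so this function is a trajectory, whereas r acts on it by the
      nonzero number (r q)(\<gamma>).\<close>
    define u where "u t = vec m (\<lambda>j. poly (q j) \<gamma> * exp (\<gamma> * t))" for t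
    define y where "y t = vec p (\<lambda>j. poly (q (m + j)) \<gamma> * exp (\<gamma> * t))" for t
    have u: "u \<in> smooth_closed m" unfolding u_def by (intro smooth_closed_vec smooth_closed_scalar_exp)
    have y: "y \<in> smooth_closed p" unfolding y_def by (intro smooth_closed_vec smooth_closed_scalar_exp)
    have eval: "(\<Sum>j<m + p. pairing (\<lambda>t. col_fun u y t $ j) (dop (s j) \<phi>)) =
        poly (\<Sum>j<m + p. s j * q j) \<gamma> * pairing (\<lambda>t. exp (\<gamma> * t)) \<phi>" if \<phi>: "test \<phi>" for s \<phi>
    proof -
      have "pairing (\<lambda>t. u t $ j) (dop (s j) \<phi>) = poly (s j * q j) \<gamma> * pairing (\<lambda>t. exp (\<gamma> * t)) \<phi>" if "j < m" for j
        using that by (simp add: u_def pairing_cmult_left pairing_exp[OF \<phi>])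
      moreover have "pairing (\<lambda>t. y t $ j) (dop (s (m + j)) \<phi>) = poly (s (m + j) * q (m + j)) \<gamma> * pairing (\<lambda>t. exp (\<gamma> * t)) \<phi>" if "j < p" for j
        using that by (simp add: y_def pairing_cmult_left pairing_exp[OF \<phi>])
      ultimately show ?thesis
        unfolding pairing_col_fun[OF smooth_closed_L2_vec[OF u] smooth_closed_L2_vec[OF y]]
        by (simp add: sum_lessThan_add poly_sum sum_distrib_right distrib_right)
    qed
    have "col_fun u y \<in> \<B>"
      unfolding behavior_kernel[OF lin, of "col_fun u y"]
      using col_fun_L2_vec[OF smooth_closed_L2_vec[OF u] smooth_closed_L2_vec[OF y]]
      by (auto simp: ann_def eval q(1))
    then have "ann (m + p) (col_fun u y) r" using r u y by (simp add: smooth_ann_def)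
    then show thesis using \<gamma> exp_pairing_nonzero[of \<gamma>] by (auto simp: ann_def eval)
  qed
qed

text \<open>
  By controllability a trajectory on \<open>(-1, 0]\<close> can be continued by zero near the right end. A distribution
  killed by \<open>d(d/dt)\<close> which vanishes on some open interval vanishes identically.
\<close>

lemma controllable_torsion_free:
  assumes lin: "linear_differential_behavior q \<B>" and ctr: "controllable \<B>" and d: "d \<noteq> 0"
    and dr: "behavior_ann q \<B> (\<lambda>j. d * r j)"
  shows "behavior_ann q \<B> r"
proof -
  define h where "h w \<phi> = (\<Sum>j<q. pairing (\<lambda>t. w t $ j) (dop (r j) \<phi>))" for w :: "real \<Rightarrow> real vec" and \<phi>
  have L2: "w \<in> L2_vec q" if "w \<in> \<B>" for w using behavior_kernel[OF lin, of w] that by blast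
  \<comment> \<open>Up to a function supported in [a, b], \<phi> is the image of some \<psi> under
    d(-d/dt), and on such images the functional vanishes because d r annihilates w.\<close>
  have h_local: "h w \<phi> = 0" if w: "w \<in> \<B>" and ab: "a < b" "-1 < a" "b < 1" and \<phi>: "test \<phi>"
    and van: "\<And>\<rho>. test \<rho> \<Longrightarrow> vanishes_outside a b \<rho> \<Longrightarrow> h w \<rho> = 0" for w a b \<phi>
  proof -
    obtain \<rho> \<psi> where \<rho>: "test \<rho>" "vanishes_outside a b \<rho>" and \<psi>: "test \<psi>" and eq: "\<phi> = (\<lambda>t. \<rho> t + dop d \<psi> t)"
      using test_decomposition[OF ab d \<phi>] .
    have sm: "smooth \<rho>" "smooth \<psi>" using \<rho> \<psi> by (auto intro: test_smooth)
    have "pairing (\<lambda>t. w t $ j) (dop (r j) \<phi>) =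
        pairing (\<lambda>t. w t $ j) (dop (r j) \<rho>) + pairing (\<lambda>t. w t $ j) (dop (d * r j) \<psi>)" if "j < q" for j
      unfolding eq dop_add_fun[OF sm(1) smooth_dop[OF sm(2)]] mult.commute[of d] dop_mult[OF sm(2)]
      by (intro pairing_add L2_vec_comp[OF L2[OF w]] that smooth_dop sm)
    then have "h w \<phi> = h w \<rho> + (\<Sum>j<q. pairing (\<lambda>t. w t $ j) (dop (d * r j) \<psi>))"
      by (simp add: h_def sum.distrib)
    then show ?thesis using van[OF \<rho>] dr w \<psi> by (simp add: behavior_ann_def ann_def)
  qed
  have zero: "(\<lambda>_. 0\<^sub>v q) \<in> \<B>"
  proof -
    have "(\<lambda>_. 0\<^sub>v q) \<in> L2_vec q" by (auto simp: L2_vec_def L2_scalar_eq)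
    moreover have "ann q (\<lambda>_. 0\<^sub>v q) s" for s by (auto simp: ann_def)
    ultimately show ?thesis using behavior_kernel[OF lin, of "\<lambda>_. 0\<^sub>v q"] by blast
  qed
  have "h w \<phi> = 0" if w: "w \<in> \<B>" and \<phi>: "test \<phi>" for w \<phi>
  proof -
    obtain t1 v where t1: "t1 \<in> {0<..<1}" and v: "v \<in> \<B>" and left: "AE t\<in>{-1<..0} in lebesgue. v t = w t"
      and right: "AE t\<in>{t1..<1} in lebesgue. v t = 0\<^sub>v q"
      using ctr[unfolded controllable_def, rule_format, OF w zero] by blast
    have v0: "h v \<phi> = 0" if \<phi>: "test \<phi>" for \<phi>
    proof (rule h_local[OF v _ _ _ \<phi>])
      \<comment> \<open>These end points cut (t1, 1) into thirds; on the middle third v is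
        zero.\<close>
      show "(2 * t1 + 1) / 3 < (t1 + 2) / 3" "- 1 < (2 * t1 + 1) / 3" "(t1 + 2) / 3 < 1" using t1 by auto
      fix \<rho> :: "real \<Rightarrow> real" assume \<rho>: "test \<rho>" "vanishes_outside ((2 * t1 + 1) / 3) ((t1 + 2) / 3) \<rho>"
      have "pairing (\<lambda>t. v t $ j) (dop (r j) \<rho>) = pairing (\<lambda>_. 0) (dop (r j) \<rho>)" if j: "j < q" for j
      proof (rule pairing_cong_AE)
        have "AE t in MI. t \<in> {t1..<1} \<longrightarrow> v t = 0\<^sub>v q"
          using right by (auto simp: AE_restrict_space_iff elim: eventually_mono)
        then show "AE t in MI. v t $ j * dop (r j) \<rho> t = 0 * dop (r j) \<rho> t"
        proof (rule eventually_mono)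
          fix t assume t: "t \<in> {t1..<1} \<longrightarrow> v t = 0\<^sub>v q"
          show "v t $ j * dop (r j) \<rho> t = 0 * dop (r j) \<rho> t"
          proof (cases "t \<in> {t1..<1}")
            case False
            then have "t \<notin> {(2 * t1 + 1) / 3..(t1 + 2) / 3}" using t1 by auto
            then show ?thesis using vanishes_outside_dop[OF \<rho>(2), of "r j"] by (simp add: vanishes_outside_def)
          qed (use t j in simp)
        qed
      qed (use L2_vec_comp[OF L2[OF v] j] \<rho>(1) in \<open>auto intro: L2I_measurable smooth_dop test_smooth\<close>)
      then show "h v \<rho> = 0" by (simp add: h_def)
    qed
    show ?thesis
    proof (rule h_local[OF w _ _ _ \<phi>])
      \<comment> \<open>This interval lies in (-1, 0], where w agrees with v, and the functional of
        v is already known to vanish.\<close>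
      show "(-2/3) < (-1/3 :: real)" "- 1 < (-2/3 :: real)" "(-1/3 :: real) < 1" by auto
      fix \<rho> :: "real \<Rightarrow> real" assume \<rho>: "test \<rho>" "vanishes_outside (-2/3) (-1/3) \<rho>"
      have "pairing (\<lambda>t. w t $ j) (dop (r j) \<rho>) = pairing (\<lambda>t. v t $ j) (dop (r j) \<rho>)" if j: "j < q" for j
      proof (rule pairing_cong_AE)
        have "AE t in MI. t \<in> {-1<..0} \<longrightarrow> v t = w t"
          using left by (auto simp: AE_restrict_space_iff elim: eventually_mono)
        then show "AE t in MI. w t $ j * dop (r j) \<rho> t = v t $ j * dop (r j) \<rho> t"
        proof (rule eventually_mono)
          fix t assume t: "t \<in> {-1<..0} \<longrightarrow> v t = w t"
          show "w t $ j * dop (r j) \<rho> t = v t $ j * dop (r j) \<rho> t"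
          proof (cases "t \<in> {-1<..0}")
            case False
            then have "t \<notin> {-2/3..-1/3}" by auto
            then show ?thesis using vanishes_outside_dop[OF \<rho>(2), of "r j"] by (simp add: vanishes_outside_def)
          qed (use t in simp)
        qed
      qed (use L2_vec_comp[OF L2[OF v] j] L2_vec_comp[OF L2[OF w] j] \<rho>(1) in
          \<open>auto intro: L2I_measurable smooth_dop test_smooth\<close>)
      then have "h w \<rho> = h v \<rho>" by (simp add: h_def)
      then show "h w \<rho> = 0" using v0[OF \<rho>(1)] by simp
    qed
  qed
  then show ?thesis by (simp add: behavior_ann_def ann_def h_def)
qed

locale controllable_representation = representation +
  assumes lin: "linear_differential_behavior (m + p) \<B>" and ctr: "controllable \<B>"
begin

lemma behavior_ann_iff_null_row: "behavior_ann (m + p) \<B> r \<longleftrightarrow> null_row r"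
proof
  assume "behavior_ann (m + p) \<B> r"
  then have "smooth_ann m p \<B> r" by (auto simp: smooth_ann_def behavior_ann_def)
  then show "null_row r" by (rule smooth_ann_null_row)
next
  assume "null_row r"
  then have "smooth_ann m p \<B> r" by (rule null_row_smooth_ann)
  then obtain d where "d \<noteq> 0" "behavior_ann (m + p) \<B> (\<lambda>j. d * r j)"
    using smooth_ann_multiple[OF lin] by blast
  then show "behavior_ann (m + p) \<B> r" by (rule controllable_torsion_free[OF lin ctr])
qed

lemma null_row_torsion_free: "d \<noteq> 0 \<Longrightarrow> null_row (\<lambda>j. d * r j) \<Longrightarrow> null_row r"
  using controllable_torsion_free[OF lin ctr, of d r] by (simp add: behavior_ann_iff_null_row)

lemma mem_behavior_iff: "w \<in> \<B> \<longleftrightarrow> w \<in> L2_vec (m + p) \<and> (\<forall>r. null_row r \<longrightarrow> ann (m + p) w r)"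
  using behavior_kernel[OF lin, of w] by (simp add: behavior_ann_iff_null_row)

end

section \<open>Reduction of the state space\<close>

lemma mult_mat_vec_index:
  "M \<in> carrier_mat a b \<Longrightarrow> v \<in> carrier_vec b \<Longrightarrow> i < a \<Longrightarrow> (M *\<^sub>v v) $ i = (\<Sum>j<b. M $$ (i, j) * v $ j)"
  for M :: "real mat"
  by (simp add: scalar_prod_def atLeast0LessThan)

lemma mult_mat_index:
  "M \<in> carrier_mat a b \<Longrightarrow> N \<in> carrier_mat b c \<Longrightarrow> i < a \<Longrightarrow> j < c \<Longrightarrow>
    (M * N) $$ (i, j) = (\<Sum>k<b. M $$ (i, k) * N $$ (k, j))"
  for M :: "real mat"
  by (simp add: scalar_prod_def atLeast0LessThan)

lemma mat_eq_of_mult_vec: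
  assumes "M \<in> carrier_mat a b" "N \<in> carrier_mat a b" "\<And>x. x \<in> carrier_vec b \<Longrightarrow> M *\<^sub>v x = N *\<^sub>v x"
  shows "M = (N :: real mat)"
proof (rule eq_matI)
  fix i j assume ij: "i < dim_row N" "j < dim_col N"
  have "col M j = col N j"
    using assms(3)[of "unit_vec b j"] mat_unit_vec_col[OF assms(1)] mat_unit_vec_col[OF assms(2)] ij assms(2) by simp
  then have "col M j $ i = col N j $ i" by simp
  then show "M $$ (i, j) = N $$ (i, j)" using assms(1,2) ij by simp
qed (use assms in auto)

lemma representation_iff: "iso_representation m p \<B> n A B C D \<longleftrightarrow> representation n m p A B C D \<B>"
  unfolding iso_representation_def representation_def representation_axioms_def matrix_system_def system_trajectory_def
  by blast

context representation
begin

text \<open>An annihilator of the behavior annihilates its smooth members in particular, hence is a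
  null row.\<close>

lemma mem_behavior_if:
  assumes lin: "linear_differential_behavior (m + p) \<B>" and w: "w \<in> L2_vec (m + p)"
    and "\<And>r. null_row r \<Longrightarrow> ann (m + p) w r"
  shows "w \<in> \<B>"
  unfolding behavior_kernel[OF lin, of w]
proof (intro conjI allI impI w)
  fix r assume "behavior_ann (m + p) \<B> r"
  then have "smooth_ann m p \<B> r" by (auto simp: smooth_ann_def behavior_ann_def)
  then show "ann (m + p) w r" using smooth_ann_null_row assms(3) by blast
qed

text \<open>The kernel of T is invariant under A and invisible in the output, so T intertwines the
  two systems and maps states to states. For the converse no reduced state is lifted: null rows of
  the large system are null for the small one, so trajectories of the small system satisfy all
  equations of the behavior.\<close>

lemma reduced_representation:
  assumes lin: "linear_differential_behavior (m + p) \<B>"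
    and TS: "splitting r n T S"
    and C0: "\<And>x. x \<in> carrier_vec n \<Longrightarrow> T *\<^sub>v x = 0\<^sub>v r \<Longrightarrow> C *\<^sub>v x = 0\<^sub>v p"
    and A0: "\<And>x. x \<in> carrier_vec n \<Longrightarrow> T *\<^sub>v x = 0\<^sub>v r \<Longrightarrow> T *\<^sub>v (A *\<^sub>v x) = 0\<^sub>v r"
  shows "representation r m p (T * A * S) (T * B) (C * S) D \<B>"
proof -
  note TSD = splittingD[OF TS]
  let ?A = "T * A * S" and ?B = "T * B" and ?C = "C * S"
  have A1: "?A \<in> carrier_mat r r" and B1: "?B \<in> carrier_mat r m" and C1: "?C \<in> carrier_mat p r"
    using TSD A B C by auto
  have TA: "T * A = ?A * T"
  proof (rule mat_eq_of_mult_vec[of _ r n])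
    fix x :: "real vec" assume x: "x \<in> carrier_vec n"
    have Tx: "T *\<^sub>v x \<in> carrier_vec r" using TSD x by simp
    have STx: "S *\<^sub>v (T *\<^sub>v x) \<in> carrier_vec n" using TSD Tx by simp
    have "T *\<^sub>v (A *\<^sub>v (x - S *\<^sub>v (T *\<^sub>v x))) = 0\<^sub>v r"
      using A0 splitting_remainder[OF TS x] by blast
    then have "T *\<^sub>v (A *\<^sub>v x) - T *\<^sub>v (A *\<^sub>v (S *\<^sub>v (T *\<^sub>v x))) = 0\<^sub>v r"
      using mult_minus_distrib_mat_vec[OF A x STx]
        mult_minus_distrib_mat_vec[OF TSD(1), of "A *\<^sub>v x" "A *\<^sub>v (S *\<^sub>v (T *\<^sub>v x))"] A x STx by simp
    then have "T *\<^sub>v (A *\<^sub>v x) = T *\<^sub>v (A *\<^sub>v (S *\<^sub>v (T *\<^sub>v x)))"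
      by (rule vec_diff_eq_0D) (use TSD A x STx in auto)
    moreover have "(T * A) *\<^sub>v x = T *\<^sub>v (A *\<^sub>v x)" by (rule assoc_mult_mat_vec[OF TSD(1) A x])
    moreover have "(?A * T) *\<^sub>v x = ?A *\<^sub>v (T *\<^sub>v x)" by (rule assoc_mult_mat_vec[OF A1 TSD(1) x])
    moreover have "?A *\<^sub>v (T *\<^sub>v x) = (T * A) *\<^sub>v (S *\<^sub>v (T *\<^sub>v x))"
      by (rule assoc_mult_mat_vec[OF _ TSD(2) Tx]) (use TSD A in auto)
    moreover have "(T * A) *\<^sub>v (S *\<^sub>v (T *\<^sub>v x)) = T *\<^sub>v (A *\<^sub>v (S *\<^sub>v (T *\<^sub>v x)))"
      by (rule assoc_mult_mat_vec[OF TSD(1) A STx])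
    ultimately show "(T * A) *\<^sub>v x = (?A * T) *\<^sub>v x" by simp
  qed (use TSD A in auto)
  have CT: "C = ?C * T"
  proof (rule mat_eq_of_mult_vec[OF C])
    fix x :: "real vec" assume x: "x \<in> carrier_vec n"
    have Tx: "T *\<^sub>v x \<in> carrier_vec r" using TSD x by simp
    have STx: "S *\<^sub>v (T *\<^sub>v x) \<in> carrier_vec n" using TSD Tx by simp
    have "C *\<^sub>v (x - S *\<^sub>v (T *\<^sub>v x)) = 0\<^sub>v p" using C0 splitting_remainder[OF TS x] by blast
    then have "C *\<^sub>v x - C *\<^sub>v (S *\<^sub>v (T *\<^sub>v x)) = 0\<^sub>v p" using mult_minus_distrib_mat_vec[OF C x STx] by simp
    then have "C *\<^sub>v x = C *\<^sub>v (S *\<^sub>v (T *\<^sub>v x))" by (rule vec_diff_eq_0D) (use C x STx in auto)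
    then show "C *\<^sub>v x = (?C * T) *\<^sub>v x"
      using assoc_mult_mat_vec[OF C1 TSD(1) x] assoc_mult_mat_vec[OF C TSD(2) Tx] by simp
  qed (use C1 TSD in auto)
  interpret red: matrix_system r m p ?A ?B ?C D
    by unfold_locales (use A1 B1 C1 D in auto)
  \<comment> \<open>This is T^T: it turns functionals of the reduced state into functionals of the
    full state and is compatible with \<open>shift\<close> and \<open>inp\<close>.\<close>
  define pull where "pull e i = (\<Sum>k<r. e k * T $$ (k, i))" for e i
  have TAi: "(\<Sum>i<n. T $$ (k, i) * A $$ (i, j)) = (\<Sum>l<r. ?A $$ (k, l) * T $$ (l, j))" if "k < r" "j < n" for k j
    using mult_mat_index[OF TSD(1) A that] mult_mat_index[OF A1 TSD(1) that] TA by simp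
  have shift_pull: "shift (pull e) j = pull (red.shift e) j" if j: "j < n" for e j
  proof -
    have "shift (pull e) j = (\<Sum>i<n. \<Sum>k<r. e k * (T $$ (k, i) * A $$ (i, j)))"
      by (simp add: shift_def pull_def sum_distrib_right mult.assoc)
    also have "\<dots> = (\<Sum>k<r. e k * (\<Sum>i<n. T $$ (k, i) * A $$ (i, j)))"
      by (subst sum.swap) (simp add: sum_distrib_left)
    also have "\<dots> = (\<Sum>k<r. e k * (\<Sum>l<r. ?A $$ (k, l) * T $$ (l, j)))"
      by (intro sum.cong refl arg_cong2[where f = "(*)"] TAi) (use j in auto)
    also have "\<dots> = (\<Sum>k<r. \<Sum>l<r. e k * ?A $$ (k, l) * T $$ (l, j))"
      by (simp add: sum_distrib_left mult.assoc)
    also have "\<dots> = (\<Sum>l<r. \<Sum>k<r. e k * ?A $$ (k, l) * T $$ (l, j))" by (rule sum.swap)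
    also have "\<dots> = pull (red.shift e) j"
      by (simp only: red.shift_def pull_def sum_distrib_right)
    finally show ?thesis .
  qed
  have inp_pull: "inp (pull e) j = red.inp e j" if j: "j < m" for e j
  proof -
    have "inp (pull e) j = (\<Sum>i<n. \<Sum>k<r. e k * (T $$ (k, i) * B $$ (i, j)))"
      by (simp add: inp_def pull_def sum_distrib_right mult.assoc)
    also have "\<dots> = (\<Sum>k<r. e k * (\<Sum>i<n. T $$ (k, i) * B $$ (i, j)))"
      by (subst sum.swap) (simp add: sum_distrib_left)
    also have "\<dots> = (\<Sum>k<r. e k * ?B $$ (k, j))"
      by (intro sum.cong refl arg_cong2[where f = "(*)"] mult_mat_index[OF TSD(1) B, symmetric]) (use j in auto)
    finally show ?thesis by (simp add: red.inp_def)
  qed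
  have state_pull: "state_part P (pull e) i = pull (red.state_part P e) i" if i: "i < n" for P e i
  proof (induction P arbitrary: e)
    case 0
    then show ?case by (simp add: pull_def)
  next
    case (pCons \<alpha> Q)
    have "state_part Q (shift (pull e)) i = state_part Q (pull (red.shift e)) i"
      by (rule state_part_cong) (use shift_pull i in auto)
    then show ?case
      by (simp add: state_part_pCons red.state_part_pCons pCons.IH)
        (simp add: pull_def distrib_right sum.distrib sum_distrib_left mult.assoc)
  qed
  have input_pull: "input_part P (pull e) j = red.input_part P e j" if j: "j < m" for P e j
  proof (induction P arbitrary: e)
    case (pCons \<alpha> Q)
    have "input_part Q (shift (pull e)) j = input_part Q (pull (red.shift e)) j"
      by (rule input_part_cong) (use shift_pull in auto)
    then show ?case by (simp add: input_part_pCons red.input_part_pCons pCons.IH inp_pull[OF j])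
  qed simp
  have C_pull: "C $$ (j, i) = pull (\<lambda>k. ?C $$ (j, k)) i" if "j < p" "i < n" for j i
    using mult_mat_index[OF C1 TSD(1) that] CT by (simp add: pull_def)
  have null: "red.null_row s" if s: "null_row s" for s
  proof -
    have st: "row_state s i = pull (red.row_state s) i" if i: "i < n" for i
    proof -
      have "row_state s i = (\<Sum>j<p. state_part (s (m + j)) (pull (\<lambda>k. ?C $$ (j, k))) i)"
        unfolding row_state_def by (intro sum.cong refl state_part_cong) (use C_pull i in auto)
      also have "\<dots> = (\<Sum>j<p. pull (red.state_part (s (m + j)) (\<lambda>k. ?C $$ (j, k))) i)"
        by (simp add: state_pull[OF i])
      also have "\<dots> = pull (red.row_state s) i"
        unfolding pull_def red.row_state_def sum_distrib_right by (rule sum.swap)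
      finally show ?thesis .
    qed
    \<comment> \<open>T S = 1 makes \<open>pull\<close> injective: the product with column k of S
      recovers entry k.\<close>
    have "red.row_state s k = 0" if k: "k < r" for k
    proof -
      have "0 = (\<Sum>i<n. pull (red.row_state s) i * S $$ (i, k))"
        using s st by (simp add: null_row_def)
      also have "\<dots> = (\<Sum>i<n. \<Sum>l<r. red.row_state s l * (T $$ (l, i) * S $$ (i, k)))"
        by (simp add: pull_def sum_distrib_right mult.assoc)
      also have "\<dots> = (\<Sum>l<r. red.row_state s l * (\<Sum>i<n. T $$ (l, i) * S $$ (i, k)))"
        by (subst sum.swap) (simp add: sum_distrib_left)
      also have "\<dots> = (\<Sum>l<r. red.row_state s l * 1\<^sub>m r $$ (l, k))"
        using mult_mat_index[OF TSD(1,2)] k TSD(3) by simp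
      also have "\<dots> = (\<Sum>l<r. if l = k then red.row_state s l else 0)"
        by (rule sum.cong) (use k in auto)
      also have "\<dots> = red.row_state s k" using k by simp
      finally show ?thesis by simp
    qed
    moreover have "red.row_input s i = 0" if i: "i < m" for i
    proof -
      have "red.row_input s i = row_input s i"
        unfolding red.row_input_def row_input_def input_pull[OF i, symmetric]
        by (intro arg_cong2[where f = "(+)"] sum.cong refl input_part_cong) (simp add: C_pull)
      then show ?thesis using s i by (simp add: null_row_def)
    qed
    ultimately show ?thesis by (simp add: red.null_row_def)
  qed
  show ?thesis
  proof (unfold_locales)
    fix u y assume u: "u \<in> smooth_closed m" and y: "y \<in> smooth_closed p"
    show "col_fun u y \<in> \<B> \<longleftrightarrow> (\<exists>x \<in> smooth_closed r. system_trajectory r ?A ?B ?C D u y x)"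
    proof
      assume "col_fun u y \<in> \<B>"
      then obtain x where x: "x \<in> smooth_closed n" and tr: "system_trajectory n A B C D u y x"
        using in_behavior[OF u y] by blast
      define z where "z t = T *\<^sub>v x t" for t
      have car: "u t \<in> carrier_vec m" "x t \<in> carrier_vec n" if "t \<in> {-1..1}" for t
        using u x that by (auto simp: smooth_closed_def)
      have zi: "z t $ k = (\<Sum>i<n. T $$ (k, i) * x t $ i)" if "t \<in> {-1..1}" "k < r" for t k
        unfolding z_def by (rule mult_mat_vec_index[OF TSD(1) car(2)[OF that(1)] that(2)])
      have "smooth_closed_scalar (\<lambda>t. z t $ k)" if k: "k < r" for k
      proof (rule smooth_closed_scalar_cong)
        show "smooth_closed_scalar (\<lambda>t. \<Sum>i\<in>{..<n}. T $$ (k, i) * x t $ i)"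
          by (intro smooth_closed_scalar_sum) (use x in \<open>auto simp: smooth_closed_def\<close>)
      qed (use zi k in simp)
      moreover have "z t \<in> carrier_vec r" if "t \<in> {-1..1}" for t using TSD(1) car[OF that] by (simp add: z_def)
      ultimately have z: "z \<in> smooth_closed r" by (simp add: smooth_closed_def)
      have "system_trajectory r ?A ?B ?C D u y z"
        unfolding system_trajectory_def
      proof (intro ballI conjI allI impI)
        fix t :: real assume t: "t \<in> {-1..1}"
        note ct = car[OF t]
        have Ax: "A *\<^sub>v x t \<in> carrier_vec n" and Bu: "B *\<^sub>v u t \<in> carrier_vec n" using A B ct by auto
        have "(T * A) *\<^sub>v x t = (?A * T) *\<^sub>v x t" by (rule arg_cong[OF TA, of "\<lambda>M. M *\<^sub>v x t"])
        also have "\<dots> = ?A *\<^sub>v z t" unfolding z_def by (rule assoc_mult_mat_vec[OF A1 TSD(1) ct(2)])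
        finally have "?A *\<^sub>v z t = (T * A) *\<^sub>v x t" by (rule sym)
        then have eq: "?A *\<^sub>v z t + ?B *\<^sub>v u t = T *\<^sub>v (A *\<^sub>v x t + B *\<^sub>v u t)"
          using assoc_mult_mat_vec[OF TSD(1) A ct(2)] assoc_mult_mat_vec[OF TSD(1) B ct(1)]
            mult_add_distrib_mat_vec[OF TSD(1) Ax Bu] by simp
        show "y t = ?C *\<^sub>v z t + D *\<^sub>v u t"
          using tr t assoc_mult_mat_vec[OF C1 TSD(1) ct(2)] CT by (simp add: system_trajectory_def z_def)
        fix k assume k: "k < r"
        have "((\<lambda>s. \<Sum>i<n. T $$ (k, i) * x s $ i) has_real_derivative
            (\<Sum>i<n. T $$ (k, i) * (A *\<^sub>v x t + B *\<^sub>v u t) $ i)) (at t within {-1..1})"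
          by (intro DERIV_sum DERIV_cmult) (use tr t in \<open>simp add: system_trajectory_def\<close>)
        moreover have "(\<Sum>i<n. T $$ (k, i) * (A *\<^sub>v x t + B *\<^sub>v u t) $ i) = (?A *\<^sub>v z t + ?B *\<^sub>v u t) $ k"
          unfolding eq using mult_mat_vec_index[OF TSD(1) _ k, of "A *\<^sub>v x t + B *\<^sub>v u t"] Ax Bu by simp
        ultimately have "((\<lambda>s. \<Sum>i<n. T $$ (k, i) * x s $ i) has_real_derivative
            (?A *\<^sub>v z t + ?B *\<^sub>v u t) $ k) (at t within {-1..1})" by simp
        then show "((\<lambda>s. z s $ k) has_real_derivative (?A *\<^sub>v z t + ?B *\<^sub>v u t) $ k) (at t within {-1..1})"
          by (rule has_field_derivative_transform_within[of _ _ _ _ 1]) (use t zi k in auto)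
      qed
      then show "\<exists>x\<in>smooth_closed r. system_trajectory r ?A ?B ?C D u y x" using z by blast
    next
      assume "\<exists>x\<in>smooth_closed r. system_trajectory r ?A ?B ?C D u y x"
      then obtain z where z: "z \<in> smooth_closed r" and tr: "system_trajectory r ?A ?B ?C D u y z" by blast
      show "col_fun u y \<in> \<B>"
      proof (rule mem_behavior_if[OF lin])
        show "col_fun u y \<in> L2_vec (m + p)"
          by (intro col_fun_L2_vec smooth_closed_L2_vec u y)
        fix s assume "null_row s"
        then have s: "red.null_row s" by (rule null)
        show "ann (m + p) (col_fun u y) s"
          unfolding ann_def using red.trajectory_row_identity[OF u y z tr] s by (simp add: red.null_row_def)
      qed
    qed
  qed
qed

end

section \<open>Observability matrices\<close>

lemma block_index: "k < N \<Longrightarrow> j < (d::nat) \<Longrightarrow> k * d + j < N * d"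
proof -
  assume "k < N" "j < d"
  then have "k * d + j < Suc k * d" by simp
  also have "\<dots> \<le> N * d" using \<open>k < N\<close> by (intro mult_le_mono1) simp
  finally show ?thesis .
qed

lemma block_div_mod: "i < N * d \<Longrightarrow> i div d < N \<and> i mod d < (d :: nat)"
  by (cases "d = 0") (auto simp: less_mult_imp_div_less)

lemma sum_blocks: "(\<Sum>a<k * d. f a) = (\<Sum>i<k. \<Sum>j<d. f (i * d + j))" for f :: "nat \<Rightarrow> 'a::comm_monoid_add"
proof -
  have "(\<Sum>a<k * d. f a) = (\<Sum>l<k. sum f {l * d..<l * d + d})" by (rule sum.nat_group[symmetric])
  also have "\<dots> = (\<Sum>l<k. \<Sum>j<d. f (l * d + j))"
  proof (rule sum.cong[OF refl])
    fix l
    show "sum f {l * d..<l * d + d} = (\<Sum>j<d. f (l * d + j))"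
      by (rule sum.reindex_bij_witness[of _ "\<lambda>j. l * d + j" "\<lambda>a. a - l * d"]) auto
  qed
  finally show ?thesis .
qed


context matrix_system
begin

abbreviation out_row :: "nat \<Rightarrow> nat \<Rightarrow> real" where
  "out_row j \<equiv> \<lambda>i. C $$ (j, i)"

lemma out_power: "j < p \<Longrightarrow> i < n \<Longrightarrow> (C * A ^\<^sub>m k) $$ (j, i) = (shift ^^ k) (out_row j) i"
proof (induction k arbitrary: i)
  case 0
  then show ?case using A C by simp
next
  case (Suc k)
  have Ak: "A ^\<^sub>m k \<in> carrier_mat n n" by (rule pow_carrier_mat[OF A])
  have CA: "C * A ^\<^sub>m k \<in> carrier_mat p n" using C Ak by simp
  have "C * A ^\<^sub>m Suc k = (C * A ^\<^sub>m k) * A" using assoc_mult_mat[OF C Ak A] by simp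
  then have "(C * A ^\<^sub>m Suc k) $$ (j, i) = (\<Sum>l<n. (C * A ^\<^sub>m k) $$ (j, l) * A $$ (l, i))"
    using mult_mat_index[OF CA A] Suc.prems by simp
  then show ?case using Suc by (simp add: shift_def)
qed

lemma obs_mat_carrier: "obs_mat n p A C k \<in> carrier_mat (k * p) n"
  by (simp add: obs_mat_def)

lemma obs_mat_kernel:
  assumes x: "x \<in> carrier_vec n"
  shows "obs_mat n p A C k *\<^sub>v x = 0\<^sub>v (k * p) \<longleftrightarrow>
    (\<forall>l<k. \<forall>j<p. (\<Sum>i<n. (shift ^^ l) (out_row j) i * x $ i) = 0)"
proof -
  have entry: "(obs_mat n p A C k *\<^sub>v x) $ a = (\<Sum>i<n. (shift ^^ (a div p)) (out_row (a mod p)) i * x $ i)" if a: "a < k * p" for a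
    unfolding mult_mat_vec_index[OF obs_mat_carrier x a]
    by (rule sum.cong) (use a block_div_mod[OF a] in \<open>auto simp: obs_mat_def out_power\<close>)
  show ?thesis
  proof (intro iffI allI impI)
    fix l j assume 0: "obs_mat n p A C k *\<^sub>v x = 0\<^sub>v (k * p)" and lj: "l < k" "j < p"
    have a: "l * p + j < k * p" using lj by (rule block_index)
    have "(obs_mat n p A C k *\<^sub>v x) $ (l * p + j) = 0" unfolding 0 using a by simp
    then show "(\<Sum>i<n. (shift ^^ l) (out_row j) i * x $ i) = 0" unfolding entry[OF a] using lj by simp
  next
    assume *: "\<forall>l<k. \<forall>j<p. (\<Sum>i<n. (shift ^^ l) (out_row j) i * x $ i) = 0"
    show "obs_mat n p A C k *\<^sub>v x = 0\<^sub>v (k * p)"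
    proof (rule eq_vecI)
      fix a assume "a < dim_vec (0\<^sub>v (k * p) :: real vec)"
      then have a: "a < k * p" by simp
      show "(obs_mat n p A C k *\<^sub>v x) $ a = 0\<^sub>v (k * p) $ a"
        unfolding entry[OF a] using * block_div_mod[OF a] a by simp
    qed (simp add: obs_mat_def)
  qed
qed

text \<open>The input part which turns a given output part into a row with vanishing \<open>row_input\<close>.\<close>

definition complete_row :: "(nat \<Rightarrow> real poly) \<Rightarrow> nat \<Rightarrow> real poly" where
  "complete_row g j = (if j < m then - (\<Sum>k<p. Polynomial.smult (D $$ (k, j)) (g k) + input_part (g k) (out_row k) j)
     else g (j - m))"

lemma row_input_complete_row: "i < m \<Longrightarrow> row_input (complete_row g) i = 0"
  by (simp add: row_input_def complete_row_def)

lemma row_state_complete_row: "row_state (complete_row g) i = (\<Sum>j<p. state_part (g j) (out_row j) i)"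
  by (simp add: row_state_def complete_row_def)

lemma state_part_monom_sum:
  "state_part (\<Sum>k<N. monom (\<nu> k) k) e i = (\<Sum>k<N. \<nu> k * (shift ^^ k) e i)"
proof (cases N)
  case (Suc M)
  let ?P = "\<Sum>k<N. monom (\<nu> k) k"
  have coeff: "coeff ?P k = (if k < N then \<nu> k else 0)" for k by (simp add: coeff_sum coeff_monom)
  have "coeff ?P i = 0" if "M < i" for i unfolding coeff using Suc that by simp
  then have "degree ?P \<le> M" by (intro degree_le allI impI)
  then have "state_part ?P e i = (\<Sum>k\<le>M. coeff ?P k * (shift ^^ k) e i)" by (rule state_part_eq_sum)
  also have "\<dots> = (\<Sum>k\<le>M. (if k < N then \<nu> k else 0) * (shift ^^ k) e i)" by (simp only: coeff)
  also have "\<dots> = (\<Sum>k<N. \<nu> k * (shift ^^ k) e i)" by (rule sum.cong) (use Suc in auto)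
  finally show ?thesis .
qed simp

text \<open>The \<open>LEAST\<close> is attained because n qualifies: the rows of C A^n depend on
  those of lower powers, so adding this block leaves the kernel, and with it the rank,
  unchanged.\<close>

lemma rep_lag_step:
  "vec_space.rank (Suc (rep_lag n p A C) * p) (obs_mat n p A C (Suc (rep_lag n p A C))) =
    vec_space.rank (rep_lag n p A C * p) (obs_mat n p A C (rep_lag n p A C))"
  unfolding rep_lag_def
proof (rule LeastI[of "\<lambda>k. vec_space.rank (Suc k * p) (obs_mat n p A C (Suc k)) = vec_space.rank (k * p) (obs_mat n p A C k)" n])
  let ?O = "obs_mat n p A C"
  have last: "(\<Sum>i<n. (shift ^^ n) (out_row j) i * x $ i) = 0"
    if 0: "\<And>l. l < n \<Longrightarrow> (\<Sum>i<n. (shift ^^ l) (out_row j) i * x $ i) = 0" for j and x :: "real vec"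
  proof -
    obtain \<chi> where \<chi>: "\<chi> \<noteq> 0" "lead_coeff \<chi> = 1" "degree \<chi> \<le> n" "\<And>i. i < n \<Longrightarrow> state_part \<chi> (out_row j) i = 0"
      using monic_annihilator[of "out_row j"] by blast
    \<comment> \<open>A power of s raises the degree to exactly n, so that the relation can be
      solved for the n-th power.\<close>
    define \<psi> where "\<psi> = monom 1 (n - degree \<chi>) * \<chi>"
    have deg: "degree \<psi> = n" using \<chi> by (simp add: \<psi>_def degree_mult_eq monom_eq_0_iff degree_monom_eq)
    have "coeff \<psi> n = 1" using \<chi>(2) deg lead_coeff_mult[of "monom 1 (n - degree \<chi>)" \<chi>]
      by (simp add: \<psi>_def degree_monom_eq)
    have st0: "state_part \<psi> (out_row j) i = 0" if "i < n" for i
      using that state_part_cong[of "state_part \<chi> (out_row j)" "\<lambda>_. 0" i "monom 1 (n - degree \<chi>)"] \<chi>(4)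
      by (simp add: \<psi>_def state_part_mult state_part_zero_fun)
    have "0 = (\<Sum>i<n. state_part \<psi> (out_row j) i * x $ i)" using st0 by simp
    also have "\<dots> = (\<Sum>i<n. \<Sum>k\<le>n. coeff \<psi> k * ((shift ^^ k) (out_row j) i * x $ i))"
      by (simp add: state_part_eq_sum[of \<psi> n] deg sum_distrib_right mult.assoc)
    also have "\<dots> = (\<Sum>k\<le>n. coeff \<psi> k * (\<Sum>i<n. (shift ^^ k) (out_row j) i * x $ i))"
      by (subst sum.swap) (simp add: sum_distrib_left)
    also have "\<dots> = coeff \<psi> n * (\<Sum>i<n. (shift ^^ n) (out_row j) i * x $ i)"
      using 0 by (subst sum.remove[of _ n]) (auto intro: sum.neutral)
    finally show ?thesis using \<open>coeff \<psi> n = 1\<close> by simp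
  qed
  have eq: "?O (Suc n) *\<^sub>v x = 0\<^sub>v (Suc n * p) \<longleftrightarrow> ?O n *\<^sub>v x = 0\<^sub>v (n * p)" if "x \<in> carrier_vec n" for x
    unfolding obs_mat_kernel[OF that] using last[of _ x] by (auto simp: less_Suc_eq)
  obtain r T S where TS: "splitting r n T S" and T: "\<And>x. x \<in> carrier_vec n \<Longrightarrow> T *\<^sub>v x = 0\<^sub>v r \<longleftrightarrow> ?O n *\<^sub>v x = 0\<^sub>v (n * p)"
    using kernel_splitting[OF obs_mat_carrier] by blast
  have T': "T *\<^sub>v x = 0\<^sub>v r \<longleftrightarrow> ?O (Suc n) *\<^sub>v x = 0\<^sub>v (Suc n * p)" if "x \<in> carrier_vec n" for x
    using T[OF that] eq[OF that] by simp
  show "vec_space.rank (Suc n * p) (?O (Suc n)) = vec_space.rank (n * p) (?O n)"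
    using rank_splitting(1)[OF obs_mat_carrier TS T] rank_splitting(1)[OF obs_mat_carrier TS T'] by simp
qed

end

text \<open>The left kernel of the observability matrix consists of the output parts of the null rows, hence depends on
  the behavior only.\<close>

lemma obs_mat_left_kernel:
  assumes 1: "representation n m p A B C D \<B>" and 2: "representation n' m p A' B' C' D' \<B>"
    and q: "\<And>i. i < n \<Longrightarrow> (\<Sum>a<k * p. obs_mat n p A C k $$ (a, i) * q a) = 0" and i: "i < n'"
  shows "(\<Sum>a<k * p. obs_mat n' p A' C' k $$ (a, i) * q a) = 0"
proof -
  interpret R1: representation n m p A B C D \<B> by (rule 1)
  interpret R2: representation n' m p A' B' C' D' \<B> by (rule 2)
  \<comment> \<open>Entry l p + j of q becomes the coefficient of s^l at output j; the hypothesis on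
    q then says that the row has no state part in the first representation.\<close>
  define g where "g j = (\<Sum>l<k. monom (q (l * p + j)) l)" for j
  define r where "r = R1.complete_row g"
  have regroup: "(\<Sum>a<k * p. f a) = (\<Sum>j<p. \<Sum>l<k. f (l * p + j))" for f :: "nat \<Rightarrow> real"
    unfolding sum_blocks by (rule sum.swap)
  have st1: "(\<Sum>j<p. R1.state_part (g j) (R1.out_row j) i) = (\<Sum>a<k * p. obs_mat n p A C k $$ (a, i) * q a)" if "i < n" for i
    unfolding regroup g_def R1.state_part_monom_sum
    by (intro sum.cong refl) (use that in \<open>simp add: obs_mat_def block_index R1.out_power mult.commute\<close>)
  have st2: "(\<Sum>j<p. R2.state_part (g j) (R2.out_row j) i) = (\<Sum>a<k * p. obs_mat n' p A' C' k $$ (a, i) * q a)" if "i < n'" for i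
    unfolding regroup g_def R2.state_part_monom_sum
    by (intro sum.cong refl) (use that in \<open>simp add: obs_mat_def block_index R2.out_power mult.commute\<close>)
  have "R1.null_row r"
    unfolding R1.null_row_def r_def using R1.row_state_complete_row R1.row_input_complete_row st1 q by simp
  then have "R2.null_row r" by (intro R2.smooth_ann_null_row R1.null_row_smooth_ann)
  then have "R2.row_state r i = 0" using i by (simp add: R2.null_row_def)
  moreover have "R2.row_state r i = (\<Sum>j<p. R2.state_part (g j) (R2.out_row j) i)"
    by (simp add: R2.row_state_def r_def R1.complete_row_def)
  ultimately show ?thesis using st2[OF i] by simp
qed

text \<open>A column space is the orthogonal complement of the left kernel, and the left kernels of
  the two matrices agree.\<close>

lemma obs_mat_col_space:
  assumes 1: "representation n m p A B C D \<B>" and 2: "representation n' m p A' B' C' D' \<B>" and x: "x \<in> carrier_vec n"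
  shows "\<exists>y \<in> carrier_vec n'. obs_mat n p A C k *\<^sub>v x = obs_mat n' p A' C' k *\<^sub>v y"
proof -
  let ?O = "obs_mat n p A C k" and ?O' = "obs_mat n' p A' C' k"
  have O: "?O \<in> carrier_mat (k * p) n" "?O' \<in> carrier_mat (k * p) n'" by (simp_all add: obs_mat_def)
  have perp: "(\<Sum>a<k * p. (?O *\<^sub>v x) $ a * q a) = 0" if q: "\<And>i. i \<in> {..<n'} \<Longrightarrow> (\<Sum>a<k * p. ?O' $$ (a, i) * q a) = 0" for q
  proof -
    have q0: "(\<Sum>a<k * p. ?O $$ (a, i) * q a) = 0" if "i < n" for i
      by (rule obs_mat_left_kernel[OF 2 1 _ that]) (use q in simp)
    have "(\<Sum>a<k * p. (?O *\<^sub>v x) $ a * q a) = (\<Sum>a<k * p. \<Sum>i<n. x $ i * (?O $$ (a, i) * q a))"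
      by (rule sum.cong) (simp_all only: mult_mat_vec_index[OF O(1) x] lessThan_iff sum_distrib_right sum_distrib_left mult_ac)
    also have "\<dots> = (\<Sum>i<n. x $ i * (\<Sum>a<k * p. ?O $$ (a, i) * q a))"
      by (subst sum.swap) (simp add: sum_distrib_left)
    also have "\<dots> = 0" using q0 by simp
    finally show ?thesis .
  qed
  obtain \<nu> where \<nu>: "\<And>a. a < k * p \<Longrightarrow> (?O *\<^sub>v x) $ a = (\<Sum>i<n'. \<nu> i * ?O' $$ (a, i))"
    using row_space_duality[of "{..<n'}" "\<lambda>i a. ?O' $$ (a, i)" "k * p" "\<lambda>a. (?O *\<^sub>v x) $ a"] perp by auto
  have "?O *\<^sub>v x = ?O' *\<^sub>v vec n' \<nu>"
  proof (rule eq_vecI)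
    fix a assume "a < dim_vec (?O' *\<^sub>v vec n' \<nu>)"
    then have a: "a < k * p" using O by simp
    show "(?O *\<^sub>v x) $ a = (?O' *\<^sub>v vec n' \<nu>) $ a"
      unfolding \<nu>[OF a] mult_mat_vec_index[OF O(2) vec_carrier a] by (intro sum.cong) auto
  qed (use O in simp)
  then show ?thesis by (intro bexI[of _ "vec n' \<nu>"]) auto
qed

lemma rep_lag_unique:
  assumes 1: "representation n m p A B C D \<B>" and 2: "representation n' m p A' B' C' D' \<B>"
  shows "rep_lag n p A C = rep_lag n' p A' C'"
proof -
  have "vec_space.rank (k * p) (obs_mat n p A C k) = vec_space.rank (k * p) (obs_mat n' p A' C' k)" for k
    by (rule rank_eq_of_col_space[of _ _ n _ n'])
      (use obs_mat_col_space[OF 1 2] obs_mat_col_space[OF 2 1] in \<open>simp_all add: obs_mat_def\<close>)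
  then show ?thesis by (simp only: rep_lag_def)
qed

text \<open>The kernel of the observability matrix is an invariant subspace on which the output vanishes, so it can be
  divided out of the state space.\<close>

lemma minimal_representation:
  assumes lin: "linear_differential_behavior (m + p) \<B>" and ex: "\<exists>n A B C D. iso_representation m p \<B> n A B C D"
  obtains A B C D where "representation (mcmillan_degree m p \<B>) m p A B C D \<B>"
    and "\<And>x. x \<in> carrier_vec (mcmillan_degree m p \<B>) \<Longrightarrow>
      obs_mat (mcmillan_degree m p \<B>) p A C (lag m p \<B>) *\<^sub>v x = 0\<^sub>v (lag m p \<B> * p) \<Longrightarrow> x = 0\<^sub>v (mcmillan_degree m p \<B>)"
proof -
  define n where "n = mcmillan_degree m p \<B>"
  let ?P = "\<lambda>n. \<exists>A B C D. iso_representation m p \<B> n A B C D"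
  have "?P n" unfolding n_def mcmillan_degree_def by (rule LeastI_ex[OF ex])
  then obtain A B C D where rep: "representation n m p A B C D \<B>" by (auto simp: representation_iff)
  interpret representation n m p A B C D \<B> by (rule rep)
  let ?l = "rep_lag n p A C"
  have lag: "lag m p \<B> = ?l"
    unfolding lag_def
  proof (rule some_equality)
    show "\<exists>n A' B C' D. iso_representation m p \<B> n A' B C' D \<and> ?l = rep_lag n p A' C'"
      using rep unfolding representation_iff by blast
    fix l assume "\<exists>n A' B C' D. iso_representation m p \<B> n A' B C' D \<and> l = rep_lag n p A' C'"
    then show "l = ?l" using rep_lag_unique[OF rep] by (auto simp: representation_iff)
  qed
  let ?U = "{x \<in> carrier_vec n. obs_mat n p A C ?l *\<^sub>v x = 0\<^sub>v (?l * p)}"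
  \<comment> \<open>At the lag two consecutive observability matrices have the same rank and hence
    the same kernel, so a vector unseen by the first blocks is unseen by one more. The extra block
    is what yields invariance under A.\<close>
  have deep: "(\<Sum>i<n. (shift ^^ l) (out_row j) i * x $ i) = 0" if x: "x \<in> ?U" and lj: "l < Suc ?l" "j < p" for x l j
  proof -
    have xc: "x \<in> carrier_vec n" using x by simp
    have "obs_mat n p A C (Suc ?l) *\<^sub>v x = 0\<^sub>v (Suc ?l * p)"
    proof (rule rank_eq_kernel_eq[OF obs_mat_carrier obs_mat_carrier _ rep_lag_step xc])
      show "obs_mat n p A C ?l *\<^sub>v z = 0\<^sub>v (?l * p)"
        if "z \<in> carrier_vec n" "obs_mat n p A C (Suc ?l) *\<^sub>v z = 0\<^sub>v (Suc ?l * p)" for z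
        using that(2) unfolding obs_mat_kernel[OF that(1)] by auto
      show "obs_mat n p A C ?l *\<^sub>v x = 0\<^sub>v (?l * p)" using x by simp
    qed
    then show ?thesis using lj unfolding obs_mat_kernel[OF xc] by blast
  qed
  have O: "obs_mat n p A C ?l \<in> carrier_mat (?l * p) n" by (rule obs_mat_carrier)
  have U0: "0\<^sub>v n \<in> ?U" using mult_mat_zero_vec[OF O] by simp
  have Ulin: "x + \<kappa> \<cdot>\<^sub>v y \<in> ?U" if "x \<in> ?U" "y \<in> ?U" for x y \<kappa>
    using that by (auto simp: mult_add_distrib_mat_vec[OF O] mult_mat_vec[OF O])
  obtain r T S where TS: "splitting r n T S" and ker: "\<And>x. x \<in> carrier_vec n \<Longrightarrow> T *\<^sub>v x = 0\<^sub>v r \<longleftrightarrow> x \<in> ?U"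
    and less: "?U \<noteq> {0\<^sub>v n} \<Longrightarrow> r < n"
  proof (rule subspace_splitting[of ?U n])
    show "?U \<subseteq> carrier_vec n" by blast
  qed (use U0 Ulin that in blast)+
  have Cx: "C *\<^sub>v x = 0\<^sub>v p" if x: "x \<in> carrier_vec n" "T *\<^sub>v x = 0\<^sub>v r" for x
  proof (rule eq_vecI)
    fix j assume "j < dim_vec (0\<^sub>v p :: real vec)"
    then have j: "j < p" by simp
    have "(\<Sum>i<n. (shift ^^ 0) (out_row j) i * x $ i) = 0" by (rule deep) (use x ker j in auto)
    then show "(C *\<^sub>v x) $ j = 0\<^sub>v p $ j" unfolding mult_mat_vec_index[OF C x(1) j] using j by simp
  qed (use C in simp)
  have Ax: "T *\<^sub>v (A *\<^sub>v x) = 0\<^sub>v r" if x: "x \<in> carrier_vec n" "T *\<^sub>v x = 0\<^sub>v r" for x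
  proof -
    have c: "A *\<^sub>v x \<in> carrier_vec n" using A x by simp
    have "(\<Sum>i<n. (shift ^^ l) (out_row j) i * (A *\<^sub>v x) $ i) = 0" if lj: "l < ?l" "j < p" for l j
    proof -
      have "(\<Sum>i<n. (shift ^^ l) (out_row j) i * (A *\<^sub>v x) $ i) =
          (\<Sum>i<n. \<Sum>k<n. (shift ^^ l) (out_row j) i * A $$ (i, k) * x $ k)"
        by (rule sum.cong) (simp_all only: mult_mat_vec_index[OF A x(1)] lessThan_iff sum_distrib_left mult.assoc)
      also have "\<dots> = (\<Sum>k<n. (shift ^^ Suc l) (out_row j) k * x $ k)"
        by (subst sum.swap) (simp add: shift_def sum_distrib_right)
      also have "\<dots> = 0" by (rule deep) (use x ker lj in auto)
      finally show ?thesis .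
    qed
    then show ?thesis unfolding ker[OF c] using c obs_mat_kernel[OF c] by blast
  qed
  \<comment> \<open>Dividing out a nonzero unobservable subspace would produce a representation of
    smaller dimension.\<close>
  have "?U = {0\<^sub>v n}"
  proof (rule ccontr)
    assume "?U \<noteq> {0\<^sub>v n}"
    then have "r < n" by (rule less)
    moreover have "representation r m p (T * A * S) (T * B) (C * S) D \<B>"
      by (rule reduced_representation[OF lin TS Cx Ax])
    then have "?P r" unfolding representation_iff by blast
    then have "n \<le> r" unfolding n_def mcmillan_degree_def by (rule Least_le)
    ultimately show False by simp
  qed
  then have "x = 0\<^sub>v n" if "x \<in> carrier_vec n" "obs_mat n p A C ?l *\<^sub>v x = 0\<^sub>v (?l * p)" for x using that by blast
  then show thesis using that rep unfolding lag n_def by blast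
qed

section \<open>Gramians\<close>

lemma gramian_carrier: "gramian N F \<in> carrier_mat N N"
  by (simp add: gramian_def)

lemma gramian_symmetric: "transpose_mat (gramian N F) = gramian N F"
  by (rule eq_matI) (auto simp: gramian_def mult.commute)

definition combination :: "nat \<Rightarrow> (real \<Rightarrow> real vec) \<Rightarrow> real vec \<Rightarrow> real \<Rightarrow> real" where
  "combination N F v t = (\<Sum>a<N. v $ a * F t $ a)"

lemma combination_L2I:
  assumes "\<And>a. a < N \<Longrightarrow> (\<lambda>t. F t $ a) \<in> L2I" shows "combination N F v \<in> L2I"
  unfolding combination_def[abs_def] by (intro L2I_sum L2I_cmult assms) simp

lemma gramian_index:
  assumes F: "\<And>a. a < N \<Longrightarrow> (\<lambda>t. F t $ a) \<in> L2I" and v: "v \<in> carrier_vec N" and a: "a < N"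
  shows "(gramian N F *\<^sub>v v) $ a = (LINT t|MI. F t $ a * combination N F v t)"
proof -
  have "(gramian N F *\<^sub>v v) $ a = (\<Sum>b<N. (LINT t|MI. F t $ a * F t $ b) * v $ b)"
    unfolding mult_mat_vec_index[OF gramian_carrier v a] using a by (simp add: gramian_def set_integral_I)
  also have "\<dots> = (\<Sum>b<N. LINT t|MI. F t $ a * F t $ b * v $ b)" by simp
  also have "\<dots> = (LINT t|MI. (\<Sum>b<N. F t $ a * F t $ b * v $ b))"
    by (rule Bochner_Integration.integral_sum[symmetric]) (use L2I_mult_integrable[OF F[OF a] F] in auto)
  also have "\<dots> = (LINT t|MI. F t $ a * combination N F v t)"
    by (simp add: combination_def sum_distrib_left mult_ac)
  finally show ?thesis .
qed

lemma gramian_quadratic: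
  assumes F: "\<And>a. a < N \<Longrightarrow> (\<lambda>t. F t $ a) \<in> L2I" and v: "v \<in> carrier_vec N"
  shows "v \<bullet> (gramian N F *\<^sub>v v) = (LINT t|MI. (combination N F v t)\<^sup>2)"
proof -
  have "v \<bullet> (gramian N F *\<^sub>v v) = (\<Sum>a<N. v $ a * (LINT t|MI. F t $ a * combination N F v t))"
    using v by (simp add: scalar_prod_def atLeast0LessThan gramian_carrier[of N F, THEN carrier_matD(1)]
        gramian_index[OF F v] del: index_mult_mat_vec)
  also have "\<dots> = (\<Sum>a<N. LINT t|MI. v $ a * (F t $ a * combination N F v t))" by simp
  also have "\<dots> = (LINT t|MI. (\<Sum>a<N. v $ a * (F t $ a * combination N F v t)))"
    by (rule Bochner_Integration.integral_sum[symmetric]) (use L2I_mult_integrable[OF F combination_L2I[OF F]] in auto)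
  also have "\<dots> = (LINT t|MI. (combination N F v t)\<^sup>2)"
    by (rule Bochner_Integration.integral_cong)
      (auto simp: combination_def[of N F v] power2_eq_square sum_distrib_right mult.assoc)
  finally show ?thesis .
qed

lemma gramian_quadratic_eq_0:
  assumes F: "\<And>a. a < N \<Longrightarrow> (\<lambda>t. F t $ a) \<in> L2I" and v: "v \<in> carrier_vec N"
  shows "v \<bullet> (gramian N F *\<^sub>v v) = 0 \<longleftrightarrow> (AE t in MI. combination N F v t = 0)"
proof -
  have "integrable MI (\<lambda>t. (combination N F v t)\<^sup>2)"
    using L2I_mult_integrable[OF combination_L2I[OF F] combination_L2I[OF F]] by (simp add: power2_eq_square)
  moreover have "v \<bullet> (gramian N F *\<^sub>v v) = (LINT t|MI. (combination N F v t)\<^sup>2)"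
    by (rule gramian_quadratic[OF _ v]) (rule F)
  ultimately show ?thesis by (simp add: integral_nonneg_eq_0_iff_AE)
qed

text \<open>Each entry of \<Gamma> v integrates a component of F against v^T F, and v^T \<Gamma> v
  is the squared L2 norm of v^T F; so \<Gamma> v, v^T \<Gamma> v and v^T F vanish together.\<close>

lemma gramian_kernel:
  assumes F: "\<And>a. a < N \<Longrightarrow> (\<lambda>t. F t $ a) \<in> L2I" and v: "v \<in> carrier_vec N"
  shows "gramian N F *\<^sub>v v = 0\<^sub>v N \<longleftrightarrow> (AE t in MI. combination N F v t = 0)"
proof
  assume "gramian N F *\<^sub>v v = 0\<^sub>v N"
  then have "v \<bullet> (gramian N F *\<^sub>v v) = 0" using v by simp
  then show "AE t in MI. combination N F v t = 0" using gramian_quadratic_eq_0[OF F v] by simp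
next
  assume ae: "AE t in MI. combination N F v t = 0"
  show "gramian N F *\<^sub>v v = 0\<^sub>v N"
  proof (rule eq_vecI)
    fix a assume "a < dim_vec (0\<^sub>v N :: real vec)"
    then have a: "a < N" by simp
    have "(LINT t|MI. F t $ a * combination N F v t) = (LINT t|MI. 0)"
      by (rule integral_cong_AE)
        (use ae L2I_measurable[OF F[OF a]] L2I_measurable[OF combination_L2I[OF F]] in auto)
    then show "(gramian N F *\<^sub>v v) $ a = 0\<^sub>v N $ a" using gramian_index[OF F v a] a by simp
  qed (simp add: gramian_def)
qed

text \<open>The vectors e_i - S T e_i are the columns of the projection 1 - S T onto the kernel of
  T, so orthogonality to these N vectors is orthogonality to the whole kernel.\<close>

lemma splitting_kernel_span:
  assumes TS: "splitting r N T S" and z: "z \<in> carrier_vec N"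
    and 0: "\<And>i. i < N \<Longrightarrow> z \<bullet> (unit_vec N i - S *\<^sub>v (T *\<^sub>v unit_vec N i)) = 0"
    and v: "v \<in> carrier_vec N" and Tv: "T *\<^sub>v v = 0\<^sub>v r"
  shows "z \<bullet> v = 0"
proof -
  note D = splittingD[OF TS]
  define z' where "z' = transpose_mat T *\<^sub>v (transpose_mat S *\<^sub>v z)"
  have z': "z' \<in> carrier_vec N" using D z by (simp add: z'_def)
  have key: "z' \<bullet> x = z \<bullet> (S *\<^sub>v (T *\<^sub>v x))" if x: "x \<in> carrier_vec N" for x
  proof -
    have Tx: "T *\<^sub>v x \<in> carrier_vec r" using D x by simp
    have "z \<bullet> (S *\<^sub>v (T *\<^sub>v x)) = (transpose_mat S *\<^sub>v z) \<bullet> (T *\<^sub>v x)" by (rule scalar_prod_transpose[OF D(2) z Tx])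
    also have "\<dots> = z' \<bullet> x" unfolding z'_def by (rule scalar_prod_transpose[OF D(1) _ x]) (use D z in simp)
    finally show ?thesis by simp
  qed
  have "z = z'"
  proof (rule eq_vecI)
    fix i assume "i < dim_vec z'"
    then have i: "i < N" using z' by simp
    have e: "unit_vec N i \<in> carrier_vec N" by simp
    have "S *\<^sub>v (T *\<^sub>v unit_vec N i) \<in> carrier_vec N" using D by auto
    then have "z \<bullet> unit_vec N i = z \<bullet> (S *\<^sub>v (T *\<^sub>v unit_vec N i))"
      using 0[OF i] scalar_prod_minus_distrib[OF z e] by simp
    then have "z \<bullet> unit_vec N i = z' \<bullet> unit_vec N i" using key[OF e] by simp
    then show "z $ i = z' $ i" using z z' i by simp
  qed (use z z' in simp)
  then have "z \<bullet> v = z \<bullet> (S *\<^sub>v 0\<^sub>v r)" using key[OF v] Tv by simp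
  also have "\<dots> = 0" using mult_mat_zero_vec[OF D(2)] z by simp
  finally show ?thesis .
qed

text \<open>Finitely many kernel vectors span the kernel, so the exceptional null sets cause no trouble.\<close>

lemma in_gramian_image_iff:
  fixes F G :: "real \<Rightarrow> real vec"
  assumes F: "\<And>a. a < N \<Longrightarrow> (\<lambda>t. F t $ a) \<in> L2I" and G: "\<And>a. a < N \<Longrightarrow> (\<lambda>t. G t $ a) \<in> L2I"
    and Gc: "\<And>t. G t \<in> carrier_vec N"
  shows "(\<exists>g \<in> L2_vec N. AE t in MI. G t = gramian N F *\<^sub>v g t) \<longleftrightarrow>
    (\<forall>v \<in> carrier_vec N. gramian N F *\<^sub>v v = 0\<^sub>v N \<longrightarrow> (AE t in MI. combination N G v t = 0))"
proof
  let ?M = "gramian N F"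
  have comb: "combination N G v t = G t \<bullet> v" if "v \<in> carrier_vec N" for v t
    using that Gc[of t] by (simp add: combination_def scalar_prod_def atLeast0LessThan mult.commute)
  {
    assume "\<exists>g \<in> L2_vec N. AE t in MI. G t = ?M *\<^sub>v g t"
    then obtain g where g: "g \<in> L2_vec N" and eq: "AE t in MI. G t = ?M *\<^sub>v g t" by blast
    show "\<forall>v \<in> carrier_vec N. ?M *\<^sub>v v = 0\<^sub>v N \<longrightarrow> (AE t in MI. combination N G v t = 0)"
    proof (intro ballI impI)
      fix v :: "real vec" assume v: "v \<in> carrier_vec N" and 0: "?M *\<^sub>v v = 0\<^sub>v N"
      have sp: "AE t in MI. t \<in> space MI" by (rule AE_space)
      from eq sp show "AE t in MI. combination N G v t = 0"
      proof eventually_elim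
        case (elim t)
        then have gt: "g t \<in> carrier_vec N" using g by (auto simp: L2_vec_def)
        have "combination N G v t = (?M *\<^sub>v g t) \<bullet> v" using comb[OF v] elim by simp
        also have "\<dots> = v \<bullet> (?M *\<^sub>v g t)"
          by (rule comm_scalar_prod[OF _ v]) (use gt gramian_carrier[of N F] in simp)
        also have "\<dots> = (?M *\<^sub>v v) \<bullet> g t"
          using scalar_prod_transpose[OF gramian_carrier v gt] by (simp add: gramian_symmetric)
        finally show ?case using 0 gt by simp
      qed
    qed
  next
    assume R: "\<forall>v \<in> carrier_vec N. ?M *\<^sub>v v = 0\<^sub>v N \<longrightarrow> (AE t in MI. combination N G v t = 0)"
    obtain H where H: "H \<in> carrier_mat N N" and HM: "\<And>z. z \<in> carrier_vec N \<Longrightarrow>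
        (\<And>v. v \<in> carrier_vec N \<Longrightarrow> ?M *\<^sub>v v = 0\<^sub>v N \<Longrightarrow> z \<bullet> v = 0) \<Longrightarrow> ?M *\<^sub>v (H *\<^sub>v z) = z"
    proof (rule psd_right_inverse[OF gramian_carrier[of N F] gramian_symmetric])
      show "?M *\<^sub>v x = 0\<^sub>v N" if "x \<in> carrier_vec N" "x \<bullet> (?M *\<^sub>v x) = 0" for x
        using that gramian_quadratic_eq_0[OF F that(1)] gramian_kernel[OF F that(1)] by blast
    qed blast
    obtain r T S where TS: "splitting r N T S" and T: "\<And>x. x \<in> carrier_vec N \<Longrightarrow> T *\<^sub>v x = 0\<^sub>v r \<longleftrightarrow> ?M *\<^sub>v x = 0\<^sub>v N"
      using kernel_splitting[OF gramian_carrier] by blast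
    let ?e = "\<lambda>i. unit_vec N i - S *\<^sub>v (T *\<^sub>v unit_vec N i)"
    have "AE t in MI. \<forall>i\<in>{..<N}. G t \<bullet> ?e i = 0"
    proof (rule AE_finite_allI)
      fix i assume "i \<in> {..<N}"
      have e: "?e i \<in> carrier_vec N" "T *\<^sub>v ?e i = 0\<^sub>v r"
        by (rule splitting_remainder[OF TS], simp)+
      then have "AE t in MI. combination N G (?e i) t = 0" using R T by blast
      then show "AE t in MI. G t \<bullet> ?e i = 0" by (simp add: comb[OF e(1)])
    qed simp
    then have "AE t in MI. G t = ?M *\<^sub>v (H *\<^sub>v G t)"
    proof eventually_elim
      case (elim t)
      have "G t \<bullet> v = 0" if "v \<in> carrier_vec N" "?M *\<^sub>v v = 0\<^sub>v N" for v
        by (rule splitting_kernel_span[OF TS Gc]) (use elim that T in auto)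
      then show ?case using HM[OF Gc] by simp
    qed
    moreover have "(\<lambda>t. H *\<^sub>v G t) \<in> L2_vec N"
      unfolding L2_vec_def L2_scalar_eq
    proof (intro CollectI conjI ballI allI impI)
      show "H *\<^sub>v G t \<in> carrier_vec N" for t using H Gc by simp
      fix j assume j: "j < N"
      have "(\<lambda>t. \<Sum>i<N. H $$ (j, i) * G t $ i) \<in> L2I" by (intro L2I_sum L2I_cmult G) simp
      then show "(\<lambda>t. (H *\<^sub>v G t) $ j) \<in> L2I" unfolding mult_mat_vec_index[OF H Gc j] .
    qed
    ultimately show "\<exists>g \<in> L2_vec N. AE t in MI. G t = ?M *\<^sub>v g t"
      by (intro bexI[of _ "\<lambda>t. H *\<^sub>v G t"])
  }
qed

section \<open>Weak derivatives\<close>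

lemma is_weak_deriv_iff:
  "is_weak_deriv i f g \<longleftrightarrow> (\<forall>\<phi>. test \<phi> \<longrightarrow> pairing f ((neg_deriv ^^ i) \<phi>) = pairing g \<phi>)"
proof -
  have "(LINT t|MI. f t * (deriv ^^ i) \<phi> t) = (-1) ^ i * (LINT t|MI. g t * \<phi> t) \<longleftrightarrow>
      pairing f ((neg_deriv ^^ i) \<phi>) = pairing g \<phi>" if \<phi>: "test \<phi>" for \<phi>
  proof -
    have "pairing f ((neg_deriv ^^ i) \<phi>) = (LINT t|MI. (-1) ^ i * (f t * (deriv ^^ i) \<phi> t))"
      unfolding pairing_def by (simp add: mult.left_commute flip: deriv_funpow[OF \<phi>])
    also have "\<dots> = (-1) ^ i * (LINT t|MI. f t * (deriv ^^ i) \<phi> t)" by simp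
    finally have "pairing f ((neg_deriv ^^ i) \<phi>) = (-1) ^ i * (LINT t|MI. f t * (deriv ^^ i) \<phi> t)" .
    then show ?thesis unfolding pairing_def by (cases "even i") auto
  qed
  then show ?thesis by (auto simp: is_weak_deriv_def test_function_iff set_integral_I)
qed

text \<open>The index k counts the stacked derivatives 0, ..., k - 1 as in \<open>Lam\<close>, so it
  exceeds the Sobolev order by one.\<close>

definition weakly_regular :: "nat \<Rightarrow> nat \<Rightarrow> (real \<Rightarrow> real vec) \<Rightarrow> bool" where
  "weakly_regular k d f \<longleftrightarrow> f \<in> L2_vec d \<and> (\<forall>i<k. \<forall>j<d. \<exists>g\<in>L2I. is_weak_deriv i (\<lambda>t. f t $ j) g)"

lemma sobolev_weakly_regular: "f \<in> sobolev k d \<Longrightarrow> l \<le> Suc k \<Longrightarrow> weakly_regular l d f"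
  by (auto simp: sobolev_def weakly_regular_def L2_scalar_eq)

lemma weakly_regular_deriv:
  assumes f: "weakly_regular k d f" and "i < k" "j < d"
  shows "weak_deriv i (\<lambda>t. f t $ j) \<in> L2I"
    and "test \<phi> \<Longrightarrow> pairing (\<lambda>t. f t $ j) ((neg_deriv ^^ i) \<phi>) = pairing (weak_deriv i (\<lambda>t. f t $ j)) \<phi>"
proof -
  have "\<exists>g. g \<in> L2I \<and> is_weak_deriv i (\<lambda>t. f t $ j) g" using assms by (auto simp: weakly_regular_def)
  from someI_ex[OF this]
  have "weak_deriv i (\<lambda>t. f t $ j) \<in> L2I \<and> is_weak_deriv i (\<lambda>t. f t $ j) (weak_deriv i (\<lambda>t. f t $ j))"
    unfolding weak_deriv_def L2_scalar_eq .
  then show "weak_deriv i (\<lambda>t. f t $ j) \<in> L2I"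
    and "test \<phi> \<Longrightarrow> pairing (\<lambda>t. f t $ j) ((neg_deriv ^^ i) \<phi>) = pairing (weak_deriv i (\<lambda>t. f t $ j)) \<phi>"
    by (auto simp: is_weak_deriv_iff)
qed

lemma pairing_dop_weak:
  assumes f: "f \<in> L2I" and \<phi>: "test \<phi>" and P: "\<And>i. k \<le> i \<Longrightarrow> coeff P i = 0"
  shows "pairing f (dop P \<phi>) = (\<Sum>i<k. coeff P i * pairing f ((neg_deriv ^^ i) \<phi>))"
proof (cases k)
  case 0
  then have "P = 0" using P by (simp add: poly_eq_iff)
  then show ?thesis using 0 by simp
next
  case (Suc l)
  have "degree P \<le> l" by (rule degree_le) (use P Suc in auto)
  then have "dop P \<phi> = (\<lambda>t. \<Sum>i\<le>l. coeff P i * (neg_deriv ^^ i) \<phi> t)" by (intro ext dop_eq_sum)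
  then have "pairing f (dop P \<phi>) = (\<Sum>i\<le>l. pairing f (\<lambda>t. coeff P i * (neg_deriv ^^ i) \<phi> t))"
    using pairing_sum[OF f, of "{..l}" "\<lambda>i t. coeff P i * (neg_deriv ^^ i) \<phi> t"]
    by (simp add: smooth_cmult smooth_funpow_neg_deriv test_smooth[OF \<phi>])
  then show ?thesis using Suc by (simp add: pairing_cmult lessThan_Suc_atMost)
qed

text \<open>Undoes the stacking order of \<open>Lam\<close>: the entries i d + j of a vector become
  the coefficients of the polynomial acting on component j.\<close>

definition block_poly :: "nat \<Rightarrow> nat \<Rightarrow> (nat \<Rightarrow> real) \<Rightarrow> nat \<Rightarrow> real poly" where
  "block_poly d k v j = (\<Sum>i<k. monom (v (i * d + j)) i)"

lemma coeff_block_poly: "coeff (block_poly d k v j) i = (if i < k then v (i * d + j) else 0)"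
  by (simp add: block_poly_def coeff_sum coeff_monom)

lemma Lam_index: "a < k * d \<Longrightarrow> Lam d k f t $ a = weak_deriv (a div d) (\<lambda>s. f s $ (a mod d)) t"
  by (simp add: Lam_def)

lemma Lam_L2I: "weakly_regular k d f \<Longrightarrow> a < k * d \<Longrightarrow> (\<lambda>t. Lam d k f t $ a) \<in> L2I"
  using weakly_regular_deriv(1)[of k d f "a div d" "a mod d"] block_div_mod[of a k d]
  by (simp add: Lam_index)

text \<open>Moving the derivatives to the test function turns a linear functional of the stacked
  derivatives into a differential operator on f; this identifies vectors with rows of bounded
  degree.\<close>

lemma pairing_Lam:
  assumes f: "weakly_regular k d f" and \<phi>: "test \<phi>"
  shows "(\<Sum>a<k * d. v a * pairing (\<lambda>t. Lam d k f t $ a) \<phi>) = (\<Sum>j<d. pairing (\<lambda>t. f t $ j) (dop (block_poly d k v j) \<phi>))"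
proof -
  note idx = block_index[of _ k _ d]
  have "(\<Sum>a<k * d. v a * pairing (\<lambda>t. Lam d k f t $ a) \<phi>) =
      (\<Sum>i<k. \<Sum>j<d. v (i * d + j) * pairing (weak_deriv i (\<lambda>s. f s $ j)) \<phi>)"
    unfolding sum_blocks by (intro sum.cong refl) (simp add: Lam_index idx)
  also have "\<dots> = (\<Sum>j<d. \<Sum>i<k. v (i * d + j) * pairing (weak_deriv i (\<lambda>s. f s $ j)) \<phi>)" by (rule sum.swap)
  also have "\<dots> = (\<Sum>j<d. pairing (\<lambda>t. f t $ j) (dop (block_poly d k v j) \<phi>))"
  proof (rule sum.cong[OF refl])
    fix j assume "j \<in> {..<d}"
    then have j: "j < d" by simp
    have fj: "(\<lambda>t. f t $ j) \<in> L2I" using f j by (auto simp: weakly_regular_def intro: L2_vec_comp)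
    have "pairing (\<lambda>t. f t $ j) (dop (block_poly d k v j) \<phi>) =
        (\<Sum>i<k. coeff (block_poly d k v j) i * pairing (\<lambda>t. f t $ j) ((neg_deriv ^^ i) \<phi>))"
      by (rule pairing_dop_weak[OF fj \<phi>]) (simp add: coeff_block_poly)
    also have "\<dots> = (\<Sum>i<k. v (i * d + j) * pairing (weak_deriv i (\<lambda>s. f s $ j)) \<phi>)"
      by (intro sum.cong refl) (simp add: coeff_block_poly weakly_regular_deriv(2)[OF f _ j \<phi>])
    finally show "(\<Sum>i<k. v (i * d + j) * pairing (weak_deriv i (\<lambda>s. f s $ j)) \<phi>) =
        pairing (\<lambda>t. f t $ j) (dop (block_poly d k v j) \<phi>)" by simp
  qed
  finally show ?thesis .
qed

lemma pairing_combination: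
  assumes "\<And>a. a < N \<Longrightarrow> (\<lambda>t. F t $ a) \<in> L2I" and "test \<phi>"
  shows "pairing (combination N F v) \<phi> = (\<Sum>a<N. v $ a * pairing (\<lambda>t. F t $ a) \<phi>)"
  unfolding combination_def[abs_def]
  by (subst pairing_sum_left) (auto simp: pairing_cmult_left intro!: L2I_cmult assms test_smooth)

lemma combination_AE_iff:
  assumes F: "\<And>a. a < N \<Longrightarrow> (\<lambda>t. F t $ a) \<in> L2I"
  shows "(AE t in MI. combination N F v t = 0) \<longleftrightarrow> (\<forall>\<phi>. test \<phi> \<longrightarrow> (\<Sum>a<N. v $ a * pairing (\<lambda>t. F t $ a) \<phi>) = 0)"
proof
  assume ae: "AE t in MI. combination N F v t = 0"
  show "\<forall>\<phi>. test \<phi> \<longrightarrow> (\<Sum>a<N. v $ a * pairing (\<lambda>t. F t $ a) \<phi>) = 0"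
  proof (intro allI impI)
    fix \<phi> :: "real \<Rightarrow> real" assume \<phi>: "test \<phi>"
    have "pairing (combination N F v) \<phi> = pairing (\<lambda>_. 0) \<phi>"
      by (rule pairing_cong_AE)
        (use ae L2I_measurable[OF combination_L2I[OF F]] in \<open>auto intro: test_smooth[OF \<phi>] elim: eventually_mono\<close>)
    then show "(\<Sum>a<N. v $ a * pairing (\<lambda>t. F t $ a) \<phi>) = 0" by (simp add: pairing_combination[OF F \<phi>])
  qed
next
  assume "\<forall>\<phi>. test \<phi> \<longrightarrow> (\<Sum>a<N. v $ a * pairing (\<lambda>t. F t $ a) \<phi>) = 0"
  then show "AE t in MI. combination N F v t = 0"
    by (intro pairing_eq_0_imp_AE_0 combination_L2I F) (auto simp: pairing_combination[OF F])
qed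

text \<open>The coefficient vector v of \<zeta> satisfies v^T \<Lambda>_k(f) = 0 almost everywhere,
  hence v^T \<Gamma> v = 0, and definiteness of the Gramian forces v = 0.\<close>

lemma persistently_exciting_annihilator:
  assumes pe: "persistently_exciting d k f" and \<zeta>: "\<And>j i. j < d \<Longrightarrow> k \<le> i \<Longrightarrow> coeff (\<zeta> j) i = 0"
    and 0: "ann d f \<zeta>" and j: "j < d"
  shows "\<zeta> j = 0"
proof -
  have reg: "weakly_regular k d f" using pe by (intro sobolev_weakly_regular[of _ "k - 1"]) (auto simp: persistently_exciting_def)
  let ?F = "Lam d k f"
  note F = Lam_L2I[OF reg]
  define v where "v = vec (k * d) (\<lambda>a. coeff (\<zeta> (a mod d)) (a div d))"
  have vc: "v \<in> carrier_vec (k * d)" by (simp add: v_def)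
  note idx = block_index[of _ k _ d]
  have bp: "block_poly d k (\<lambda>a. v $ a) j = \<zeta> j" if "j < d" for j
    by (rule poly_eqI) (use that \<zeta>[OF that] idx in \<open>auto simp: coeff_block_poly v_def\<close>)
  have "AE t in MI. combination (k * d) ?F v t = 0"
  proof (rule combination_AE_iff[THEN iffD2])
    show "\<forall>\<phi>. test \<phi> \<longrightarrow> (\<Sum>a<k * d. v $ a * pairing (\<lambda>t. ?F t $ a) \<phi>) = 0"
      using pairing_Lam[OF reg, of _ "\<lambda>a. v $ a"] 0 by (simp add: bp ann_def)
  qed (rule F)
  then have "v \<bullet> (Gam d k f *\<^sub>v v) = 0"
    using gramian_quadratic_eq_0[OF F vc] by (simp add: Gam_def)
  then have v0: "v = 0\<^sub>v (k * d)" using pe vc unfolding persistently_exciting_def positive_definite_def by force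
  show "\<zeta> j = 0"
  proof (rule poly_eqI)
    fix i
    show "coeff (\<zeta> j) i = coeff 0 i"
    proof (cases "i < k")
      case True
      have "v $ (i * d + j) = 0" unfolding v0 using idx[OF True j] by simp
      then show ?thesis using idx[OF True j] j by (simp add: v_def)
    qed (use \<zeta>[OF j] in auto)
  qed
qed

section \<open>Rows of bounded degree\<close>

text \<open>Here \<open>l\<close> stands for the lag, and minimality of the representation enters
  through \<open>obs\<close>.\<close>

locale observable_representation = controllable_representation +
  fixes l L K :: nat
  assumes obs: "\<And>x. x \<in> carrier_vec n \<Longrightarrow> obs_mat n p A C l *\<^sub>v x = 0\<^sub>v (l * p) \<Longrightarrow> x = 0\<^sub>v n"
    and lK: "l < K" and KL: "K \<le> L"
begin

text \<open>The dual form of observability: the rows of an injective matrix span all functionals of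
  the state.\<close>

lemma obs_span:
  obtains \<nu> where "\<And>i. i < n \<Longrightarrow> e i = (\<Sum>k<l. \<Sum>j<p. \<nu> k j * (shift ^^ k) (out_row j) i)"
proof -
  obtain \<nu> where \<nu>: "\<And>i. i < n \<Longrightarrow> e i = (\<Sum>kj\<in>{..<l} \<times> {..<p}. \<nu> kj * (case kj of (k, j) \<Rightarrow> (shift ^^ k) (out_row j)) i)"
  proof (rule row_space_duality[of "{..<l} \<times> {..<p}" "\<lambda>(k, j). (shift ^^ k) (out_row j)" n e])
    fix q assume q: "\<And>kj. kj \<in> {..<l} \<times> {..<p} \<Longrightarrow> (\<Sum>i<n. (case kj of (k, j) \<Rightarrow> (shift ^^ k) (out_row j)) i * q i) = 0"
    have "(\<Sum>i<n. (shift ^^ k) (out_row j) i * vec n q $ i) = 0" if "k < l" "j < p" for k j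
      using q[of "(k, j)"] that by simp
    then have "obs_mat n p A C l *\<^sub>v vec n q = 0\<^sub>v (l * p)"
      unfolding obs_mat_kernel[OF vec_carrier] by blast
    then have q0: "vec n q = 0\<^sub>v n" by (intro obs) auto
    have "q i = 0" if "i < n" for i
    proof -
      have "vec n q $ i = 0" unfolding q0 using that by simp
      then show ?thesis using that by simp
    qed
    then show "(\<Sum>j<n. e j * q j) = 0" by simp
  qed auto
  show thesis
    by (rule that[of "\<lambda>k j. \<nu> (k, j)"]) (simp add: \<nu> sum.cartesian_product split_beta)
qed

definition bounded_row :: "(nat \<Rightarrow> real poly) \<Rightarrow> bool" where
  "bounded_row r \<longleftrightarrow> (\<forall>j<m. \<forall>i\<ge>L. coeff (r j) i = 0) \<and> (\<forall>j<p. \<forall>i\<ge>K. coeff (r (m + j)) i = 0)"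

lemma coeff_row_input_eq_0:
  assumes u: "\<And>i. N \<le> i \<Longrightarrow> coeff (r j) i = 0" and y: "\<And>k i. k < p \<Longrightarrow> N \<le> i \<Longrightarrow> coeff (r (m + k)) i = 0"
    and i: "N \<le> i"
  shows "coeff (row_input r j) i = 0"
proof -
  have "coeff (input_part (r (m + k)) (out_row k) j) i = 0" if "k < p" for k
  proof (rule coeff_input_part_eq_0)
    have "degree (r (m + k)) \<le> N" by (rule degree_le) (use y[OF that] in auto)
    then show "degree (r (m + k)) \<le> i" using i by simp
  qed
  then show ?thesis using u y i by (simp add: row_input_def coeff_sum)
qed

lemma coeff_complete_row_eq_0:
  assumes y: "\<And>k i. k < p \<Longrightarrow> N \<le> i \<Longrightarrow> coeff (g k) i = 0" and j: "j < m" and i: "N \<le> i"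
  shows "coeff (complete_row g j) i = 0"
proof -
  have "coeff (input_part (g k) (out_row k) j) i = 0" if "k < p" for k
  proof (rule coeff_input_part_eq_0)
    have "degree (g k) \<le> N" by (rule degree_le) (use y[OF that] in auto)
    then show "degree (g k) \<le> i" using i by simp
  qed
  then show ?thesis using y i j by (simp add: complete_row_def coeff_sum)
qed

text \<open>Higher derivatives of the output are eliminated using the dependence of \<open>C A\<^sup>l\<close> on the rows of the
  observability matrix.\<close>

lemma ann_null_row_if_bounded:
  assumes w: "w \<in> L2_vec (m + p)" and ann: "\<And>r. null_row r \<Longrightarrow> bounded_row r \<Longrightarrow> ann (m + p) w r"
  shows "null_row r \<Longrightarrow> ann (m + p) w r"
proof -
  \<comment> \<open>For each output j this is a combination of output derivatives up to order l
    without state part, whose coefficient at s^l is the j-th unit vector. Such combinations lower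
    output degrees as long as these are at least l.\<close>
  have "\<exists>g. (\<forall>i<n. (\<Sum>k<p. state_part (g k) (out_row k) i) = 0) \<and>
      (\<forall>k<p. coeff (g k) l = (if k = j then 1 else 0) \<and> (\<forall>i>l. coeff (g k) i = 0))" if j: "j < p" for j
  proof -
    obtain \<nu> where \<nu>: "\<And>i. i < n \<Longrightarrow> - (shift ^^ l) (out_row j) i = (\<Sum>k<l. \<Sum>j<p. \<nu> k j * (shift ^^ k) (out_row j) i)"
      using obs_span[of "\<lambda>i. - (shift ^^ l) (out_row j) i"] by blast
    define \<mu> where "\<mu> k i = (if i < l then \<nu> i k else if k = j then 1 else 0)" for k i
    define g where "g k = (\<Sum>i<Suc l. monom (\<mu> k i) i)" for k
    have coeff: "coeff (g k) i = (if i < Suc l then \<mu> k i else 0)" for k i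
      unfolding g_def by (simp only: coeff_sum coeff_monom) simp
    have "(\<Sum>k<p. state_part (g k) (out_row k) i) = 0" if i: "i < n" for i
    proof -
      have "(\<Sum>k<p. state_part (g k) (out_row k) i) = (\<Sum>k<p. \<Sum>q<Suc l. \<mu> k q * (shift ^^ q) (out_row k) i)"
        unfolding g_def state_part_monom_sum ..
      also have "\<dots> = (\<Sum>k<p. \<Sum>q<l. \<nu> q k * (shift ^^ q) (out_row k) i) + (\<Sum>k<p. if k = j then (shift ^^ l) (out_row k) i else 0)"
        unfolding sum.distrib[symmetric] by (intro sum.cong refl) (simp add: \<mu>_def)
      also have "(\<Sum>k<p. \<Sum>q<l. \<nu> q k * (shift ^^ q) (out_row k) i) = - (shift ^^ l) (out_row j) i"
        unfolding \<nu>[OF i] by (rule sum.swap)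
      finally show ?thesis using j by simp
    qed
    then show ?thesis by (intro exI[of _ g]) (auto simp: coeff \<mu>_def)
  qed
  then have "\<forall>j\<in>{..<p}. \<exists>g. (\<forall>i<n. (\<Sum>k<p. state_part (g k) (out_row k) i) = 0) \<and>
      (\<forall>k<p. coeff (g k) l = (if k = j then 1 else 0) \<and> (\<forall>i>l. coeff (g k) i = 0))"
    by (simp only: lessThan_iff Ball_def) (intro allI impI)
  from bchoice[OF this] obtain g where g_all:
    "\<forall>j\<in>{..<p}. (\<forall>i<n. (\<Sum>k<p. state_part (g j k) (out_row k) i) = 0) \<and>
      (\<forall>k<p. coeff (g j k) l = (if k = j then 1 else 0) \<and> (\<forall>i>l. coeff (g j k) i = 0))"
    by (elim exE)
  have g: "(\<Sum>k<p. state_part (g j k) (out_row k) i) = 0" if "j < p" "i < n" for j i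
    using g_all that by simp
  have g': "coeff (g j k) l = (if k = j then 1 else 0)" "l < i \<Longrightarrow> coeff (g j k) i = 0" if "j < p" "k < p" for j k i
    using g_all that by simp_all
  define s where "s j = complete_row (g j)" for j
  have s_null: "null_row (s j)" if "j < p" for j
    unfolding null_row_def s_def using row_state_complete_row row_input_complete_row g[OF that] by simp
  have s_out: "s j (m + k) = g j k" for j k by (simp add: s_def complete_row_def)
  have "bounded_row (s j)" if j: "j < p" for j
    unfolding bounded_row_def
  proof (intro conjI allI impI)
    show "coeff (s j k) i = 0" if "k < m" "L \<le> i" for k i
      unfolding s_def
    proof (rule coeff_complete_row_eq_0[where N = "Suc l"])
      show "\<And>k i. k < p \<Longrightarrow> Suc l \<le> i \<Longrightarrow> coeff (g j k) i = 0" using g'(2)[OF j] by (simp add: Suc_le_eq)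
    qed (use that lK KL in auto)
    show "coeff (s j (m + k)) i = 0" if "k < p" "K \<le> i" for k i
      unfolding s_out using g'(2)[OF j that(1), of i] that lK by simp
  qed
  then have s_ann: "ann (m + p) w (s j)" if "j < p" for j using ann s_null that by blast
  \<comment> \<open>Induction on a strict bound N for the output degrees, starting from K.\<close>
  have main: "null_row r \<Longrightarrow> (\<forall>j<p. \<forall>i\<ge>N. coeff (r (m + j)) i = 0) \<Longrightarrow> ann (m + p) w r" if "K \<le> N" for N r
    using that
  proof (induction N arbitrary: r rule: dec_induct)
    case base
    have "coeff (r j) i = 0" if j: "j < m" and i: "L \<le> i" for j i
    proof -
      \<comment> \<open>r' is r without its own input entry j. The equation
        \<open>row_input r j = 0\<close> then bounds this entry by the output degrees, which are
        below K \<le> L.\<close>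
      define r' where "r' k = (if k = j then 0 else r k)" for k
      have r': "r' (m + k) = r (m + k)" for k using j by (simp add: r'_def)
      have "row_input r j = r j + row_input r' j"
        unfolding row_input_def r' by (simp add: r'_def)
      moreover have "row_input r j = 0" using base(1) j by (simp add: null_row_def)
      moreover have "coeff (row_input r' j) i = 0"
        by (rule coeff_row_input_eq_0[where N = K]) (use base(2) r' i KL in \<open>auto simp: r'_def\<close>)
      ultimately have "coeff (r j + row_input r' j) i = 0" by simp
      then show ?thesis using \<open>coeff (row_input r' j) i = 0\<close> by simp
    qed
    then have "bounded_row r" using base(2) by (simp add: bounded_row_def)
    then show ?case using ann base(1) by blast
  next
    case (step N)
    \<comment> \<open>The factor s^(N - l) moves the unit vector at s^l to s^N, where these
      multiples together cancel the top output coefficients of r.\<close>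
    define \<tau> where "\<tau> k j = monom (coeff (r (m + k)) N) (N - l) * s k j" for k j
    have \<tau>_null: "null_row (\<tau> k)" if "k < p" for k
      unfolding \<tau>_def[abs_def] by (rule null_row_mult[OF s_null[OF that]])
    have \<tau>_ann: "ann (m + p) w (\<tau> k)" if "k < p" for k
      unfolding \<tau>_def[abs_def] by (rule ann_mult[OF s_ann[OF that]])
    define r' where "r' j = r j + (-1) * (\<Sum>k<p. \<tau> k j)" for j
    have sum_null: "null_row (\<lambda>j. \<Sum>k<q. \<tau> k j)" if "q \<le> p" for q
      using that
    proof (induction q)
      case 0
      show ?case using null_row_mult[OF step.prems(1), of 0] by simp
    next
      case (Suc q)
      then show ?case using null_row_add[OF _ \<tau>_null[of q], of "\<lambda>j. \<Sum>k<q. \<tau> k j"] by simp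
    qed
    have "null_row r'"
      unfolding r'_def by (intro null_row_add step.prems null_row_mult sum_null) simp
    moreover have "coeff (r' (m + j)) i = 0" if j: "j < p" and i: "N \<le> i" for j i
    proof -
      have "l \<le> i" "l \<le> N" using step.hyps lK i by auto
      have "coeff (\<tau> k (m + j)) i = (if i = N \<and> k = j then coeff (r (m + j)) N else 0)" if k: "k < p" for k
      proof -
        have "coeff (\<tau> k (m + j)) i = coeff (r (m + k)) N * coeff (g k j) (i - (N - l))"
          using i \<open>l \<le> N\<close> by (simp add: \<tau>_def s_out coeff_monom_mult)
        then show ?thesis
          using g'(1)[OF k j] g'(2)[OF k j, of "i - (N - l)"] i \<open>l \<le> N\<close> by (cases "i = N") auto
      qed
      then have "coeff (r' (m + j)) i = coeff (r (m + j)) i - (if i = N then coeff (r (m + j)) N else 0)"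
        using j by (simp add: r'_def coeff_sum)
      then show ?thesis using step.prems(2) j i by auto
    qed
    ultimately have "ann (m + p) w r'" by (intro step.IH) auto
    moreover have "ann (m + p) w (\<lambda>j. \<Sum>k<p. \<tau> k j)" by (rule ann_sum[OF w]) (use \<tau>_ann in simp)
    ultimately have "ann (m + p) w (\<lambda>j. r' j + (\<Sum>k<p. \<tau> k j))" by (rule ann_add[OF w])
    then show ?case by (simp add: r'_def)
  qed
  assume r: "null_row r"
  define N where "N = K + Suc (\<Sum>j<p. degree (r (m + j)))"
  have "coeff (r (m + j)) i = 0" if "j < p" "N \<le> i" for j i
  proof (rule coeff_eq_0)
    have "degree (r (m + j)) \<le> (\<Sum>j<p. degree (r (m + j)))" by (rule member_le_sum) (use that in auto)
    then show "degree (r (m + j)) < i" using that by (simp add: N_def)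
  qed
  then show "ann (m + p) w r" by (intro main[of N] r) (auto simp: N_def)
qed

section \<open>Coefficient vectors of bounded rows and the dimension count\<close>

definition coeff_row :: "real vec \<Rightarrow> nat \<Rightarrow> real poly" where
  "coeff_row v j = (if j < m then block_poly m L (\<lambda>a. v $ a) j else block_poly p K (\<lambda>a. v $ (L * m + a)) (j - m))"

definition row_coeffs :: "(nat \<Rightarrow> real poly) \<Rightarrow> real vec" where
  "row_coeffs r = vec (L * m + K * p) (\<lambda>a. if a < L * m then coeff (r (a mod m)) (a div m)
     else coeff (r (m + (a - L * m) mod p)) ((a - L * m) div p))"

lemma row_coeffs_carrier: "row_coeffs r \<in> carrier_vec (L * m + K * p)"
  by (simp add: row_coeffs_def)

lemma bounded_coeff_row: "bounded_row (coeff_row v)"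
  by (auto simp: bounded_row_def coeff_row_def coeff_block_poly)

lemma coeff_row_row_coeffs:
  assumes r: "bounded_row r" and j: "j < m + p" shows "coeff_row (row_coeffs r) j = r j"
proof (rule poly_eqI)
  fix i
  show "coeff (coeff_row (row_coeffs r) j) i = coeff (r j) i"
  proof (cases "j < m")
    case True
    then show ?thesis
      using r block_index[of i L j m] by (auto simp: coeff_row_def coeff_block_poly row_coeffs_def bounded_row_def)
  next
    case False
    define k where "k = j - m"
    have k: "j = m + k" "k < p" using False j by (auto simp: k_def)
    show ?thesis
      using r k block_index[of i K k p] by (auto simp: coeff_row_def coeff_block_poly row_coeffs_def bounded_row_def)
  qed
qed

lemma null_row_cong: "(\<And>j. j < m + p \<Longrightarrow> r j = r' j) \<Longrightarrow> null_row r \<longleftrightarrow> null_row r'"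
  by (simp add: null_row_def row_state_def row_input_def)

lemma Lam2_index:
  "a < L * m \<Longrightarrow> Lam2 m p L K u y t $ a = Lam m L u t $ a"
  "a < K * p \<Longrightarrow> Lam2 m p L K u y t $ (L * m + a) = Lam p K y t $ a"
  by (simp_all add: Lam2_def col_fun_def Lam_def)

lemma Lam2_L2I:
  assumes u: "weakly_regular L m u" and y: "weakly_regular K p y" and a: "a < L * m + K * p"
  shows "(\<lambda>t. Lam2 m p L K u y t $ a) \<in> L2I"
proof (cases "a < L * m")
  case True
  then show ?thesis using Lam_L2I[OF u True] by (simp add: Lam2_index)
next
  case False
  define k where "k = a - L * m"
  have k: "a = L * m + k" "k < K * p" using False a by (auto simp: k_def)
  show ?thesis unfolding k(1) Lam2_index(2)[OF k(2)] by (rule Lam_L2I[OF y k(2)])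
qed

lemma combination_Lam2:
  assumes u: "weakly_regular L m u" and y: "weakly_regular K p y"
  shows "(AE t in MI. combination (L * m + K * p) (Lam2 m p L K u y) v t = 0) \<longleftrightarrow> ann (m + p) (col_fun u y) (coeff_row v)"
proof -
  have "(\<Sum>a<L * m + K * p. v $ a * pairing (\<lambda>t. Lam2 m p L K u y t $ a) \<phi>) =
      (\<Sum>j<m + p. pairing (\<lambda>t. col_fun u y t $ j) (dop (coeff_row v j) \<phi>))" if \<phi>: "test \<phi>" for \<phi>
  proof -
    have L2: "u \<in> L2_vec m" "y \<in> L2_vec p" using u y by (auto simp: weakly_regular_def)
    have "(\<Sum>a<L * m + K * p. v $ a * pairing (\<lambda>t. Lam2 m p L K u y t $ a) \<phi>) =
      (\<Sum>a<L * m. v $ a * pairing (\<lambda>t. Lam m L u t $ a) \<phi>) + (\<Sum>a<K * p. v $ (L * m + a) * pairing (\<lambda>t. Lam p K y t $ a) \<phi>)"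
      unfolding sum_lessThan_add by (simp add: Lam2_index)
    also have "\<dots> = (\<Sum>j<m. pairing (\<lambda>t. u t $ j) (dop (coeff_row v j) \<phi>)) +
        (\<Sum>j<p. pairing (\<lambda>t. y t $ j) (dop (coeff_row v (m + j)) \<phi>))"
      unfolding pairing_Lam[OF u \<phi>] pairing_Lam[OF y \<phi>] by (simp add: coeff_row_def)
    finally show ?thesis unfolding pairing_col_fun[OF L2] .
  qed
  moreover have "(AE t in MI. combination (L * m + K * p) (Lam2 m p L K u y) v t = 0) \<longleftrightarrow>
      (\<forall>\<phi>. test \<phi> \<longrightarrow> (\<Sum>a<L * m + K * p. v $ a * pairing (\<lambda>t. Lam2 m p L K u y t $ a) \<phi>) = 0)"
    by (rule combination_AE_iff) (rule Lam2_L2I[OF u y])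
  ultimately show ?thesis by (simp add: ann_def)
qed

lemma mem_behavior_bounded:
  assumes w: "w \<in> L2_vec (m + p)"
  shows "w \<in> \<B> \<longleftrightarrow> (\<forall>v \<in> carrier_vec (L * m + K * p). null_row (coeff_row v) \<longrightarrow> ann (m + p) w (coeff_row v))"
proof
  assume "w \<in> \<B>"
  then show "\<forall>v \<in> carrier_vec (L * m + K * p). null_row (coeff_row v) \<longrightarrow> ann (m + p) w (coeff_row v)"
    using mem_behavior_iff[of w] by blast
next
  assume *: "\<forall>v \<in> carrier_vec (L * m + K * p). null_row (coeff_row v) \<longrightarrow> ann (m + p) w (coeff_row v)"
  have "ann (m + p) w r" if r: "null_row r" "bounded_row r" for r
  proof -
    have "null_row (coeff_row (row_coeffs r)) \<longleftrightarrow> null_row r"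
      by (rule null_row_cong) (rule coeff_row_row_coeffs[OF r(2)])
    moreover have "ann (m + p) w (coeff_row (row_coeffs r)) \<longleftrightarrow> ann (m + p) w r"
      by (rule ann_cong) (rule coeff_row_row_coeffs[OF r(2)])
    ultimately show ?thesis using * r(1) row_coeffs_carrier by blast
  qed
  then show "w \<in> \<B>" unfolding mem_behavior_iff[of w] using ann_null_row_if_bounded[OF w] w by blast
qed

text \<open>The linear map \<open>v \<mapsto> (row_input (coeff_row v), row_state (coeff_row v))\<close> in coordinates.\<close>

definition row_image :: "real vec \<Rightarrow> nat \<Rightarrow> real" where
  "row_image v a = (if a < L * m then coeff (row_input (coeff_row v) (a mod m)) (a div m) else row_state (coeff_row v) (a - L * m))"

text \<open>For a bounded row, \<open>row_input\<close> has no coefficients from L on, since K \<le>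
  L and input parts do not raise degrees; so finitely many coordinates decide.\<close>

lemma null_row_image: "null_row (coeff_row v) \<longleftrightarrow> (\<forall>a<L * m + n. row_image v a = 0)"
proof
  assume "null_row (coeff_row v)"
  then show "\<forall>a<L * m + n. row_image v a = 0"
    using block_div_mod[of _ L m] by (auto simp: row_image_def null_row_def)
next
  assume *: "\<forall>a<L * m + n. row_image v a = 0"
  have "row_input (coeff_row v) j = 0" if j: "j < m" for j
  proof (rule poly_eqI)
    fix i
    show "coeff (row_input (coeff_row v) j) i = coeff 0 i"
    proof (cases "i < L")
      case True
      then have "row_image v (i * m + j) = 0" using * block_index[OF True j] by simp
      then show ?thesis using block_index[OF True j] j by (simp add: row_image_def)
    next
      case False
      have "coeff (row_input (coeff_row v) j) i = 0"
        by (rule coeff_row_input_eq_0[where N = L])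
          (use bounded_coeff_row[of v] j False KL in \<open>auto simp: bounded_row_def\<close>)
      then show ?thesis by simp
    qed
  qed
  moreover have "row_state (coeff_row v) i = 0" if "i < n" for i
    using *[rule_format, of "L * m + i"] that by (simp add: row_image_def)
  ultimately show "null_row (coeff_row v)" by (simp add: null_row_def)
qed

lemma coeff_row_lin:
  assumes v: "v \<in> carrier_vec (L * m + K * p)" and j: "j < m + p"
  shows "coeff_row v j = (\<Sum>b<L * m + K * p. [:v $ b:] * coeff_row (unit_vec (L * m + K * p) b) j)"
proof (rule poly_eqI)
  fix i
  let ?N = "L * m + K * p"
  have unit: "(\<Sum>b<?N. v $ b * (unit_vec ?N b :: real vec) $ a) = v $ a" if "a < ?N" for a
  proof -
    have "(\<Sum>b<?N. v $ b * (unit_vec ?N b :: real vec) $ a) = (\<Sum>b<?N. if b = a then v $ b else 0)"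
      by (rule sum.cong) (use that in auto)
    then show ?thesis using that by simp
  qed
  show "coeff (coeff_row v j) i = coeff (\<Sum>b<?N. [:v $ b:] * coeff_row (unit_vec ?N b) j) i"
  proof (cases "j < m")
    case jm: True
    show ?thesis
    proof (cases "i < L")
      case True
      then have idx: "i * m + j < ?N" using block_index[OF True jm] by simp
      have "coeff (coeff_row v j) i = v $ (i * m + j)" using True jm by (simp add: coeff_row_def coeff_block_poly)
      also note unit[OF idx, symmetric]
      finally show ?thesis using True jm by (simp add: coeff_sum coeff_row_def coeff_block_poly)
    qed (use jm in \<open>simp add: coeff_sum coeff_row_def coeff_block_poly\<close>)
  next
    case jm: False
    show ?thesis
    proof (cases "i < K")
      case True
      have "j - m < p" using jm j by simp
      then have idx: "L * m + (i * p + (j - m)) < ?N"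
        by (intro add_strict_left_mono block_index[OF True])
      have "coeff (coeff_row v j) i = v $ (L * m + (i * p + (j - m)))" using True jm by (simp add: coeff_row_def coeff_block_poly)
      also note unit[OF idx, symmetric]
      finally show ?thesis using True jm by (simp add: coeff_sum coeff_row_def coeff_block_poly)
    qed (use jm in \<open>simp add: coeff_sum coeff_row_def coeff_block_poly\<close>)
  qed
qed

lemma row_image_lin:
  assumes v: "v \<in> carrier_vec (L * m + K * p)" and a: "a < L * m + n"
  shows "row_image v a = (\<Sum>b<L * m + K * p. v $ b * row_image (unit_vec (L * m + K * p) b) a)"
proof -
  let ?N = "L * m + K * p"
  define \<rho> where "\<rho> b = coeff_row (unit_vec ?N b)" for b
  \<comment> \<open>Scalars are written as constant polynomials so that the product formulas for
    \<open>row_state\<close> and \<open>row_input\<close> apply.\<close>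
  have sums: "row_state (\<lambda>j. \<Sum>b<M. [:v $ b:] * \<rho> b j) i = (\<Sum>b<M. v $ b * row_state (\<rho> b) i)"
    "row_input (\<lambda>j. \<Sum>b<M. [:v $ b:] * \<rho> b j) i = (\<Sum>b<M. Polynomial.smult (v $ b) (row_input (\<rho> b) i))" for M i
  proof (induction M)
    case 0
    show "row_state (\<lambda>j. \<Sum>b<0. [:v $ b:] * \<rho> b j) i = (\<Sum>b<0. v $ b * row_state (\<rho> b) i)" by (simp add: row_state_def)
    show "row_input (\<lambda>j. \<Sum>b<0. [:v $ b:] * \<rho> b j) i = (\<Sum>b<0. Polynomial.smult (v $ b) (row_input (\<rho> b) i))" by (simp add: row_input_def)
  next
    case (Suc M)
    show "row_state (\<lambda>j. \<Sum>b<Suc M. [:v $ b:] * \<rho> b j) i = (\<Sum>b<Suc M. v $ b * row_state (\<rho> b) i)"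
      using Suc(1) row_state_add[of "\<lambda>j. \<Sum>b<M. [:v $ b:] * \<rho> b j" "\<lambda>j. [:v $ M:] * \<rho> M j" i]
        row_state_mult[of "[:v $ M:]" "\<rho> M" i] by (simp add: state_part_pCons)
    show "row_input (\<lambda>j. \<Sum>b<Suc M. [:v $ b:] * \<rho> b j) i = (\<Sum>b<Suc M. Polynomial.smult (v $ b) (row_input (\<rho> b) i))"
      using Suc(2) row_input_add[of "\<lambda>j. \<Sum>b<M. [:v $ b:] * \<rho> b j" "\<lambda>j. [:v $ M:] * \<rho> M j" i]
        row_input_mult[of "[:v $ M:]" "\<rho> M" i] by (simp add: input_part_pCons)
  qed
  have eq: "coeff_row v j = (\<Sum>b<?N. [:v $ b:] * \<rho> b j)" if "j < m + p" for j
    unfolding \<rho>_def by (rule coeff_row_lin[OF v that])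
  have "row_state (coeff_row v) i = (\<Sum>b<?N. v $ b * row_state (\<rho> b) i)" for i
    unfolding sums[symmetric] by (simp add: row_state_def eq)
  moreover have "row_input (coeff_row v) i = (\<Sum>b<?N. Polynomial.smult (v $ b) (row_input (\<rho> b) i))" if "i < m" for i
    unfolding sums[symmetric] using that by (simp add: row_input_def eq)
  ultimately show ?thesis
    using block_div_mod[of a L m] by (simp add: row_image_def coeff_sum \<rho>_def)
qed

text \<open>Input coordinates are reached by a monomial in a single input entry. State coordinates
  are reached by observability: a unit functional is a combination of rows of C A^k with k < l, and
  completing it by an input part keeps all input coordinates zero.\<close>

lemma row_image_surj:
  assumes a: "a < L * m + n"
  obtains v where "v \<in> carrier_vec (L * m + K * p)" "\<And>b. b < L * m + n \<Longrightarrow> row_image v b = (if b = a then 1 else 0)"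
proof -
  note result = that
  have from_row: thesis if r: "bounded_row r" and eq: "\<And>b. b < L * m + n \<Longrightarrow>
      (if b < L * m then coeff (row_input r (b mod m)) (b div m) else row_state r (b - L * m)) = (if b = a then 1 else 0)" for r
  proof (rule result[OF row_coeffs_carrier[of r]])
    fix b assume b: "b < L * m + n"
    have "row_state (coeff_row (row_coeffs r)) i = row_state r i" for i
      by (simp add: row_state_def coeff_row_row_coeffs[OF r])
    moreover have "row_input (coeff_row (row_coeffs r)) i = row_input r i" if "i < m" for i
      using that by (simp add: row_input_def coeff_row_row_coeffs[OF r])
    ultimately have "row_image (row_coeffs r) b = (if b < L * m then coeff (row_input r (b mod m)) (b div m) else row_state r (b - L * m))"
      using block_div_mod[of b L m] by (simp add: row_image_def)
    then show "row_image (row_coeffs r) b = (if b = a then 1 else 0)" using eq[OF b] by simp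
  qed
  show thesis
  proof (cases "a < L * m")
    case True
    then have am: "a div m < L" "a mod m < m" using block_div_mod by auto
    define r where "r j = (if j = a mod m then monom 1 (a div m) else (0 :: real poly))" for j
    have ry: "r (m + j) = 0" for j using am by (simp add: r_def)
    show thesis
    proof (rule from_row[of r])
      show "bounded_row r" unfolding bounded_row_def using am by (auto simp: r_def coeff_monom)
      fix b assume "b < L * m + n"
      have "row_state r i = 0" for i by (simp add: row_state_def ry)
      moreover have "row_input r i = r i" for i by (simp add: row_input_def ry)
      moreover have "b = a \<longleftrightarrow> b mod m = a mod m \<and> b div m = a div m" by (metis div_mult_mod_eq)
      ultimately show "(if b < L * m then coeff (row_input r (b mod m)) (b div m) else row_state r (b - L * m)) = (if b = a then 1 else 0)"
        using True by (auto simp: r_def coeff_monom)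
    qed
  next
    case False
    obtain \<nu> where \<nu>: "\<And>i. i < n \<Longrightarrow> (if i = a - L * m then 1 else 0) = (\<Sum>k<l. \<Sum>j<p. \<nu> k j * (shift ^^ k) (out_row j) i)"
      using obs_span[of "\<lambda>i. if i = a - L * m then 1 else 0"] by blast
    define g where "g j = (\<Sum>k<l. monom (\<nu> k j) k)" for j
    have gc: "coeff (g j) i = 0" if "l \<le> i" for i j using that by (auto simp: g_def coeff_sum coeff_monom intro!: sum.neutral)
    have st: "row_state (complete_row g) i = (if i = a - L * m then 1 else 0)" if "i < n" for i
      unfolding row_state_complete_row g_def state_part_monom_sum \<nu>[OF that] by (rule sum.swap)
    show thesis
    proof (rule from_row[of "complete_row g"])
      show "bounded_row (complete_row g)"
        unfolding bounded_row_def
      proof (intro conjI allI impI)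
        show "coeff (complete_row g j) i = 0" if "j < m" "L \<le> i" for j i
          by (rule coeff_complete_row_eq_0[where N = l]) (use gc that lK KL in auto)
        show "coeff (complete_row g (m + j)) i = 0" if "K \<le> i" for j i
          using gc[of i j] that lK by (simp add: complete_row_def)
      qed
      fix b assume b: "b < L * m + n"
      show "(if b < L * m then coeff (row_input (complete_row g) (b mod m)) (b div m) else row_state (complete_row g) (b - L * m)) = (if b = a then 1 else 0)"
        using b False block_div_mod[of b L m] by (auto simp: row_input_complete_row st)
    qed
  qed
qed

text \<open>This is the origin of the number L m + n: the matrix of \<open>row_image\<close> is
  onto, preimages of the unit vectors form the section S, and the kernel consists of the coefficient
  vectors of null rows.\<close>

lemma row_image_splitting:
  obtains T S where "splitting (L * m + n) (L * m + K * p) T S"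
    "\<And>v. v \<in> carrier_vec (L * m + K * p) \<Longrightarrow> T *\<^sub>v v = 0\<^sub>v (L * m + n) \<longleftrightarrow> null_row (coeff_row v)"
proof -
  let ?N = "L * m + K * p" and ?R = "L * m + n"
  define T where "T = mat ?R ?N (\<lambda>(a, b). row_image (unit_vec ?N b) a)"
  have T: "T \<in> carrier_mat ?R ?N" by (simp add: T_def)
  have Tv: "(T *\<^sub>v v) $ a = row_image v a" if "v \<in> carrier_vec ?N" "a < ?R" for v a
    unfolding mult_mat_vec_index[OF T that] row_image_lin[OF that] using that by (simp add: T_def mult.commute)
  have "\<exists>v. v \<in> carrier_vec ?N \<and> (\<forall>b<?R. row_image v b = (if b = a then 1 else 0))" if "a < ?R" for a
    using row_image_surj[OF that] by blast
  then obtain \<sigma> where \<sigma>: "\<And>a. a < ?R \<Longrightarrow> \<sigma> a \<in> carrier_vec ?N"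
    "\<And>a b. a < ?R \<Longrightarrow> b < ?R \<Longrightarrow> row_image (\<sigma> a) b = (if b = a then 1 else 0)" by metis
  define S where "S = mat ?N ?R (\<lambda>(b, a). \<sigma> a $ b)"
  have S: "S \<in> carrier_mat ?N ?R" by (simp add: S_def)
  have "T * S = 1\<^sub>m ?R"
  proof (rule eq_matI)
    fix b a assume "b < dim_row (1\<^sub>m ?R)" "a < dim_col (1\<^sub>m ?R)"
    then have ba: "b < ?R" "a < ?R" by auto
    have "(T * S) $$ (b, a) = (T *\<^sub>v \<sigma> a) $ b"
      unfolding mult_mat_index[OF T S ba] mult_mat_vec_index[OF T \<sigma>(1)[OF ba(2)] ba(1)]
      by (rule sum.cong) (use ba in \<open>auto simp: S_def\<close>)
    then show "(T * S) $$ (b, a) = 1\<^sub>m ?R $$ (b, a)" using Tv[OF \<sigma>(1)] \<sigma>(2) ba by simp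
  qed (use T S in auto)
  then have "splitting ?R ?N T S" using T S by (simp add: splitting_def)
  moreover have "T *\<^sub>v v = 0\<^sub>v ?R \<longleftrightarrow> null_row (coeff_row v)" if v: "v \<in> carrier_vec ?N" for v
    unfolding null_row_image
  proof
    assume 0: "T *\<^sub>v v = 0\<^sub>v ?R"
    show "\<forall>a<?R. row_image v a = 0"
    proof (intro allI impI)
      fix a assume a: "a < ?R"
      have "(T *\<^sub>v v) $ a = 0" unfolding 0 using a by simp
      then show "row_image v a = 0" using Tv[OF v a] by simp
    qed
  next
    assume "\<forall>a<?R. row_image v a = 0"
    then show "T *\<^sub>v v = 0\<^sub>v ?R" by (intro eq_vecI) (use Tv[OF v] T in auto)
  qed
  ultimately show thesis using that by blast
qed

section \<open>The excited trajectory\<close>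

context
  fixes u y :: "real \<Rightarrow> real vec"
  assumes pe: "persistently_exciting m (L + n) u" and uy: "col_fun u y \<in> \<B>"
    and uy_carrier: "\<forall>t\<in>\<I>. u t \<in> carrier_vec m \<and> y t \<in> carrier_vec p"
begin

lemma excited_L2: "u \<in> L2_vec m" "y \<in> L2_vec p"
proof -
  show u: "u \<in> L2_vec m" using pe by (simp add: persistently_exciting_def sobolev_def)
  have w: "col_fun u y \<in> L2_vec (m + p)" using mem_behavior_iff[of "col_fun u y"] uy by blast
  have "(\<lambda>t. y t $ j) \<in> L2I" if j: "j < p" for j
  proof -
    have eq: "col_fun u y t $ (m + j) = y t $ j" if "t \<in> \<I>" for t
    proof -
      have "u t \<in> carrier_vec m" "y t \<in> carrier_vec p" using uy_carrier that by blast+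
      then show ?thesis using j by (simp add: col_fun_def)
    qed
    have "(\<lambda>t. col_fun u y t $ (m + j)) \<in> L2I" by (rule L2_vec_comp[OF w]) (use j in simp)
    then show ?thesis unfolding L2I_def mem_Collect_eq
      by (subst measurable_cong[of MI _ "\<lambda>t. col_fun u y t $ (m + j)"], simp add: eq)
        (subst Bochner_Integration.integrable_cong[of MI MI _ "\<lambda>t. (norm (col_fun u y t $ (m + j)))\<^sup>2"], auto simp: eq)
  qed
  then show "y \<in> L2_vec p" using uy_carrier by (simp add: L2_vec_def L2_scalar_eq)
qed

lemma excited_input_regular: "weakly_regular (L + n) m u"
  using pe by (intro sobolev_weakly_regular[of _ "L + n - 1"]) (auto simp: persistently_exciting_def)

text \<open>The output satisfies a monic scalar equation \<open>\<chi>(d/dt) y\<^sub>j = \<zeta>(d/dt) u\<close> with \<open>deg \<zeta> \<le> deg \<chi> \<le> n\<close>.\<close>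

lemma excited_output_regular: "weakly_regular K p y"
  unfolding weakly_regular_def
proof (intro conjI allI impI excited_L2)
  fix i j assume i: "i < K" and j: "j < p"
  obtain \<chi> where \<chi>: "\<chi> \<noteq> 0" "lead_coeff \<chi> = 1" "degree \<chi> \<le> n" "\<And>i. i < n \<Longrightarrow> state_part \<chi> (out_row j) i = 0"
    using monic_annihilator[of "out_row j"] by blast
  \<comment> \<open>The factor s^i turns the scalar equation for y_j into one for its i-th
    derivative.\<close>
  define g where "g k = (if k = j then monom 1 i * \<chi> else 0)" for k
  have st: "(\<Sum>k<p. state_part (g k) (out_row k) q) = 0" if q: "q < n" for q
  proof -
    have "state_part (monom 1 i * \<chi>) (out_row j) q = 0"
      using q state_part_cong[of "state_part \<chi> (out_row j)" "\<lambda>_. 0" q "monom 1 i"] \<chi>(4)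
      by (simp add: state_part_mult state_part_zero_fun)
    then show ?thesis by (intro sum.neutral) (auto simp: g_def)
  qed
  define r where "r = complete_row g"
  have null: "null_row r"
    unfolding null_row_def r_def using row_state_complete_row row_input_complete_row st by simp
  \<comment> \<open>Since i < K \<le> L, the degree i + n stays below L + n, so the completed row
    uses only input derivatives that excitation provides.\<close>
  have gdeg: "coeff (g k) q = 0" if "L + n \<le> q" for k q
  proof -
    have "degree (monom 1 i * \<chi>) \<le> i + n"
      using degree_mult_le[of "monom 1 i" \<chi>] degree_monom_le[of "1::real" i] \<chi>(3) by linarith
    then show ?thesis using that i KL by (auto simp: g_def intro!: coeff_eq_0)
  qed
  have rdeg: "coeff (r k) q = 0" if "k < m" "L + n \<le> q" for k q
    unfolding r_def by (rule coeff_complete_row_eq_0[where N = "L + n"]) (use gdeg that in auto)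
  have uL: "(\<lambda>t. u t $ k) \<in> L2I" if "k < m" for k by (rule L2_vec_comp[OF excited_L2(1) that])
  have yL: "(\<lambda>t. y t $ j) \<in> L2I" by (rule L2_vec_comp[OF excited_L2(2) j])
  define F where "F t = - (\<Sum>k<m. \<Sum>q<L + n. coeff (r k) q * weak_deriv q (\<lambda>s. u s $ k) t)" for t
  have D: "weak_deriv q (\<lambda>s. u s $ k) \<in> L2I" if "k < m" "q < L + n" for k q
    by (rule weakly_regular_deriv(1)[OF excited_input_regular that(2,1)])
  have F: "F \<in> L2I"
  proof -
    have "(\<lambda>t. \<Sum>k<m. \<Sum>q<L + n. coeff (r k) q * weak_deriv q (\<lambda>s. u s $ k) t) \<in> L2I"
      by (intro L2I_sum L2I_cmult D) auto
    from L2I_cmult[OF this, of "-1"] show ?thesis by (simp add: F_def[abs_def])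
  qed
  \<comment> \<open>T is the i-th distributional derivative of y_j. It satisfies \<chi>(d/dt) T = F
    with F square integrable, so \<open>regularity\<close> represents T by a square integrable
    function.\<close>
  define T where "T \<phi> = pairing (\<lambda>t. y t $ j) ((neg_deriv ^^ i) \<phi>)" for \<phi>
  have Tm: "T \<phi> = pairing (\<lambda>t. y t $ j) (dop (monom 1 i) \<phi>)" for \<phi>
    unfolding T_def dop_monom[abs_def] by simp
  have "test_linear T"
    unfolding Tm[abs_def] by (intro test_linear_dop test_linear_pairing yL)
  moreover have "T (dop \<chi> \<phi>) = pairing F \<phi>" if \<phi>: "test \<phi>" for \<phi>
  proof -
    have "ann (m + p) (col_fun u y) r" using mem_behavior_iff[of "col_fun u y"] uy null by blast
    then have "(\<Sum>k<m. pairing (\<lambda>t. u t $ k) (dop (r k) \<phi>)) + (\<Sum>k<p. pairing (\<lambda>t. y t $ k) (dop (r (m + k)) \<phi>)) = 0"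
      using \<phi> unfolding ann_def pairing_col_fun[OF excited_L2] by blast
    moreover have "(\<Sum>k<p. pairing (\<lambda>t. y t $ k) (dop (r (m + k)) \<phi>)) = T (dop \<chi> \<phi>)"
    proof -
      have "(\<Sum>k<p. pairing (\<lambda>t. y t $ k) (dop (r (m + k)) \<phi>)) = (\<Sum>k<p. if k = j then T (dop \<chi> \<phi>) else 0)"
        by (rule sum.cong) (auto simp: r_def complete_row_def g_def Tm dop_mult[OF test_smooth[OF \<phi>]])
      then show ?thesis using j by simp
    qed
    moreover have "(\<Sum>k<m. pairing (\<lambda>t. u t $ k) (dop (r k) \<phi>)) = - pairing F \<phi>"
    proof -
      have sm: "smooth \<phi>" by (rule test_smooth[OF \<phi>])
      have "(\<Sum>k<m. pairing (\<lambda>t. u t $ k) (dop (r k) \<phi>)) =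
          (\<Sum>k<m. \<Sum>q<L + n. coeff (r k) q * pairing (weak_deriv q (\<lambda>s. u s $ k)) \<phi>)"
      proof (rule sum.cong[OF refl])
        fix k assume "k \<in> {..<m}"
        then have k: "k < m" by simp
        have "pairing (\<lambda>t. u t $ k) (dop (r k) \<phi>) = (\<Sum>q<L + n. coeff (r k) q * pairing (\<lambda>t. u t $ k) ((neg_deriv ^^ q) \<phi>))"
          by (rule pairing_dop_weak[OF uL[OF k] \<phi>]) (rule rdeg[OF k])
        then show "pairing (\<lambda>t. u t $ k) (dop (r k) \<phi>) = (\<Sum>q<L + n. coeff (r k) q * pairing (weak_deriv q (\<lambda>s. u s $ k)) \<phi>)"
          by (simp add: weakly_regular_deriv(2)[OF excited_input_regular _ k \<phi>])
      qed
      also have "\<dots> = (\<Sum>k<m. pairing (\<lambda>t. \<Sum>q<L + n. coeff (r k) q * weak_deriv q (\<lambda>s. u s $ k) t) \<phi>)"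
        by (intro sum.cong refl, subst pairing_sum_left) (auto simp: pairing_cmult_left intro!: L2I_cmult D sm)
      also have "\<dots> = pairing (\<lambda>t. \<Sum>k<m. \<Sum>q<L + n. coeff (r k) q * weak_deriv q (\<lambda>s. u s $ k) t) \<phi>"
        by (rule pairing_sum_left[symmetric]) (auto intro!: L2I_sum L2I_cmult D sm)
      also have "\<dots> = - pairing F \<phi>"
        using pairing_cmult_left[of "-1" F \<phi>] by (simp add: F_def)
      finally show ?thesis .
    qed
    ultimately show ?thesis by simp
  qed
  ultimately obtain f where "f \<in> L2I" "\<And>\<phi>. test \<phi> \<Longrightarrow> T \<phi> = pairing f \<phi>"
    using regularity[OF \<chi>(1) _ F, of T] by blast
  then show "\<exists>g\<in>L2I. is_weak_deriv i (\<lambda>t. y t $ j) g" by (auto simp: is_weak_deriv_iff T_def)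
qed

text \<open>
  If \<open>r\<close> annihilates the excited trajectory and \<open>\<chi>\<close> annihilates the state part of \<open>r\<close>, then \<open>\<chi> r\<close> acts
  as an operator \<open>\<zeta>(d/dt)\<close> of order below \<open>L + n\<close> on the input alone, so \<open>\<zeta> = 0\<close> by excitation.
\<close>

lemma excited_ann_null_row:
  assumes r: "bounded_row r" and ann: "ann (m + p) (col_fun u y) r"
  shows "null_row r"
proof -
  have w: "col_fun u y \<in> L2_vec (m + p)" by (rule col_fun_L2_vec[OF excited_L2])
  obtain \<chi> where \<chi>: "\<chi> \<noteq> 0" "lead_coeff \<chi> = 1" "degree \<chi> \<le> n" "\<And>i. i < n \<Longrightarrow> state_part \<chi> (row_state r) i = 0"
    using monic_annihilator[of "row_state r"] by blast
  define \<zeta> where "\<zeta> j = row_input (\<lambda>j. \<chi> * r j) j" for j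
  \<comment> \<open>With z the row \<chi> r + z has neither state nor input part, so it is an
    equation of the behavior; subtracting \<chi> r leaves an equation for u alone.\<close>
  define z where "z j = (if j < m then - \<zeta> j else 0)" for j
  have zy: "z (m + j) = 0" for j by (simp add: z_def)
  have z_state: "row_state z i = 0" for i by (simp add: row_state_def zy)
  have z_input: "row_input z i = - \<zeta> i" if "i < m" for i using that by (simp add: row_input_def zy) (simp add: z_def)
  have "null_row (\<lambda>j. \<chi> * r j + z j)"
    unfolding null_row_def row_state_add row_input_add
    using \<chi>(4) by (simp add: row_state_mult z_state z_input \<zeta>_def)
  then have "ann (m + p) (col_fun u y) (\<lambda>j. \<chi> * r j + z j)"
    using mem_behavior_iff[of "col_fun u y"] uy by blast
  from ann_add[OF w this ann_mult[OF ann, of "- \<chi>"]]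
  have "ann (m + p) (col_fun u y) z" by simp
  then have z_ann: "ann m u z"
    unfolding ann_def pairing_col_fun[OF excited_L2] by (simp add: zy)
  \<comment> \<open>\<open>row_input r\<close> has degree below L and \<chi> has degree at most n,
    which is why excitation of order L + n suffices.\<close>
  have z_deg: "coeff (z j) i = 0" if j: "j < m" and i: "L + n \<le> i" for j i
  proof -
    have row_deg: "coeff (row_input r j) q = 0" if "L \<le> q" for q
      by (rule coeff_row_input_eq_0[where N = L]) (use r j that KL in \<open>auto simp: bounded_row_def\<close>)
    have "coeff (\<chi> * row_input r j) i = 0"
      unfolding coeff_mult
    proof (intro sum.neutral ballI)
      fix q assume q: "q \<in> {..i}"
      show "coeff \<chi> q * coeff (row_input r j) (i - q) = 0"
      proof (cases "q \<le> n")
        case True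
        then show ?thesis using row_deg i by simp
      next
        case False
        then show ?thesis using \<chi>(3) by (simp add: coeff_eq_0)
      qed
    qed
    moreover have "coeff (input_part \<chi> (row_state r) j) i = 0"
      by (rule coeff_input_part_eq_0) (use \<chi>(3) i in simp)
    ultimately show ?thesis using j by (simp add: z_def \<zeta>_def row_input_mult)
  qed
  have "z j = 0" if "j < m" for j
    by (rule persistently_exciting_annihilator[OF pe z_deg z_ann that])
  then have "\<zeta> j = 0" if "j < m" for j using that by (simp add: z_def)
  then have "null_row (\<lambda>j. \<chi> * r j)"
    unfolding null_row_def using \<chi>(4) by (simp add: row_state_mult \<zeta>_def)
  then show ?thesis by (rule null_row_torsion_free[OF \<chi>(1)])
qed

text \<open>A kernel vector is a bounded row annihilating the excited trajectory, which is null by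
  excitation; conversely null rows annihilate every trajectory. Regularity of the output makes the
  entries of the Gramian meaningful.\<close>

lemma excited_gramian_kernel:
  assumes v: "v \<in> carrier_vec (L * m + K * p)"
  shows "Gam2 m p L K u y *\<^sub>v v = 0\<^sub>v (L * m + K * p) \<longleftrightarrow> null_row (coeff_row v)"
proof -
  have reg: "weakly_regular L m u" using excited_input_regular by (auto simp: weakly_regular_def)
  have "Gam2 m p L K u y *\<^sub>v v = 0\<^sub>v (L * m + K * p) \<longleftrightarrow>
      (AE t in MI. combination (L * m + K * p) (Lam2 m p L K u y) v t = 0)"
    unfolding Gam2_def by (rule gramian_kernel[OF _ v]) (rule Lam2_L2I[OF reg excited_output_regular])
  also have "\<dots> \<longleftrightarrow> ann (m + p) (col_fun u y) (coeff_row v)"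
    by (rule combination_Lam2[OF reg excited_output_regular])
  also have "\<dots> \<longleftrightarrow> null_row (coeff_row v)"
    using excited_ann_null_row[OF bounded_coeff_row] mem_behavior_iff[of "col_fun u y"] uy by blast
  finally show ?thesis .
qed

lemma excited_rank: "vec_space.rank (L * m + K * p) (Gam2 m p L K u y) = L * m + n"
proof -
  obtain T S where TS: "splitting (L * m + n) (L * m + K * p) T S"
    "\<And>v. v \<in> carrier_vec (L * m + K * p) \<Longrightarrow> T *\<^sub>v v = 0\<^sub>v (L * m + n) \<longleftrightarrow> null_row (coeff_row v)"
    using row_image_splitting by blast
  show ?thesis
  proof (rule rank_splitting(1)[OF _ TS(1)])
    show "Gam2 m p L K u y \<in> carrier_mat (L * m + K * p) (L * m + K * p)"
      unfolding Gam2_def by (rule gramian_carrier)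
  qed (simp add: TS(2) excited_gramian_kernel)
qed

lemma fundamental_lemma:
  assumes "u' \<in> sobolev (L - 1) m" "y' \<in> sobolev (L - 1) p"
  shows "col_fun u' y' \<in> \<B> \<longleftrightarrow>
    (\<exists>g \<in> L2_vec (L * m + K * p). AE t in MI. Lam2 m p L K u' y' t = Gam2 m p L K u y *\<^sub>v g t)"
proof -
  have reg: "weakly_regular L m u" using excited_input_regular by (auto simp: weakly_regular_def)
  have reg': "weakly_regular L m u'" "weakly_regular K p y'"
    using assms KL by (auto intro: sobolev_weakly_regular)
  have L2: "u' \<in> L2_vec m" "y' \<in> L2_vec p" using reg' by (auto simp: weakly_regular_def)
  have car: "Lam2 m p L K u' y' t \<in> carrier_vec (L * m + K * p)" for t
    by (simp add: Lam2_def col_fun_def Lam_def)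
  have "col_fun u' y' \<in> \<B> \<longleftrightarrow> (\<forall>v \<in> carrier_vec (L * m + K * p). null_row (coeff_row v) \<longrightarrow>
      ann (m + p) (col_fun u' y') (coeff_row v))"
    by (rule mem_behavior_bounded[OF col_fun_L2_vec[OF L2]])
  also have "\<dots> \<longleftrightarrow> (\<forall>v \<in> carrier_vec (L * m + K * p). Gam2 m p L K u y *\<^sub>v v = 0\<^sub>v (L * m + K * p) \<longrightarrow>
      (AE t in MI. combination (L * m + K * p) (Lam2 m p L K u' y') v t = 0))"
    by (simp add: excited_gramian_kernel combination_Lam2[OF reg'])
  also have "\<dots> \<longleftrightarrow> (\<exists>g \<in> L2_vec (L * m + K * p). AE t in MI. Lam2 m p L K u' y' t = Gam2 m p L K u y *\<^sub>v g t)"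
    unfolding Gam2_def
    by (rule in_gramian_image_iff[symmetric, OF Lam2_L2I[OF reg excited_output_regular] Lam2_L2I[OF reg'] car])
  finally show ?thesis .
qed

end

end

theorem theorem21:
  fixes m p L K :: nat
    and \<B> :: "(real \<Rightarrow> real vec) set"
    and ubar ybar :: "real \<Rightarrow> real vec"
  assumes "linear_differential_behavior (m + p) \<B>"
    and "\<exists>n A B C D. iso_representation m p \<B> n A B C D"
    and "controllable \<B>"
    and "lag m p \<B> + 1 \<le> L"
    and "\<forall>t\<in>\<I>. ubar t \<in> carrier_vec m \<and> ybar t \<in> carrier_vec p"
    and "col_fun ubar ybar \<in> \<B>"
    and "persistently_exciting m (L + mcmillan_degree m p \<B>) ubar"
    and "lag m p \<B> + 1 \<le> K" and "K \<le> L"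
  shows "(\<forall>u \<in> sobolev (L - 1) m. \<forall>y \<in> sobolev (L - 1) p.
            col_fun u y \<in> \<B> \<longleftrightarrow>
            (\<exists>g \<in> L2_vec (L * m + K * p).
               AE t\<in>\<I> in lebesgue. Lam2 m p L K u y t = Gam2 m p L K ubar ybar *\<^sub>v g t)) \<and>
         vec_space.rank (L * m + K * p) (Gam2 m p L K ubar ybar) = L * m + mcmillan_degree m p \<B>"
proof -
  obtain A B C D where rep: "representation (mcmillan_degree m p \<B>) m p A B C D \<B>"
    and obs: "\<And>x. x \<in> carrier_vec (mcmillan_degree m p \<B>) \<Longrightarrow>
      obs_mat (mcmillan_degree m p \<B>) p A C (lag m p \<B>) *\<^sub>v x = 0\<^sub>v (lag m p \<B> * p) \<Longrightarrow> x = 0\<^sub>v (mcmillan_degree m p \<B>)"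
    using minimal_representation[OF assms(1,2)] by blast
  interpret representation "mcmillan_degree m p \<B>" m p A B C D \<B> by (rule rep)
  interpret observable_representation "mcmillan_degree m p \<B>" m p A B C D \<B> "lag m p \<B>" L K
    by unfold_locales (use assms obs in auto)
  show ?thesis
    unfolding AE_I using fundamental_lemma[OF assms(7,6,5)] excited_rank[OF assms(7,6,5)] by blast
qed

end
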